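(* Let $k\ge 1$ be an integer. Suppose that $\theta$ is in the interior of $\Theta$, that $\hat\theta_n$ satisfies $\sqrt n\,|\hat\theta_n-\theta|=O_P(1)$, and that $\lim_{x\to 0}x^{-\zeta}P\{|\varepsilon_0|\le x\}=0$ for some $\zeta>0$. If $E|\varepsilon_0|^k<\infty$, then, as $n\to\infty$, $$\sup_{0\le u\le 1}\frac{1}{\sqrt n}\left|\bigl(\hat S_n^{(k)}(u)-u\hat S_n^{(k)}(1)\bigr)-\bigl(S_n^{(k)}(u)-uS_n^{(k)}(1)\bigr)\right|=o_P(1).$$
   Context: Model. Let $p,q\ge 1$ be integers and $\theta=(\alpha_0,\alpha_1,\dots,\alpha_p,\beta_1,\dots,\beta_q)$ with $\alpha_0>0$, $\alpha_i\ge 0$, $\beta_j\ge 0$. Let $\{\varepsilon_t\}_{t\in\mathbb Z}$ be i.i.d. random variables with mean $0$ and variance $1$. $\{X_t\}_{t\in\mathbb Z}$ is a GARCH$(p,q)$ sequence: $X_t=\sigma_t\varepsilon_t$, $\sigma_t^2=\alpha_0+\sum_{i=1}^p\alpha_iX_{t-i}^2+\sum_{j=1}^q\beta_j\sigma_{t-j}^2$. Standing assumption: the Bougerol–Picard conditions hold, under which these equations have a unique strictly stationary solution, with $\sigma_t$ a function of $\varepsilon_{t-1},\varepsilon_{t-2},\dots$; $\{X_t\}$ is this solution. Notation. $|\cdot|$ is the maximum norm of vectors. For $\mathbf u=(s_0,\dots,s_p,t_1,\dots,t_q)\in\mathbb R^{p+q+1}$ put $c_0(\mathbf u)=s_0/(1-(t_1+\cdots+t_q))$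 and, recursively for $i\ge 1$, $c_i(\mathbf u)=s_i+\sum_{j=1}^{\min(i-1,q)}t_jc_{i-j}(\mathbf u)$ if $i\le p$, and $c_i(\mathbf u)=\sum_{j=1}^{\min(i-1,q)}t_jc_{i-j}(\mathbf u)$ if $i>p$. Fix $0<\underline u<\bar u$, $0<\rho_0<1$ with $q\underline u<\rho_0$, and let $\Theta$ be the set of $\mathbf u$ with $t_1+\cdots+t_q\le\rho_0$ and all coordinates of $\mathbf u$ in $[\underline u,\bar u]$. The conditional variance satisfies $\sigma_t^2=c_0(\theta)+\sum_{i=1}^\infty c_i(\theta)X_{t-i}^2$. Residuals. $\hat\theta_n$ is an estimator of $\theta$ based on $X_0,\dots,X_n$. For $1\le t\le n$, $\hat\sigma_t^2=c_0(\hat\theta_n)+\sum_{i=1}^tc_i(\hat\theta_n)X_{t-i}^2$ and $\hat\varepsilon_t=X_t/\hat\sigma_t$. For $0\le u\le1$, $\hat S_n^{(k)}(u)=\sum_{t=1}^{[nu]}\hat\varepsilon_t^k$ and $S_n^{(k)}(u)=\sum_{t=1}^{[nu]}\varepsilon_t^k$. *)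

theory Defs
  imports "HOL-Probability.Probability" "Jordan_Normal_Form.Matrix"
begin

text \<open>A parameter vector \<open>(s\<^sub>0,\<dots>,s\<^sub>p,t\<^sub>1,\<dots>,t\<^sub>q)\<close> of the Euclidean space of dimension
  \<open>p+q+1\<close> is an element \<open>u\<close> of \<open>{..p+q} \<rightarrow>\<^sub>E UNIV\<close>, with \<open>s\<^sub>i = u i\<close> and \<open>t\<^sub>j = u (p+j)\<close>.
  The topology is \<open>product_topology\<close> and the Borel structure is \<open>Pi\<^sub>M\<close>, both over \<open>{..p+q}\<close>.\<close>

definition maxnorm :: "nat \<Rightarrow> (nat \<Rightarrow> real) \<Rightarrow> real" where
  "maxnorm d u = Max ((\<lambda>i. \<bar>u i\<bar>) ` {..d})"

definition Theta :: "nat \<Rightarrow> nat \<Rightarrow> real \<Rightarrow> real \<Rightarrow> real \<Rightarrow> (nat \<Rightarrow> real) set" where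
  "Theta p q ul uu \<rho>0 =
    {u \<in> {..p+q} \<rightarrow>\<^sub>E UNIV. (\<Sum>j=1..q. u (p + j)) \<le> \<rho>0 \<and> (\<forall>i\<le>p+q. ul \<le> u i \<and> u i \<le> uu)}"

fun garch_c :: "nat \<Rightarrow> nat \<Rightarrow> (nat \<Rightarrow> real) \<Rightarrow> nat \<Rightarrow> real" where
  "garch_c p q u i =
    (if i = 0 then u 0 / (1 - (\<Sum>j=1..q. u (p + j)))
     else (if i \<le> p then u i else 0) + (\<Sum>j=1..min (i - 1) q. u (p + j) * garch_c p q u (i - j)))"

declare garch_c.simps [simp del]

definition strictly_stationary :: "'a measure \<Rightarrow> 'b measure \<Rightarrow> (int \<Rightarrow> 'a \<Rightarrow> 'b) \<Rightarrow> bool" where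
  "strictly_stationary M N Y \<longleftrightarrow>
    (\<forall>t. Y t \<in> measurable M N) \<and>
    (\<forall>h. distr M (\<Pi>\<^sub>M t\<in>UNIV. N) (\<lambda>\<omega> t. Y (t + h) \<omega>) = distr M (\<Pi>\<^sub>M t\<in>UNIV. N) (\<lambda>\<omega> t. Y t \<omega>))"

definition iid_family :: "'a measure \<Rightarrow> (int \<Rightarrow> 'a \<Rightarrow> real) \<Rightarrow> bool" where
  "iid_family M \<epsilon> \<longleftrightarrow>
    prob_space.indep_vars M (\<lambda>_. borel) \<epsilon> UNIV \<and>
    (\<forall>t. distr M borel (\<epsilon> t) = distr M borel (\<epsilon> 0))"

definition garch_equations ::
  "'a measure \<Rightarrow> nat \<Rightarrow> nat \<Rightarrow> (nat \<Rightarrow> real) \<Rightarrow>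
   (int \<Rightarrow> 'a \<Rightarrow> real) \<Rightarrow> (int \<Rightarrow> 'a \<Rightarrow> real) \<Rightarrow> (int \<Rightarrow> 'a \<Rightarrow> real) \<Rightarrow> bool" where
  "garch_equations M p q \<theta> \<epsilon> X \<sigma> \<longleftrightarrow>
    (\<forall>t. AE \<omega> in M.
      \<sigma> t \<omega> \<ge> 0 \<and>
      X t \<omega> = \<sigma> t \<omega> * \<epsilon> t \<omega> \<and>
      (\<sigma> t \<omega>)\<^sup>2 = \<theta> 0 + (\<Sum>i=1..p. \<theta> i * (X (t - int i) \<omega>)\<^sup>2)
                      + (\<Sum>j=1..q. \<theta> (p + j) * (\<sigma> (t - int j) \<omega>)\<^sup>2))"

definition causal :: "'a measure \<Rightarrow> (int \<Rightarrow> 'a \<Rightarrow> real) \<Rightarrow> (int \<Rightarrow> 'a \<Rightarrow> real) \<Rightarrow> bool" where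
  "causal M \<epsilon> \<sigma> \<longleftrightarrow>
    (\<exists>f \<in> borel_measurable (\<Pi>\<^sub>M i\<in>(UNIV :: nat set). borel).
      \<forall>t. AE \<omega> in M. \<sigma> t \<omega> = f (\<lambda>i. \<epsilon> (t - 1 - int i) \<omega>))"

definition garch_stationary_solution ::
  "'a measure \<Rightarrow> nat \<Rightarrow> nat \<Rightarrow> (nat \<Rightarrow> real) \<Rightarrow>
   (int \<Rightarrow> 'a \<Rightarrow> real) \<Rightarrow> (int \<Rightarrow> 'a \<Rightarrow> real) \<Rightarrow> (int \<Rightarrow> 'a \<Rightarrow> real) \<Rightarrow> bool" where
  "garch_stationary_solution M p q \<theta> \<epsilon> X \<sigma> \<longleftrightarrow>
    garch_equations M p q \<theta> \<epsilon> X \<sigma> \<and>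
    strictly_stationary M (borel \<Otimes>\<^sub>M borel) (\<lambda>t \<omega>. (X t \<omega>, \<sigma> t \<omega>)) \<and>
    causal M \<epsilon> \<sigma>"

text \<open>The random matrix, of size \<open>p+q-1\<close>, of the recursion \<open>Y\<^sub>t = A\<^sub>t Y\<^bsub>t-1\<^esub> + b\<close>, with \<open>b = (\<alpha>\<^sub>0,0,\<dots>,0)\<close>,
  for the state
  \<open>Y\<^sub>t = (\<sigma>\<^bsub>t+1\<^esub>\<^sup>2,\<dots>,\<sigma>\<^bsub>t-q+2\<^esub>\<^sup>2, X\<^sub>t\<^sup>2,\<dots>,X\<^bsub>t-p+2\<^esub>\<^sup>2)\<close>, as a function of the value \<open>e\<close> of \<open>\<epsilon>\<^sub>t\<close>
  (rows and columns are numbered from 0). The usual block form requires \<open>p,q \<ge> 2\<close>; this one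
  agrees with it there and is meaningful for all \<open>p,q \<ge> 1\<close>.\<close>

definition garch_matrix :: "nat \<Rightarrow> nat \<Rightarrow> (nat \<Rightarrow> real) \<Rightarrow> real \<Rightarrow> real mat" where
  "garch_matrix p q \<theta> e = mat (p + q - 1) (p + q - 1) (\<lambda>(i, j).
    if i = 0 then
      (if j = 0 then \<theta> (p + 1) + \<theta> 1 * e\<^sup>2
       else if j < q then \<theta> (p + j + 1)
       else \<theta> (j - q + 2))
    else if i = q then (if j = 0 then e\<^sup>2 else 0)
    else (if j = i - 1 then 1 else 0))"

text \<open>The operator norm induced by the maximum norm (the maximal absolute row sum); the top
  Lyapunov exponent does not depend on the choice of the operator norm.\<close>

definition row_sum_norm :: "real mat \<Rightarrow> real" where
  "row_sum_norm A = Max ((\<lambda>i. \<Sum>j<dim_col A. \<bar>A $$ (i, j)\<bar>) ` {..<dim_row A})"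

primrec garch_matrix_prod ::
  "nat \<Rightarrow> nat \<Rightarrow> (nat \<Rightarrow> real) \<Rightarrow> (int \<Rightarrow> 'a \<Rightarrow> real) \<Rightarrow> nat \<Rightarrow> 'a \<Rightarrow> real mat" where
  "garch_matrix_prod p q \<theta> \<epsilon> 0 \<omega> = garch_matrix p q \<theta> (\<epsilon> 0 \<omega>)"
| "garch_matrix_prod p q \<theta> \<epsilon> (Suc n) \<omega> =
    garch_matrix_prod p q \<theta> \<epsilon> n \<omega> * garch_matrix p q \<theta> (\<epsilon> (- int (Suc n)) \<omega>)"

text \<open>The infimum over \<open>n \<ge> 0\<close> of \<open>E log \<parallel>A\<^sub>0 A\<^bsub>-1\<^esub> \<dots> A\<^bsub>-n\<^esub>\<parallel> / (n+1)\<close>. The definition is meant for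
  \<open>\<beta>\<^sub>1 > 0\<close> (\<open>\<beta>\<^sub>1 = \<theta> (p+1)\<close>), which holds for every parameter in \<open>Theta\<close> with \<open>ul > 0\<close>: then the norm is at least
  \<open>\<beta>\<^sub>1\<^sup>n\<^sup>+\<^sup>1\<close>, so that the convention \<open>ln 0 = 0\<close> is never used.\<close>

definition top_lyapunov ::
  "'a measure \<Rightarrow> nat \<Rightarrow> nat \<Rightarrow> (nat \<Rightarrow> real) \<Rightarrow> (int \<Rightarrow> 'a \<Rightarrow> real) \<Rightarrow> ereal" where
  "top_lyapunov M p q \<theta> \<epsilon> =
    (INF n. ereal ((LINT \<omega>|M. ln (row_sum_norm (garch_matrix_prod p q \<theta> \<epsilon> n \<omega>))) / real (n + 1)))"

definition bougerol_picard ::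
  "'a measure \<Rightarrow> nat \<Rightarrow> nat \<Rightarrow> (nat \<Rightarrow> real) \<Rightarrow> (int \<Rightarrow> 'a \<Rightarrow> real) \<Rightarrow> bool" where
  "bougerol_picard M p q \<theta> \<epsilon> \<longleftrightarrow>
    integrable M (\<lambda>\<omega>. max 0 (ln (row_sum_norm (garch_matrix p q \<theta> (\<epsilon> 0 \<omega>))))) \<and>
    top_lyapunov M p q \<theta> \<epsilon> < 0"

text \<open>\<open>th n\<close> is a measurable function of the observations \<open>X\<^sub>0,\<dots>,X\<^sub>n\<close>, with values in the whole
  parameter space.\<close>

definition estimator_seq ::
  "'a measure \<Rightarrow> nat \<Rightarrow> (int \<Rightarrow> 'a \<Rightarrow> real) \<Rightarrow> (nat \<Rightarrow> 'a \<Rightarrow> nat \<Rightarrow> real) \<Rightarrow> bool" where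
  "estimator_seq M d X th \<longleftrightarrow>
    (\<forall>n. \<exists>g \<in> measurable (\<Pi>\<^sub>M i\<in>{..n}. borel) (\<Pi>\<^sub>M i\<in>{..d}. borel).
      \<forall>\<omega>\<in>space M. th n \<omega> = g (\<lambda>i\<in>{..n}. X (int i) \<omega>))"

text \<open>In the next two definitions \<open>u\<close> is a parameter and \<open>x\<close> a sample path.\<close>

definition sigma2_hat :: "nat \<Rightarrow> nat \<Rightarrow> (nat \<Rightarrow> real) \<Rightarrow> (int \<Rightarrow> real) \<Rightarrow> nat \<Rightarrow> real" where
  "sigma2_hat p q u x t = garch_c p q u 0 + (\<Sum>i=1..t. garch_c p q u i * (x (int t - int i))\<^sup>2)"

definition residual :: "nat \<Rightarrow> nat \<Rightarrow> (nat \<Rightarrow> real) \<Rightarrow> (int \<Rightarrow> real) \<Rightarrow> nat \<Rightarrow> real" where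
  "residual p q u x t = x (int t) / sqrt (sigma2_hat p q u x t)"

definition partial_sum :: "nat \<Rightarrow> nat \<Rightarrow> (nat \<Rightarrow> real) \<Rightarrow> real \<Rightarrow> real" where
  "partial_sum k n e u = (\<Sum>t=1..nat \<lfloor>real n * u\<rfloor>. e t ^ k)"

definition big_OP_1 :: "'a measure \<Rightarrow> (nat \<Rightarrow> 'a \<Rightarrow> real) \<Rightarrow> bool" where
  "big_OP_1 M Z \<longleftrightarrow>
    (\<forall>n. Z n \<in> borel_measurable M) \<and>
    (\<forall>\<delta>>0. \<exists>K. \<forall>\<^sub>F n in sequentially. measure M {\<omega>\<in>space M. \<bar>Z n \<omega>\<bar> > K} \<le> \<delta>)"

definition little_oP_1 :: "'a measure \<Rightarrow> (nat \<Rightarrow> 'a \<Rightarrow> real) \<Rightarrow> bool" where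
  "little_oP_1 M Z \<longleftrightarrow>
    (\<forall>n. Z n \<in> borel_measurable M) \<and>
    (\<forall>\<delta>>0. (\<lambda>n. measure M {\<omega>\<in>space M. \<bar>Z n \<omega>\<bar> > \<delta>}) \<longlonglongrightarrow> 0)"

end

theory Submission
  imports Defs
begin

text \<open>
  Why the theorem holds. Let \<open>c i\<close> be the weights at the true parameter \<open>\<theta>\<close>, so that
  \<open>\<sigma>\<^sub>t\<^sup>2 = \<Sum>i. c i * x\<^sub>i\<close> with \<open>x\<^sub>0 = 1\<close> and \<open>x\<^sub>i = X\<^bsub>t-i\<^esub>\<^sup>2\<close>. The residual at time \<open>t\<close> is
  \<open>\<epsilon>\<^sub>t (1 + y\<^sub>t)\<^bsup>-1/2\<^esup>\<close>, where \<open>1 + y\<^sub>t\<close> is the ratio of the fitted to the true conditional variance. With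
  \<open>h\<close> the error of the estimator and \<open>g\<^bsub>t,l\<^esub>\<close> the partial derivatives of \<open>ln \<sigma>\<^sub>t\<^sup>2\<close> in the parameter, the
  difference of the \<open>k\<close>-th powers of the residual and of \<open>\<epsilon>\<^sub>t\<close> is
  \<open>- (k / 2) * (\<Sum>l. h l * \<epsilon>\<^sub>t\<^sup>k * g\<^bsub>t,l\<^esub>)\<close> up to terms of second order. The vector \<open>h\<close> does not depend on \<open>t\<close>. By the law
  of large numbers the partial sums of \<open>\<epsilon>\<^sub>t\<^sup>k g\<^bsub>t,l\<^esub>\<close> are linear in time up to \<open>o(n)\<close>, uniformly up to time \<open>n\<close>.
  Passing from \<open>S u\<close> to \<open>S u - u * S 1\<close> cancels linear functions, and \<open>h = O(n\<^bsup>-1/2\<^esup>)\<close> together with the normalization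
  \<open>n\<^bsup>-1/2\<^esup>\<close> turns the rest into \<open>o(1)\<close> (lemmas \<open>bridge_bound\<close> and \<open>bridge_difference_tendsto\<close>).

  The difficulty is that the process may have very heavy tails, so all errors must be measured relative to the variance.

  First, for \<open>i > 0\<close> the weight of index \<open>i\<close> is a polynomial of degree at most \<open>i\<close> in the parameter,
  with nonnegative coefficients. A change of all
  coordinates by a relative amount \<open>\<eta>\<close> changes \<open>c i\<close> by a relative amount of order \<open>i \<eta>\<close>, with a
  second-order remainder of order \<open>i\<^sup>2 \<eta>\<^sup>2\<close> (theorem \<open>c_expansion\<close>); the weight of index 0 is a quotient and is treated directly. Hence \<open>\<bar>y\<^sub>t\<bar>\<close> is at most \<open>\<eta> G\<^sub>t\<close>, where
  \<open>G\<^sub>t = \<Sum>i. C b\<^sup>i c i x\<^sub>i / \<sigma>\<^sub>t\<^sup>2\<close> for some \<open>b > 1\<close> close to 1, apart from the contribution of the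
  unobserved past, which decays geometrically in \<open>t\<close>.

  Second, every summand of \<open>G\<^sub>t\<close> is at most \<open>C b\<^sup>i\<close> times \<open>min 1 (c i x\<^sub>i / c 0)\<close>, and so at most \<open>C b\<^sup>i\<close> times any
  power of \<open>c i x\<^sub>i / c 0\<close> with an exponent in \<open>(0,1]\<close>. Since the weights decay geometrically, \<open>G\<^sub>t\<close> has a finite fourth moment as soon
  as the process has a finite moment of some order, however small (lemma \<open>score_bound_moment\<close>). In particular, for
  \<open>\<eta>\<close> of order \<open>n\<^bsup>-1/2\<^esup>\<close>, all \<open>\<eta> G\<^sub>t\<close> with \<open>t \<le> n\<close> are small with probability tending to 1. Such a moment exists because
  the top Lyapunov exponent is negative: some matrix product has a norm whose \<open>s\<close>-th moment is less than 1, and the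
  recursion of the state then propagates the bound (lemma \<open>fractional_moment\<close>).

  Third, all variables are functions of the noise up to the present, whose law does not depend on the present time. Such
  functions are approximated in mean by functions of finitely many noise variables, for which the law of large numbers is
  Chebyshev's inequality (lemma \<open>weak_law_uniform\<close>).
\<close>

section \<open>The noise sequence and its law\<close>

definition past :: "(int \<Rightarrow> 'a \<Rightarrow> real) \<Rightarrow> int \<Rightarrow> 'a \<Rightarrow> nat \<Rightarrow> real" where
  "past \<epsilon> t \<omega> i = \<epsilon> (t - int i) \<omega>"

text \<open>Sequences list the noise backwards in time, so dropping the first \<open>h\<close> coordinates of the
  sequence seen at time \<open>t\<close> gives the sequence seen at time \<open>t - h\<close>.\<close>

definition tail_from :: "nat \<Rightarrow> (nat \<Rightarrow> 'b) \<Rightarrow> nat \<Rightarrow> 'b" where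
  "tail_from h e i = e (h + i)"

lemma tail_from_past: "tail_from h (past \<epsilon> t \<omega>) = past \<epsilon> (t - int h) \<omega>"
  by (auto simp: tail_from_def past_def algebra_simps)

abbreviation seq_borel :: "(nat \<Rightarrow> real) measure" where
  "seq_borel \<equiv> \<Pi>\<^sub>M i\<in>(UNIV :: nat set). borel"

lemma space_seq_borel: "space seq_borel = UNIV"
  by (simp add: space_PiM)

lemma measurable_seq_borelI:
  assumes "\<And>i. (\<lambda>x. f x i) \<in> borel_measurable N"
  shows "f \<in> measurable N seq_borel"
  by (rule measurable_PiM_single') (use assms in \<open>auto simp: space_PiM\<close>)

lemma measurable_tail_from [measurable]: "tail_from h \<in> measurable seq_borel seq_borel"
  by (rule measurable_seq_borelI) (auto simp: tail_from_def intro!: measurable_component_singleton)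

definition depends_on_first :: "nat \<Rightarrow> ((nat \<Rightarrow> real) \<Rightarrow> 'b) \<Rightarrow> bool" where
  "depends_on_first m H \<longleftrightarrow> (\<forall>e e'. (\<forall>i<m. e i = e' i) \<longrightarrow> H e = H e')"

lemma depends_on_first_mono: "depends_on_first m H \<Longrightarrow> m \<le> m' \<Longrightarrow> depends_on_first m' H"
  unfolding depends_on_first_def by (meson order_less_le_trans)

lemma depends_on_first_comp: "depends_on_first m H \<Longrightarrow> depends_on_first m (\<lambda>e. g (H e))"
  unfolding depends_on_first_def by metis

lemma depends_on_first_comp2:
  "depends_on_first m H \<Longrightarrow> depends_on_first m K \<Longrightarrow> depends_on_first m (\<lambda>e. g (H e) (K e))"
  unfolding depends_on_first_def by metis

locale iid_noise = prob_space M for M :: "'a measure" +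
  fixes \<epsilon> :: "int \<Rightarrow> 'a \<Rightarrow> real"
  assumes iid: "iid_family M \<epsilon>"
begin

definition noise_law :: "real measure" where
  "noise_law = distr M borel (\<epsilon> 0)"

definition past_law :: "(nat \<Rightarrow> real) measure" where
  "past_law = (\<Pi>\<^sub>M i\<in>(UNIV :: nat set). noise_law)"

lemma measurable_noise [measurable]: "\<epsilon> t \<in> borel_measurable M"
  using iid unfolding iid_family_def indep_vars_def by auto

lemma measurable_past [measurable]: "past \<epsilon> t \<in> measurable M seq_borel"
  by (rule measurable_seq_borelI) (simp add: past_def)

lemma sets_noise_law [measurable_cong, simp]: "sets noise_law = sets borel"
  by (simp add: noise_law_def)

lemma sets_past_law [measurable_cong, simp]: "sets past_law = sets seq_borel"
  unfolding past_law_def by (rule sets_PiM_cong) auto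

lemma space_past_law [simp]: "space past_law = UNIV"
  using sets_eq_imp_space_eq[OF sets_past_law] by (simp add: space_seq_borel)

lemma prob_space_noise_law: "prob_space noise_law"
  unfolding noise_law_def by (rule prob_space_distr) simp

text \<open>The sequence seen at any time \<open>t\<close> is an injective reindexing of one i.i.d. family, so its law is
  the same product measure for all \<open>t\<close>. All stationarity arguments below are uses of this fact: a quantity
  attached to time \<open>t\<close> is written as a fixed function of \<open>past \<epsilon> t\<close>.\<close>

lemma distr_past: "distr M seq_borel (past \<epsilon> t) = past_law"
proof -
  have ind: "indep_vars (\<lambda>_. borel) \<epsilon> UNIV"
    and id: "\<And>t. distr M borel (\<epsilon> t) = noise_law"
    using iid unfolding iid_family_def noise_law_def by auto
  let ?P = "\<Pi>\<^sub>M i\<in>(UNIV :: int set). (borel :: real measure)"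
  have joint: "distr M ?P (\<lambda>x i. \<epsilon> i x) = (\<Pi>\<^sub>M i\<in>(UNIV :: int set). noise_law)"
    using ind indep_vars_iff_distr_eq_PiM[of "UNIV :: int set" \<epsilon> "\<lambda>_. borel"] by (simp add: id restrict_def)
  let ?r = "\<lambda>w :: int \<Rightarrow> real. \<lambda>n. w (t - int n)"
  have m: "?r \<in> measurable ?P seq_borel"
    by (rule measurable_seq_borelI) (auto intro!: measurable_component_singleton)
  have m': "(\<lambda>x i. \<epsilon> i x) \<in> measurable M ?P"
    by (rule measurable_PiM_single') (auto simp: space_PiM)
  have "distr M seq_borel (past \<epsilon> t) = distr M seq_borel (?r \<circ> (\<lambda>x i. \<epsilon> i x))"
    by (intro distr_cong) (auto simp: past_def)
  also have "\<dots> = distr (distr M ?P (\<lambda>x i. \<epsilon> i x)) seq_borel ?r"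
    by (rule distr_distr[symmetric, OF m m'])
  also have "\<dots> = distr (\<Pi>\<^sub>M i\<in>(UNIV :: int set). noise_law) (\<Pi>\<^sub>M i\<in>(UNIV :: nat set). noise_law) ?r"
    unfolding joint by (intro distr_cong sets_PiM_cong) auto
  also have "\<dots> = past_law"
    using distr_PiM_reindex[of UNIV "\<lambda>_. noise_law" "\<lambda>n. t - int n" UNIV] prob_space_noise_law
    by (simp add: past_law_def inj_on_def restrict_def)
  finally show ?thesis .
qed

sublocale past: prob_space past_law
  using prob_space_distr[OF measurable_past] by (simp add: distr_past)

lemma prob_UNIV_past [simp]: "past.prob UNIV = 1"
  using past.prob_space by simp

sublocale S: sequence_space noise_law
  using prob_space_noise_law
  by (simp add: sequence_space_def product_prob_space_def product_prob_space_axioms_def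
    product_sigma_finite_def prob_space_imp_sigma_finite)

lemma integral_past:
  fixes F :: "(nat \<Rightarrow> real) \<Rightarrow> real"
  assumes [measurable]: "F \<in> borel_measurable seq_borel"
  shows "(\<integral>\<omega>. F (past \<epsilon> t \<omega>) \<partial>M) = (\<integral>e. F e \<partial>past_law)"
  unfolding distr_past[of t, symmetric] by (rule integral_distr[symmetric]) auto

lemma integrable_past:
  fixes F :: "(nat \<Rightarrow> real) \<Rightarrow> real"
  assumes "integrable past_law F"
  shows "integrable M (\<lambda>\<omega>. F (past \<epsilon> t \<omega>))"
  using integrable_distr[of "past \<epsilon> t" M seq_borel F] assms by (simp add: distr_past)

lemma nn_integral_past:
  assumes [measurable]: "F \<in> borel_measurable seq_borel"
  shows "(\<integral>\<^sup>+\<omega>. F (past \<epsilon> t \<omega>) \<partial>M) = (\<integral>\<^sup>+e. F e \<partial>past_law)"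
  unfolding distr_past[of t, symmetric] by (subst nn_integral_distr) auto

lemma AE_past:
  assumes [measurable]: "Measurable.pred seq_borel P"
  shows "(AE e in past_law. P e) \<longleftrightarrow> (AE \<omega> in M. P (past \<epsilon> t \<omega>))"
  unfolding distr_past[of t, symmetric] by (subst AE_distr_iff) (use assms in \<open>auto simp: space_seq_borel pred_def\<close>)

text \<open>Gluing the first \<open>N\<close> coordinates of one sequence to a second, independent sequence reproduces
  the product measure. Hence a function of the first \<open>N\<close> coordinates is independent of the remaining ones,
  and expectations of products factor; the nonnegative and the integrable version follow.\<close>

lemma distr_comb_seq:
  "distr (past_law \<Otimes>\<^sub>M past_law) past_law (\<lambda>(e, e'). comb_seq N e e') = past_law"
  using S.PiM_comb_seq[of N] by (simp add: past_law_def)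

lemma measurable_comb_seq_past: 
  "(\<lambda>(e, e'). comb_seq N e e') \<in> measurable (past_law \<Otimes>\<^sub>M past_law) past_law"
  using measurable_comb_seq[of N noise_law] by (simp add: past_law_def)

lemma tail_from_comb_seq: "tail_from N (comb_seq N e e') = e'"
  by (auto simp: tail_from_def comb_seq_def)

lemma depends_comb_seq: "depends_on_first N H \<Longrightarrow> H (comb_seq N e e') = H e"
  unfolding depends_on_first_def by (metis comb_seq_less)

lemma nn_integral_head_tail:
  fixes f g :: "(nat \<Rightarrow> real) \<Rightarrow> ennreal"
  assumes [measurable]: "f \<in> borel_measurable seq_borel" "g \<in> borel_measurable seq_borel"
    and f: "depends_on_first N f"
  shows "(\<integral>\<^sup>+e. f e * g (tail_from N e) \<partial>past_law) = (\<integral>\<^sup>+e. f e \<partial>past_law) * (\<integral>\<^sup>+e. g e \<partial>past_law)"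
proof -
  have "(\<integral>\<^sup>+e. f e * g (tail_from N e) \<partial>past_law) =
      (\<integral>\<^sup>+e. f e * g (tail_from N e) \<partial>distr (past_law \<Otimes>\<^sub>M past_law) past_law (\<lambda>(e, e'). comb_seq N e e'))"
    by (simp add: distr_comb_seq)
  also have "\<dots> = (\<integral>\<^sup>+x. f (fst x) * g (snd x) \<partial>(past_law \<Otimes>\<^sub>M past_law))"
    by (subst nn_integral_distr[OF measurable_comb_seq_past])
       (auto simp: case_prod_beta tail_from_comb_seq depends_comb_seq[OF f])
  also have "\<dots> = (\<integral>\<^sup>+e. \<integral>\<^sup>+e'. f e * g e' \<partial>past_law \<partial>past_law)"
    by (subst past.nn_integral_fst[symmetric]) auto
  also have "\<dots> = (\<integral>\<^sup>+e. f e \<partial>past_law) * (\<integral>\<^sup>+e. g e \<partial>past_law)"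
    by (simp add: nn_integral_cmult nn_integral_multc)
  finally show ?thesis .
qed

lemma integrable_head_tail:
  fixes f g :: "(nat \<Rightarrow> real) \<Rightarrow> real"
  assumes int: "integrable past_law f" "integrable past_law g" and f: "depends_on_first N f"
  shows "integrable past_law (\<lambda>e. f e * g (tail_from N e))"
proof -
  have [measurable]: "f \<in> borel_measurable seq_borel" "g \<in> borel_measurable seq_borel"
    using int[THEN borel_measurable_integrable] by (auto simp: measurable_cong_sets[OF sets_past_law refl])
  have nf: "depends_on_first N (\<lambda>e. ennreal (norm (f e)))"
    using f unfolding depends_on_first_def by metis
  have "(\<integral>\<^sup>+e. ennreal (norm (f e * g (tail_from N e))) \<partial>past_law) =
      (\<integral>\<^sup>+e. ennreal (norm (f e)) * ennreal (norm (g (tail_from N e))) \<partial>past_law)"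
    by (simp add: ennreal_mult' abs_mult)
  also have "\<dots> = (\<integral>\<^sup>+e. ennreal (norm (f e)) \<partial>past_law) * (\<integral>\<^sup>+e. ennreal (norm (g e)) \<partial>past_law)"
    by (rule nn_integral_head_tail[OF _ _ nf]) auto
  also have "\<dots> < \<infinity>"
    using int by (simp add: integrable_iff_bounded ennreal_mult_less_top)
  finally show ?thesis
    by (intro integrableI_bounded) auto
qed

lemma integral_head_tail:
  fixes f g :: "(nat \<Rightarrow> real) \<Rightarrow> real"
  assumes int: "integrable past_law f" "integrable past_law g" and f: "depends_on_first N f"
  shows "(\<integral>e. f e * g (tail_from N e) \<partial>past_law) = (\<integral>e. f e \<partial>past_law) * (\<integral>e. g e \<partial>past_law)"
proof -
  have [measurable]: "f \<in> borel_measurable seq_borel" "g \<in> borel_measurable seq_borel"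
    using int[THEN borel_measurable_integrable] by (auto simp: measurable_cong_sets[OF sets_past_law refl])
  interpret P: pair_prob_space past_law past_law ..
  have int2: "integrable (past_law \<Otimes>\<^sub>M past_law) (\<lambda>x. f (fst x) * g (snd x))"
  proof -
    have "integrable (distr (past_law \<Otimes>\<^sub>M past_law) past_law (\<lambda>(e, e'). comb_seq N e e')) (\<lambda>e. f e * g (tail_from N e))"
      unfolding distr_comb_seq by (rule integrable_head_tail[OF int f])
    then show ?thesis
      by (subst (asm) integrable_distr_eq[OF measurable_comb_seq_past])
         (auto simp: case_prod_beta tail_from_comb_seq depends_comb_seq[OF f])
  qed
  have "(\<integral>e. f e * g (tail_from N e) \<partial>past_law) =
      (\<integral>e. f e * g (tail_from N e) \<partial>distr (past_law \<Otimes>\<^sub>M past_law) past_law (\<lambda>(e, e'). comb_seq N e e'))"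
    by (simp add: distr_comb_seq)
  also have "\<dots> = (\<integral>x. f (fst x) * g (snd x) \<partial>(past_law \<Otimes>\<^sub>M past_law))"
    by (subst integral_distr[OF measurable_comb_seq_past])
       (auto simp: case_prod_beta tail_from_comb_seq depends_comb_seq[OF f])
  also have "\<dots> = (\<integral>e. \<integral>e'. f e * g e' \<partial>past_law \<partial>past_law)"
    using P.integral_fst'[OF int2] by simp
  also have "\<dots> = (\<integral>e. f e \<partial>past_law) * (\<integral>e. g e \<partial>past_law)"
    by simp
  finally show ?thesis .
qed

section \<open>Approximation by functions of finitely many coordinates\<close>

text \<open>Approximation in \<open>L\<^sup>1\<close> by bounded functions of finitely many coordinates. Through it, averages of
  arbitrary integrable functions of the past are reduced to averages of finite-range dependent variables.\<close>

definition cylinder_approximable :: "((nat \<Rightarrow> real) \<Rightarrow> real) \<Rightarrow> bool" where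
  "cylinder_approximable F \<longleftrightarrow> (\<forall>\<eta>>0. \<exists>m H B. H \<in> borel_measurable seq_borel \<and> (\<forall>e. \<bar>H e\<bar> \<le> B) \<and>
     depends_on_first m H \<and> (\<integral>e. \<bar>F e - H e\<bar> \<partial>past_law) < \<eta>)"

lemma cylinder_approximableI:
  assumes "\<And>\<eta>. \<eta> > 0 \<Longrightarrow> \<exists>m H B. H \<in> borel_measurable seq_borel \<and> (\<forall>e. \<bar>H e\<bar> \<le> B) \<and>
     depends_on_first m H \<and> (\<integral>e. \<bar>F e - H e\<bar> \<partial>past_law) < \<eta>"
  shows "cylinder_approximable F"
  using assms unfolding cylinder_approximable_def by blast

lemma integrable_bounded_past:
  assumes "H \<in> borel_measurable seq_borel" "\<And>e. \<bar>H e\<bar> \<le> (B::real)"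
  shows "integrable past_law H"
  by (rule past.integrable_const_bound[of _ B])
     (use assms in \<open>auto simp: measurable_cong_sets[OF sets_past_law refl]\<close>)

lemma cylinder_approximable_lincomb:
  assumes F: "integrable past_law F" "cylinder_approximable F"
    and G: "integrable past_law G" "cylinder_approximable G"
  shows "cylinder_approximable (\<lambda>e. a * F e + b * G e)"
proof (rule cylinder_approximableI)
  fix \<eta> :: real assume \<eta>: "\<eta> > 0"
  define \<eta>' where "\<eta>' = \<eta> / (\<bar>a\<bar> + \<bar>b\<bar> + 1)"
  have \<eta>': "\<eta>' > 0" using \<eta> by (auto simp: \<eta>'_def intro!: divide_pos_pos add_nonneg_pos)
  obtain m H B where H [measurable]: "H \<in> borel_measurable seq_borel"
    and HB: "\<And>e. \<bar>H e\<bar> \<le> B" and Hm: "depends_on_first m H"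
    and HF: "(\<integral>e. \<bar>F e - H e\<bar> \<partial>past_law) < \<eta>'"
    using F(2) \<eta>' unfolding cylinder_approximable_def by blast
  obtain m' H' B' where H' [measurable]: "H' \<in> borel_measurable seq_borel"
    and HB': "\<And>e. \<bar>H' e\<bar> \<le> B'" and Hm': "depends_on_first m' H'"
    and HG: "(\<integral>e. \<bar>G e - H' e\<bar> \<partial>past_law) < \<eta>'"
    using G(2) \<eta>' unfolding cylinder_approximable_def by blast
  note [intro] = integrable_bounded_past[OF H HB] integrable_bounded_past[OF H' HB'] F(1) G(1)
  let ?K = "\<lambda>e. a * H e + b * H' e"
  have "(\<integral>e. \<bar>a * F e + b * G e - ?K e\<bar> \<partial>past_law)
      \<le> (\<integral>e. \<bar>a\<bar> * \<bar>F e - H e\<bar> + \<bar>b\<bar> * \<bar>G e - H' e\<bar> \<partial>past_law)"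
  proof (rule integral_mono)
    fix e
    have "a * F e + b * G e - ?K e = a * (F e - H e) + b * (G e - H' e)"
      by (simp add: algebra_simps)
    then show "\<bar>a * F e + b * G e - ?K e\<bar> \<le> \<bar>a\<bar> * \<bar>F e - H e\<bar> + \<bar>b\<bar> * \<bar>G e - H' e\<bar>"
      by (metis abs_mult abs_triangle_ineq)
  qed (auto intro!: integrable_abs Bochner_Integration.integrable_diff Bochner_Integration.integrable_add)
  also have "\<dots> = \<bar>a\<bar> * (\<integral>e. \<bar>F e - H e\<bar> \<partial>past_law) + \<bar>b\<bar> * (\<integral>e. \<bar>G e - H' e\<bar> \<partial>past_law)"
    by (subst Bochner_Integration.integral_add) (auto intro!: Bochner_Integration.integrable_diff)
  also have "\<dots> \<le> \<bar>a\<bar> * \<eta>' + \<bar>b\<bar> * \<eta>'"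
    using HF HG by (intro add_mono mult_left_mono) auto
  also have "\<dots> < (\<bar>a\<bar> + \<bar>b\<bar> + 1) * \<eta>'"
    using \<eta>' by (simp add: algebra_simps)
  also have "\<dots> = \<eta>"
    unfolding \<eta>'_def using abs_ge_zero[of a] abs_ge_zero[of b] by (simp add: field_simps add_nonneg_pos)
  finally have "(\<integral>e. \<bar>a * F e + b * G e - ?K e\<bar> \<partial>past_law) < \<eta>" .
  moreover have "depends_on_first (max m m') ?K"
    using depends_on_first_mono[OF Hm] depends_on_first_mono[OF Hm']
    by (intro depends_on_first_comp2[where g = "\<lambda>x y. a * x + b * y"]) auto
  moreover have "\<bar>?K e\<bar> \<le> \<bar>a\<bar> * B + \<bar>b\<bar> * B'" for e
    using mult_left_mono[OF HB, of "\<bar>a\<bar>" e] mult_left_mono[OF HB', of "\<bar>b\<bar>" e]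
      abs_triangle_ineq[of "a * H e" "b * H' e"] by (simp add: abs_mult)
  ultimately show "\<exists>m H B. H \<in> borel_measurable seq_borel \<and> (\<forall>e. \<bar>H e\<bar> \<le> B) \<and>
     depends_on_first m H \<and> (\<integral>e. \<bar>a * F e + b * G e - H e\<bar> \<partial>past_law) < \<eta>"
    by (intro exI[of _ "max m m'"] exI[of _ ?K] exI[of _ "\<bar>a\<bar> * B + \<bar>b\<bar> * B'"]) auto
qed

lemma cylinder_approximable_limit:
  assumes int: "integrable past_law F" "\<And>i. integrable past_law (G i)"
    and G: "\<And>i. cylinder_approximable (G i)"
    and lim: "(\<lambda>i::nat. \<integral>e. \<bar>F e - G i e\<bar> \<partial>past_law) \<longlonglongrightarrow> 0"
  shows "cylinder_approximable F"
proof (rule cylinder_approximableI)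
  fix \<eta> :: real assume \<eta>: "\<eta> > 0"
  then have "eventually (\<lambda>i. (\<integral>e. \<bar>F e - G i e\<bar> \<partial>past_law) < \<eta> / 2) sequentially"
    using order_tendstoD(2)[OF lim, of "\<eta> / 2"] by simp
  then obtain i where i: "(\<integral>e. \<bar>F e - G i e\<bar> \<partial>past_law) < \<eta> / 2"
    by (auto simp: eventually_sequentially)
  obtain m H B where H [measurable]: "H \<in> borel_measurable seq_borel"
    and HB: "\<And>e. \<bar>H e\<bar> \<le> B" and Hm: "depends_on_first m H"
    and HG: "(\<integral>e. \<bar>G i e - H e\<bar> \<partial>past_law) < \<eta> / 2"
    using G[of i] \<eta> unfolding cylinder_approximable_def by (meson half_gt_zero)
  note [intro] = integrable_bounded_past[OF H HB] int
  have "(\<integral>e. \<bar>F e - H e\<bar> \<partial>past_law) \<le> (\<integral>e. \<bar>F e - G i e\<bar> + \<bar>G i e - H e\<bar> \<partial>past_law)"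
    by (intro integral_mono) (auto intro!: integrable_abs Bochner_Integration.integrable_diff Bochner_Integration.integrable_add)
  also have "\<dots> = (\<integral>e. \<bar>F e - G i e\<bar> \<partial>past_law) + (\<integral>e. \<bar>G i e - H e\<bar> \<partial>past_law)"
    by (intro Bochner_Integration.integral_add) (auto intro!: integrable_abs Bochner_Integration.integrable_diff)
  also have "\<dots> < \<eta>" using i HG by simp
  finally show "\<exists>m H B. H \<in> borel_measurable seq_borel \<and> (\<forall>e. \<bar>H e\<bar> \<le> B) \<and>
     depends_on_first m H \<and> (\<integral>e. \<bar>F e - H e\<bar> \<partial>past_law) < \<eta>"
    using H HB Hm by blast
qed

lemma cylinder_approximable_dominated:
  assumes int: "integrable past_law F" "\<And>i. integrable past_law (G i)" "integrable past_law w"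
    and G: "\<And>i. cylinder_approximable (G i)"
    and lim: "\<And>e. (\<lambda>i. G i e) \<longlonglongrightarrow> F e"
    and dom: "\<And>i e. \<bar>G i e\<bar> \<le> w e"
  shows "cylinder_approximable F"
proof (rule cylinder_approximable_limit[OF int(1,2) G])
  have "(\<lambda>i. \<integral>e. \<bar>F e - G i e\<bar> \<partial>past_law) \<longlonglongrightarrow> (\<integral>e. 0 \<partial>past_law)"
  proof (rule integral_dominated_convergence[where w = "\<lambda>e. \<bar>F e\<bar> + w e"])
    show "AE e in past_law. (\<lambda>i. \<bar>F e - G i e\<bar>) \<longlonglongrightarrow> 0"
    proof (rule AE_I2)
      fix e
      show "(\<lambda>i. \<bar>F e - G i e\<bar>) \<longlonglongrightarrow> 0"
        using tendsto_rabs[OF tendsto_diff[OF tendsto_const[of "F e"] lim[of e]]] by simp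
    qed
    show "AE e in past_law. norm \<bar>F e - G i e\<bar> \<le> \<bar>F e\<bar> + w e" for i
      using dom[of i] by (intro AE_I2) (smt (verit) real_norm_def)
  qed (use int in \<open>auto intro!: borel_measurable_integrable Bochner_Integration.integrable_diff\<close>)
  then show "(\<lambda>i. \<integral>e. \<bar>F e - G i e\<bar> \<partial>past_law) \<longlonglongrightarrow> 0" by simp
qed

lemma cylinder_approximable_const: "cylinder_approximable (\<lambda>e. c)"
  by (rule cylinder_approximableI, rule exI[of _ 0], rule exI[of _ "\<lambda>_. c"], rule exI[of _ "\<bar>c\<bar>"])
     (auto simp: depends_on_first_def)

text \<open>The sets with approximable indicator form a Dynkin system (by the two closure properties above),
  and they contain the cylinder sets, which are stable under intersection and generate the
  \<open>\<sigma>\<close>-algebra.\<close>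

lemma cylinder_approximable_indicator:
  assumes "A \<in> sets past_law"
  shows "cylinder_approximable (indicator A)"
proof -
  have int: "integrable past_law (indicat_real A)" if "A \<in> sets past_law" for A
    using that by (intro past.integrable_const_bound[of _ 1]) (auto simp: indicator_def)
  let ?\<Omega> = "\<Pi>\<^sub>E i\<in>(UNIV :: nat set). space (borel :: real measure)"
  let ?G = "prod_algebra (UNIV :: nat set) (\<lambda>_. borel :: real measure)"
  have sets: "sets past_law = sigma_sets ?\<Omega> ?G" by (simp only: sets_past_law sets_PiM)
  show ?thesis
  proof (rule sigma_sets_induct_disjoint[of ?G ?\<Omega> A])
    show "Int_stable ?G" by (rule Int_stable_prod_algebra)
    show "?G \<subseteq> Pow ?\<Omega>" by (rule prod_algebra_sets_into_space)
    show "A \<in> sigma_sets ?\<Omega> ?G" using assms unfolding sets .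
  next
    fix A assume "A \<in> ?G"
    then obtain J E where A: "A = prod_emb UNIV (\<lambda>_. borel) J (Pi\<^sub>E J E)" "finite J"
      "\<And>i. i \<in> J \<Longrightarrow> E i \<in> sets borel"
      by (elim prod_algebraE) auto
    have mA: "A \<in> sets seq_borel" 
      unfolding sets_PiM using \<open>A \<in> ?G\<close> by (rule sigma_sets.Basic)
    obtain m where m: "\<And>j. j \<in> J \<Longrightarrow> j < m"
      using A(2) finite_nat_bounded[of J] by (meson lessThan_iff subset_iff)
    have inA: "e \<in> A \<longleftrightarrow> (\<forall>j\<in>J. e j \<in> E j)" for e
      by (auto simp: A(1) prod_emb_def space_PiM PiE_iff)
    have dep: "depends_on_first m (indicat_real A)"
      unfolding depends_on_first_def
    proof (intro allI impI)
      fix e e' :: "nat \<Rightarrow> real" assume "\<forall>i<m. e i = e' i"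
      then have "e \<in> A \<longleftrightarrow> e' \<in> A" unfolding inA using m by (metis (no_types))
      then show "indicat_real A e = indicat_real A e'" by (simp add: indicator_def)
    qed
    show "cylinder_approximable (indicator A)"
    proof (rule cylinder_approximableI)
      fix \<eta> :: real assume "\<eta> > 0"
      then show "\<exists>m H B. H \<in> borel_measurable seq_borel \<and> (\<forall>e. \<bar>H e\<bar> \<le> B) \<and>
          depends_on_first m H \<and> (\<integral>e. \<bar>indicat_real A e - H e\<bar> \<partial>past_law) < \<eta>"
        using mA dep by (intro exI[of _ m] exI[of _ "indicat_real A"] exI[of _ 1]) (simp add: indicator_def)
    qed
  next
    have "indicat_real ({} :: (nat \<Rightarrow> real) set) = (\<lambda>_. 0)" by auto
    then show "cylinder_approximable (indicator {})" using cylinder_approximable_const[of 0] by simp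
  next
    fix A assume A: "A \<in> sigma_sets ?\<Omega> ?G" "cylinder_approximable (indicator A)"
    have "cylinder_approximable (\<lambda>e. 1 * 1 + (-1) * indicator A e)"
      by (rule cylinder_approximable_lincomb[OF _ cylinder_approximable_const int[OF A(1)[folded sets]] A(2)]) simp
    moreover have "(\<lambda>e. 1 * 1 + (-1) * indicator A e) = indicat_real (?\<Omega> - A)"
      by (auto simp: indicator_def)
    ultimately show "cylinder_approximable (indicator (?\<Omega> - A))" by (simp only:)
  next
    fix A :: "nat \<Rightarrow> (nat \<Rightarrow> real) set"
    assume A: "disjoint_family A" "range A \<subseteq> sigma_sets ?\<Omega> ?G" "\<And>i. cylinder_approximable (indicator (A i))"
    have mA: "A i \<in> sets past_law" for i unfolding sets using A(2) by (rule subsetD) (rule rangeI)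
    have partial: "cylinder_approximable (indicator (\<Union>i<n. A i))" for n
    proof (induction n)
      case 0
      have "indicat_real (\<Union>i<0::nat. A i) = (\<lambda>_. 0)" by (simp add: fun_eq_iff)
      then show ?case using cylinder_approximable_const[of 0] by (simp only:)
    next
      case (Suc n)
      have "integrable past_law (indicat_real (\<Union>i<n. A i))"
        by (rule int[OF sets.finite_UN[OF _ mA]]) simp
      from cylinder_approximable_lincomb[OF this Suc int[OF mA] A(3), of 1 1 n]
      have "cylinder_approximable (\<lambda>e. 1 * indicator (\<Union>i<n. A i) e + 1 * indicator (A n) e)" .
      moreover have "(\<lambda>e. 1 * indicator (\<Union>i<n. A i) e + 1 * indicator (A n) e) =
          indicat_real (\<Union>i<Suc n. A i)"
      proof
        fix e
        have "e \<notin> (\<Union>i<n. A i)" if "e \<in> A n"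
        proof
          assume "e \<in> (\<Union>i<n. A i)"
          then obtain i where "i < n" "e \<in> A i" by auto
          with that disjoint_family_onD[OF A(1), of i n] show False by auto
        qed
        moreover have "e \<in> (\<Union>i<Suc n. A i) \<longleftrightarrow> e \<in> (\<Union>i<n. A i) \<or> e \<in> A n"
          unfolding lessThan_Suc by blast
        ultimately show "1 * indicator (\<Union>i<n. A i) e + 1 * indicator (A n) e = indicat_real (\<Union>i<Suc n. A i) e"
          unfolding indicator_def by (simp only: if_True if_False) (cases "e \<in> A n"; simp)
      qed
      ultimately show ?case by (simp only:)
    qed
    show "cylinder_approximable (indicator (\<Union> (range A)))"
    proof (rule cylinder_approximable_dominated[where w = "\<lambda>_. 1" and G = "\<lambda>n. indicator (\<Union>i<n. A i)"])
      fix e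
      show "(\<lambda>n. indicat_real (\<Union>i<n. A i) e) \<longlonglongrightarrow> indicator (\<Union> (range A)) e"
        by (rule LIMSEQ_indicator_UN)
    next
      show "integrable past_law (indicat_real (\<Union> (range A)))"
      proof (rule int)
        have "range A \<subseteq> sets past_law" using A(2) unfolding sets .
        then show "\<Union> (range A) \<in> sets past_law" by (rule sets.countable_UN)
      qed
      show "integrable past_law (indicat_real (\<Union>i<n. A i))" for n
        by (rule int[OF sets.finite_UN[OF _ mA]]) simp_all
      show "cylinder_approximable (indicator (\<Union>i<n. A i))" for n by (rule partial)
      show "\<bar>indicat_real (\<Union>i<n. A i) e\<bar> \<le> 1" for n e by (simp add: indicator_def)
    qed simp
  qed
qed

lemma cylinder_approximable:
  assumes "integrable past_law F"
  shows "cylinder_approximable F"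
  using assms
proof (induction rule: integrable_induct)
  case (base A c)
  have base': "cylinder_approximable (\<lambda>e. c * indicator A e + 0 * 0)"
  proof (rule cylinder_approximable_lincomb[OF _ cylinder_approximable_indicator[OF base(1)] _
      cylinder_approximable_const])
    show "integrable past_law (indicat_real A)"
      using base by (intro integrable_real_indicator) auto
  qed simp
  have "(\<lambda>e. indicat_real A e *\<^sub>R c) = (\<lambda>e. c * indicator A e + 0 * 0)" by auto
  with base' show ?case by (simp only:)
next
  case (add f g)
  show ?case using cylinder_approximable_lincomb[OF add(1,3,2,4), of 1 1] unfolding mult_1 .
next
  case (lim f s)
  show ?case
  proof (rule cylinder_approximable_dominated[where G = s and w = "\<lambda>e. 2 * norm (f e)"])
    show "integrable past_law (\<lambda>e. 2 * norm (f e))"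
      by (rule integrable_mult_right[OF integrable_norm[OF lim.hyps(4)]])
    show "integrable past_law f" "\<And>i. integrable past_law (s i)" by (fact lim.hyps)+
    show "cylinder_approximable (s i)" for i by (fact lim.IH)
    show "(\<lambda>i. s i e) \<longlonglongrightarrow> f e" for e by (rule lim.hyps(2)) simp
    show "\<bar>s i e\<bar> \<le> 2 * norm (f e)" for i e
      using lim.hyps(3)[of e i, unfolded space_past_law real_norm_def, OF UNIV_I]
      unfolding real_norm_def .
  qed
qed

end

section \<open>A weak law of large numbers, uniform in time\<close>

lemma (in prob_space) prob_gt_le_expectation:
  assumes u: "integrable M u" "\<And>\<omega>. \<omega> \<in> space M \<Longrightarrow> 0 \<le> u \<omega>" and c: "0 < (c :: real)"
  shows "prob {\<omega>\<in>space M. c < u \<omega>} \<le> expectation u / c"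
proof -
  have [measurable]: "u \<in> borel_measurable M" using u(1) by simp
  have "prob {\<omega>\<in>space M. c < u \<omega>} \<le> prob {\<omega>\<in>space M. c \<le> u \<omega>}"
    by (intro finite_measure_mono) auto
  also have "\<dots> \<le> expectation u / c"
    using integral_Markov_inequality_measure[OF u(1), of "{}" c] u(2) c by simp
  finally show ?thesis .
qed

context iid_noise begin

text \<open>Variables that are at least \<open>m\<close> time steps apart are uncorrelated, so only \<open>O(j)\<close> of the
  \<open>j\<^sup>2\<close> covariances contribute.\<close>

lemma second_moment_finite_range:
  assumes [measurable]: "H \<in> borel_measurable seq_borel" and B: "\<And>e. \<bar>H e\<bar> \<le> B"
    and dep: "depends_on_first m H"
  shows "\<exists>C\<ge>0. \<forall>j. integrable M (\<lambda>\<omega>. (\<Sum>t=1..j. H (past \<epsilon> (int t) \<omega>) - (\<integral>e. H e \<partial>past_law))\<^sup>2) \<and>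
    (\<integral>\<omega>. (\<Sum>t=1..j. H (past \<epsilon> (int t) \<omega>) - (\<integral>e. H e \<partial>past_law))\<^sup>2 \<partial>M) \<le> C * real j"
proof -
  define c where "c = (\<integral>e. H e \<partial>past_law)"
  define K where "K e = H e - c" for e
  have B0: "0 \<le> B" using B[of undefined] by linarith
  have intH: "integrable past_law H" by (rule integrable_bounded_past) (use B in auto)
  have "\<bar>c\<bar> \<le> (\<integral>e. \<bar>H e\<bar> \<partial>past_law)" unfolding c_def by (rule integral_abs_bound)
  also have "\<dots> \<le> (\<integral>e. B \<partial>past_law)"
    by (intro integral_mono integrable_abs intH) (use B in auto)
  finally have cB: "\<bar>c\<bar> \<le> B" by (simp add: past.prob_space)
  have K_meas [measurable]: "K \<in> borel_measurable seq_borel" unfolding K_def by simp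
  have KB: "\<bar>K e\<bar> \<le> 2 * B" for e using B[of e] cB unfolding K_def by linarith
  have intK: "integrable past_law K" by (rule integrable_bounded_past[OF K_meas KB])
  have K0: "(\<integral>e. K e \<partial>past_law) = 0"
    unfolding K_def by (simp add: intH c_def[symmetric] past.prob_space)
  have depK: "depends_on_first m K" using dep unfolding depends_on_first_def K_def by metis
  define V where "V t \<omega> = K (past \<epsilon> (int t) \<omega>)" for t :: nat and \<omega>
  have V_meas [measurable]: "V t \<in> borel_measurable M" for t unfolding V_def by measurable
  have VB: "\<bar>V s \<omega> * V t \<omega>\<bar> \<le> 4 * B\<^sup>2" for s t \<omega>
    using mult_mono[OF KB KB, of "past \<epsilon> (int s) \<omega>" "past \<epsilon> (int t) \<omega>"] B0
    by (simp add: V_def abs_mult power2_eq_square mult.commute)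
  have intV: "integrable M (\<lambda>\<omega>. V s \<omega> * V t \<omega>)" for s t
    by (rule integrable_const_bound[of _ "4 * B\<^sup>2"]) (use VB in auto)
  have orth: "(\<integral>\<omega>. V s \<omega> * V t \<omega> \<partial>M) = 0" if "s + m \<le> t" for s t
  proof -
    have "V s \<omega> = K (tail_from (t - s) (past \<epsilon> (int t) \<omega>))" for \<omega>
      using that by (simp add: V_def tail_from_past of_nat_diff)
    then have "(\<integral>\<omega>. V s \<omega> * V t \<omega> \<partial>M) =
        (\<integral>\<omega>. (\<lambda>e. K e * K (tail_from (t - s) e)) (past \<epsilon> (int t) \<omega>) \<partial>M)"
      by (simp add: V_def mult.commute)
    also have "\<dots> = (\<integral>e. K e * K (tail_from (t - s) e) \<partial>past_law)"
      by (rule integral_past) measurable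
    also have "\<dots> = 0"
      using depends_on_first_mono[OF depK, of "t - s"] that
      by (subst integral_head_tail[OF intK intK]) (auto simp: K0)
    finally show ?thesis .
  qed
  have cov: "(\<integral>\<omega>. V s \<omega> * V t \<omega> \<partial>M) \<le> (if s < t + m \<and> t < s + m then 4 * B\<^sup>2 else 0)" for s t
  proof (cases "s < t + m \<and> t < s + m")
    case True
    have "(\<integral>\<omega>. V s \<omega> * V t \<omega> \<partial>M) \<le> (\<integral>\<omega>. 4 * B\<^sup>2 \<partial>M)"
      by (intro integral_mono intV) (use VB in \<open>auto intro: order_trans[OF abs_ge_self]\<close>)
    then show ?thesis using True by (simp add: prob_space)
  next
    case False
    then consider "s + m \<le> t" | "t + m \<le> s" by linarith
    then have "(\<integral>\<omega>. V s \<omega> * V t \<omega> \<partial>M) = 0"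
      by cases (use orth[of s t] orth[of t s] in \<open>simp_all add: mult.commute\<close>)
    then show ?thesis by simp
  qed
  have sq: "(\<Sum>t=1..j. V t \<omega>)\<^sup>2 = (\<Sum>s=1..j. \<Sum>t=1..j. V s \<omega> * V t \<omega>)" for j \<omega>
    by (simp add: power2_eq_square sum_product)
  have row: "(\<Sum>t=1..j. if s < t + m \<and> t < s + m then 4 * B\<^sup>2 else 0) \<le> 8 * real m * B\<^sup>2" for s j
  proof -
    have "(\<Sum>t=1..j. if s < t + m \<and> t < s + m then 4 * B\<^sup>2 else 0) =
        (\<Sum>t\<in>{t\<in>{1..j}. s < t + m \<and> t < s + m}. 4 * B\<^sup>2)"
      by (subst sum.inter_filter[symmetric]) auto
    also have "\<dots> = real (card {t\<in>{1..j}. s < t + m \<and> t < s + m}) * (4 * B\<^sup>2)" by simp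
    also have "\<dots> \<le> real (2 * m) * (4 * B\<^sup>2)"
    proof (intro mult_right_mono)
      have "card {t\<in>{1..j}. s < t + m \<and> t < s + m} \<le> card {s - m..<s + m}"
        by (intro card_mono) auto
      also have "\<dots> \<le> 2 * m" by simp
      finally show "real (card {t\<in>{1..j}. s < t + m \<and> t < s + m}) \<le> real (2 * m)" by linarith
    qed simp
    finally show ?thesis by simp
  qed
  have "(\<integral>\<omega>. (\<Sum>t=1..j. V t \<omega>)\<^sup>2 \<partial>M) \<le> (8 * real m * B\<^sup>2) * real j" for j
  proof -
    have "(\<integral>\<omega>. (\<Sum>t=1..j. V t \<omega>)\<^sup>2 \<partial>M) = (\<Sum>s=1..j. \<Sum>t=1..j. \<integral>\<omega>. V s \<omega> * V t \<omega> \<partial>M)"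
      unfolding sq by (simp add: Bochner_Integration.integral_sum intV Bochner_Integration.integrable_sum)
    also have "\<dots> \<le> (\<Sum>s=1..j. 8 * real m * B\<^sup>2)"
      by (intro sum_mono order_trans[OF sum_mono[OF cov] row])
    finally show ?thesis by (simp add: mult.commute)
  qed
  moreover have "integrable M (\<lambda>\<omega>. (\<Sum>t=1..j. V t \<omega>)\<^sup>2)" for j
    unfolding sq by (intro Bochner_Integration.integrable_sum intV)
  moreover have "(\<Sum>t=1..j. H (past \<epsilon> (int t) \<omega>) - (\<integral>e. H e \<partial>past_law)) = (\<Sum>t=1..j. V t \<omega>)" for j \<omega>
    by (simp add: V_def K_def c_def)
  ultimately show ?thesis
    by (intro exI[of _ "8 * real m * B\<^sup>2"]) (simp add: B0)
qed

text \<open>Chebyshev's inequality controls the sums at the ends of a bounded number of blocks; between two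
  ends the sum moves by at most the block length times the bound on a single summand. So the deviation is
  small for all \<open>j \<le> n\<close> simultaneously.\<close>

lemma weak_law_finite_range_uniform:
  assumes H [measurable]: "H \<in> borel_measurable seq_borel" and B: "\<And>e. \<bar>H e\<bar> \<le> B"
    and dep: "depends_on_first m H" and \<delta>: "\<delta> > 0"
  shows "(\<lambda>n. prob {\<omega>\<in>space M. \<exists>j\<le>n.
    \<delta> * real n < \<bar>(\<Sum>t=1..j. H (past \<epsilon> (int t) \<omega>)) - real j * (\<integral>e. H e \<partial>past_law)\<bar>}) \<longlonglongrightarrow> 0"
    (is "(\<lambda>n. prob (?A n)) \<longlonglongrightarrow> 0")
proof -
  define c where "c = (\<integral>e. H e \<partial>past_law)"
  define S where "S j \<omega> = (\<Sum>t=1..j. H (past \<epsilon> (int t) \<omega>) - c)" for j :: nat and \<omega>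
  have [measurable]: "S j \<in> borel_measurable M" for j unfolding S_def by measurable
  obtain C where C: "C \<ge> 0" "\<And>j. integrable M (\<lambda>\<omega>. (S j \<omega>)\<^sup>2)"
    "\<And>j. expectation (\<lambda>\<omega>. (S j \<omega>)\<^sup>2) \<le> C * real j"
    using second_moment_finite_range[OF H B dep] unfolding S_def c_def by blast
  have B0: "0 \<le> B" using B[of undefined] by linarith
  have intH: "integrable past_law H" by (rule integrable_bounded_past) (use B in auto)
  have "\<bar>c\<bar> \<le> (\<integral>e. \<bar>H e\<bar> \<partial>past_law)" unfolding c_def by (rule integral_abs_bound)
  also have "\<dots> \<le> (\<integral>e. B \<partial>past_law)"
    by (intro integral_mono integrable_abs intH) (use B in auto)
  finally have cB: "\<bar>c\<bar> \<le> B" by simp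
  have step: "\<bar>H e - c\<bar> \<le> 2 * B" for e using B[of e] cB by linarith
  have incr: "\<bar>S (i + d) \<omega> - S i \<omega>\<bar> \<le> 2 * B * real d" for i d \<omega>
  proof (induction d)
    case (Suc d)
    have "S (i + Suc d) \<omega> = S (i + d) \<omega> + (H (past \<epsilon> (int (i + Suc d)) \<omega>) - c)"
      by (simp add: S_def)
    then show ?case using Suc step[of "past \<epsilon> (int (i + Suc d)) \<omega>"] by (simp add: algebra_simps)
  qed simp
  obtain N :: nat where N: "N > 0" "8 * B \<le> \<delta> * real N"
  proof -
    obtain N :: nat where "8 * B / \<delta> < real N" using reals_Archimedean2 by blast
    then show ?thesis using \<delta> by (intro that[of "Suc N"]) (auto simp: field_simps)
  qed
  have bound: "prob (?A n) \<le> (real N + 1) * (8 * C / \<delta>\<^sup>2) * (1 / real n)"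
    if n: "n \<ge> N" "8 * B \<le> \<delta> * real n" for n
  proof -
    have n0: "n > 0" using n N by simp
    \<comment> \<open>Block length such that \<open>N + 1\<close> block ends cover \<open>{0..n}\<close>.\<close>
    define L where "L = n div N + 1"
    have L_pos: "L > 0" by (simp add: L_def)
    have nL: "n < N * L" unfolding L_def using N(1)
      by (metis Suc_eq_plus1 dividend_less_times_div mult_Suc_right add.commute)
    have "N * (n div N) \<le> n" by simp
    then have NL: "N * L \<le> 2 * n" unfolding L_def distrib_left using n(1) by linarith
    have L: "4 * B * real L \<le> \<delta> * real n"
    proof -
      have "real N * (8 * B * real L) = 8 * B * real (N * L)" by simp
      also have "\<dots> \<le> 8 * B * real (2 * n)" using NL B0 by (intro mult_left_mono) linarith+
      also have "\<dots> \<le> 2 * (\<delta> * real N) * real n"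
        using mult_right_mono[OF N(2), of "2 * real n"] by (simp add: algebra_simps)
      finally show ?thesis using N(1) by (simp add: algebra_simps)
    qed
    have "?A n \<subseteq> (\<Union>i\<le>N. {\<omega>\<in>space M. (\<delta> * real n / 2)\<^sup>2 < (S (i * L) \<omega>)\<^sup>2})"
    proof
      fix \<omega> assume "\<omega> \<in> ?A n"
      then obtain j where \<omega>: "\<omega> \<in> space M" and j: "j \<le> n" "\<delta> * real n < \<bar>S j \<omega>\<bar>"
        by (auto simp: S_def c_def[symmetric] sum_subtractf)
      let ?i = "j div L"
      have "?i < N" using j(1) nL by (intro less_mult_imp_div_less) simp
      have "\<bar>S (?i * L + j mod L) \<omega> - S (?i * L) \<omega>\<bar> \<le> 2 * B * real (j mod L)" by (rule incr)
      also have "\<dots> \<le> 2 * B * real L"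
        using B0 mod_less_divisor[of L j] by (intro mult_left_mono) (auto simp: L_pos)
      finally have "\<delta> * real n / 2 < \<bar>S (?i * L) \<omega>\<bar>" using L j(2) by simp
      then have "(\<delta> * real n / 2)\<^sup>2 < \<bar>S (?i * L) \<omega>\<bar>\<^sup>2"
        using \<delta> by (intro power_strict_mono) auto
      then show "\<omega> \<in> (\<Union>i\<le>N. {\<omega>\<in>space M. (\<delta> * real n / 2)\<^sup>2 < (S (i * L) \<omega>)\<^sup>2})"
        using \<omega> \<open>?i < N\<close> by (auto intro!: bexI[of _ ?i])
    qed
    then have "prob (?A n) \<le> prob (\<Union>i\<le>N. {\<omega>\<in>space M. (\<delta> * real n / 2)\<^sup>2 < (S (i * L) \<omega>)\<^sup>2})"
      by (intro finite_measure_mono) auto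
    also have "\<dots> \<le> (\<Sum>i\<le>N. prob {\<omega>\<in>space M. (\<delta> * real n / 2)\<^sup>2 < (S (i * L) \<omega>)\<^sup>2})"
      by (intro finite_measure_subadditive_finite) auto
    also have "\<dots> \<le> (\<Sum>i\<le>N. 8 * C / \<delta>\<^sup>2 * (1 / real n))"
    proof (intro sum_mono)
      fix i assume "i \<in> {..N}"
      then have "i * L \<le> N * L" by simp
      then have "real (i * L) \<le> real (2 * n)" using NL unfolding of_nat_le_iff by linarith
      then have iL: "real (i * L) \<le> 2 * real n" by simp
      have "prob {\<omega>\<in>space M. (\<delta> * real n / 2)\<^sup>2 < (S (i * L) \<omega>)\<^sup>2} \<le> C * real (i * L) / (\<delta> * real n / 2)\<^sup>2"
        using \<delta> n0 by (intro order_trans[OF prob_gt_le_expectation[OF C(2)]] divide_right_mono C(3)) auto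
      also have "\<dots> \<le> C * (2 * real n) / (\<delta> * real n / 2)\<^sup>2"
        using iL C(1) by (intro divide_right_mono mult_left_mono) auto
      also have "\<dots> = 8 * C / \<delta>\<^sup>2 * (1 / real n)"
        using \<delta> n0 by (simp add: field_simps power2_eq_square)
      finally show "prob {\<omega>\<in>space M. (\<delta> * real n / 2)\<^sup>2 < (S (i * L) \<omega>)\<^sup>2} \<le> 8 * C / \<delta>\<^sup>2 * (1 / real n)" .
    qed
    also have "\<dots> = (real N + 1) * (8 * C / \<delta>\<^sup>2) * (1 / real n)" by simp
    finally show ?thesis .
  qed
  show ?thesis
  proof (rule tendsto_sandwich[where f = "\<lambda>_. 0"])
    show "(\<lambda>n. (real N + 1) * (8 * C / \<delta>\<^sup>2) * (1 / real n)) \<longlonglongrightarrow> 0"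
      by (intro tendsto_mult_right_zero lim_1_over_n)
    obtain n0 :: nat where n0: "8 * B / \<delta> < real n0" using reals_Archimedean2 by blast
    show "eventually (\<lambda>n. prob (?A n) \<le> (real N + 1) * (8 * C / \<delta>\<^sup>2) * (1 / real n)) sequentially"
      unfolding eventually_sequentially
    proof (intro exI[of _ "max N n0"] allI impI bound)
      fix n assume "max N n0 \<le> n"
      then have "8 * B / \<delta> \<le> real n" using n0 by linarith
      then show "8 * B \<le> \<delta> * real n" using \<delta> by (simp add: field_simps)
    qed simp
  qed (auto intro!: always_eventually)
qed

text \<open>If \<open>F\<close> is replaced by a function \<open>H\<close> of finitely many coordinates, all partial sums up to \<open>n\<close>
  change by at most the single sum of \<open>\<bar>F - H\<bar>\<close>, whose expectation is \<open>n\<close> times a small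
  number. Uniformity in \<open>j\<close> is therefore inherited from the finite-range case by Markov's inequality.\<close>

lemma weak_law_uniform:
  assumes F: "integrable past_law F" and \<delta>: "\<delta> > 0"
  shows "(\<lambda>n. prob {\<omega>\<in>space M. \<exists>j\<le>n.
    \<delta> * real n < \<bar>(\<Sum>t=1..j. F (past \<epsilon> (int t) \<omega>)) - real j * (\<integral>e. F e \<partial>past_law)\<bar>}) \<longlonglongrightarrow> 0"
    (is "(\<lambda>n. prob (?A n)) \<longlonglongrightarrow> 0")
proof (rule LIMSEQ_I)
  fix \<kappa> :: real assume \<kappa>: "\<kappa> > 0"
  have F_meas [measurable]: "F \<in> borel_measurable seq_borel"
    using borel_measurable_integrable[OF F] by (simp add: measurable_cong_sets[OF sets_past_law refl])
  define \<eta> where "\<eta> = min (\<delta> / 4) (\<kappa> * \<delta> / 16)"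
  have \<eta>: "\<eta> > 0" using \<delta> \<kappa> by (simp add: \<eta>_def)
  obtain m H B where H [measurable]: "H \<in> borel_measurable seq_borel" and B: "\<And>e. \<bar>H e\<bar> \<le> B"
    and dep: "depends_on_first m H" and HF: "(\<integral>e. \<bar>F e - H e\<bar> \<partial>past_law) < \<eta>"
    using cylinder_approximable[OF F] \<eta> unfolding cylinder_approximable_def by blast
  have intH: "integrable past_law H" by (rule integrable_bounded_past[OF H B])
  have intD: "integrable past_law (\<lambda>e. \<bar>F e - H e\<bar>)" using F intH by auto
  let ?mF = "\<integral>e. F e \<partial>past_law" and ?mH = "\<integral>e. H e \<partial>past_law"
  have "\<bar>?mF - ?mH\<bar> = \<bar>\<integral>e. F e - H e \<partial>past_law\<bar>"
    using F intH by simp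
  also have "\<dots> \<le> (\<integral>e. \<bar>F e - H e\<bar> \<partial>past_law)" by (rule integral_abs_bound)
  finally have means: "\<bar>?mF - ?mH\<bar> \<le> \<delta> / 4" using HF unfolding \<eta>_def by linarith
  let ?D = "\<lambda>n \<omega>. \<Sum>t=1..n. \<bar>F (past \<epsilon> (int t) \<omega>) - H (past \<epsilon> (int t) \<omega>)\<bar>"
  let ?B = "\<lambda>n. {\<omega>\<in>space M. \<delta> / 4 * real n < ?D n \<omega>}"
  let ?C = "\<lambda>n. {\<omega>\<in>space M. \<exists>j\<le>n.
    \<delta> / 2 * real n < \<bar>(\<Sum>t=1..j. H (past \<epsilon> (int t) \<omega>)) - real j * ?mH\<bar>}"
  have combine: "\<bar>x - a\<bar> \<le> d" if "\<bar>x - y\<bar> \<le> D" "\<bar>a - b\<bar> \<le> d / 4" "D \<le> d / 4" "\<bar>y - b\<bar> \<le> d / 2"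
    for x y a b d D :: real
    using that by linarith
  have sub: "?A n \<subseteq> ?B n \<union> ?C n" for n
  proof
    fix \<omega> assume "\<omega> \<in> ?A n"
    then obtain j where \<omega>: "\<omega> \<in> space M" and j: "j \<le> n"
      "\<delta> * real n < \<bar>(\<Sum>t=1..j. F (past \<epsilon> (int t) \<omega>)) - real j * ?mF\<bar>" by auto
    have "\<bar>(\<Sum>t=1..j. F (past \<epsilon> (int t) \<omega>)) - (\<Sum>t=1..j. H (past \<epsilon> (int t) \<omega>))\<bar> \<le> ?D j \<omega>"
      unfolding sum_subtractf[symmetric] by (rule sum_abs)
    also have "\<dots> \<le> ?D n \<omega>" using j by (intro sum_mono2) auto
    finally have 1: "\<bar>(\<Sum>t=1..j. F (past \<epsilon> (int t) \<omega>)) - (\<Sum>t=1..j. H (past \<epsilon> (int t) \<omega>))\<bar> \<le> ?D n \<omega>" .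
    have "\<bar>real j * ?mF - real j * ?mH\<bar> = real j * \<bar>?mF - ?mH\<bar>"
      by (simp add: right_diff_distrib[symmetric] abs_mult)
    also have "\<dots> \<le> real n * (\<delta> / 4)" using j means by (intro mult_mono) auto
    finally have 2: "\<bar>real j * ?mF - real j * ?mH\<bar> \<le> real n * (\<delta> / 4)" .
    show "\<omega> \<in> ?B n \<union> ?C n"
    proof (rule ccontr)
      assume "\<omega> \<notin> ?B n \<union> ?C n"
      then have 3: "\<not> \<delta> / 4 * real n < ?D n \<omega>"
        "\<not> \<delta> / 2 * real n < \<bar>(\<Sum>t=1..j. H (past \<epsilon> (int t) \<omega>)) - real j * ?mH\<bar>"
        using \<omega> j(1) by blast+
      have "real n * (\<delta> / 4) = (\<delta> * real n) / 4" "\<delta> / 4 * real n = (\<delta> * real n) / 4"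
        "\<delta> / 2 * real n = (\<delta> * real n) / 2" by simp_all
      from combine[OF 1 2[unfolded this] 3[unfolded not_less this]] j(2) show False
        by (rule leD[THEN notE])
    qed
  qed
  have ED: "expectation (?D n) = real n * (\<integral>e. \<bar>F e - H e\<bar> \<partial>past_law)" and intDn: "integrable M (?D n)" for n
  proof -
    have i: "integrable M (\<lambda>\<omega>. \<bar>F (past \<epsilon> (int t) \<omega>) - H (past \<epsilon> (int t) \<omega>)\<bar>)" for t
      using integrable_past[OF intD] by simp
    then show "integrable M (?D n)" by (intro Bochner_Integration.integrable_sum)
    have "expectation (?D n) = (\<Sum>t=1..n. expectation (\<lambda>\<omega>. \<bar>F (past \<epsilon> (int t) \<omega>) - H (past \<epsilon> (int t) \<omega>)\<bar>))"
      by (intro Bochner_Integration.integral_sum i)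
    also have "\<dots> = (\<Sum>t=1..n. \<integral>e. \<bar>F e - H e\<bar> \<partial>past_law)"
      by (intro sum.cong refl integral_past[where F = "\<lambda>e. \<bar>F e - H e\<bar>"]) measurable
    finally show "expectation (?D n) = real n * (\<integral>e. \<bar>F e - H e\<bar> \<partial>past_law)" by simp
  qed
  have PB: "prob (?B n) \<le> \<kappa> / 4" if "n > 0" for n
  proof -
    have "prob (?B n) \<le> expectation (?D n) / (\<delta> / 4 * real n)"
      using \<delta> that by (intro prob_gt_le_expectation intDn) (auto intro!: sum_nonneg)
    also have "\<dots> \<le> (real n * (\<kappa> * \<delta> / 16)) / (\<delta> / 4 * real n)"
      unfolding ED using HF \<delta> that by (intro divide_right_mono mult_left_mono) (auto simp: \<eta>_def)
    also have "\<dots> = \<kappa> / 4" using \<delta> that by simp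
    finally show ?thesis .
  qed
  have "eventually (\<lambda>n. prob (?C n) < \<kappa> / 4) sequentially"
    using order_tendstoD(2)[OF weak_law_finite_range_uniform[OF H B dep, of "\<delta> / 2"], of "\<kappa> / 4"] \<delta> \<kappa> by simp
  then obtain n0 where n0: "\<And>n. n \<ge> n0 \<Longrightarrow> prob (?C n) < \<kappa> / 4" by (auto simp: eventually_sequentially)
  show "\<exists>n0. \<forall>n\<ge>n0. norm (prob (?A n) - 0) < \<kappa>"
  proof (intro exI[of _ "Suc n0"] allI impI)
    fix n assume n: "n \<ge> Suc n0"
    have "prob (?A n) \<le> prob (?B n \<union> ?C n)" by (intro finite_measure_mono sub) measurable
    also have "\<dots> \<le> prob (?B n) + prob (?C n)" by (intro measure_Un_le) measurable
    also have "\<dots> < \<kappa>" using PB[of n] n0[of n] n \<kappa> by simp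
    finally show "norm (prob (?A n) - 0) < \<kappa>" by simp
  qed
qed

end

section \<open>The weights and their dependence on the parameter\<close>

lemma garch_c_0: "garch_c p q u 0 = u 0 / (1 - (\<Sum>j=1..q. u (p + j)))"
  by (subst garch_c.simps) simp

lemma garch_c_pos:
  "i > 0 \<Longrightarrow> garch_c p q u i =
    (if i \<le> p then u i else 0) + (\<Sum>j=1..min (i - 1) q. u (p + j) * garch_c p q u (i - j))"
  by (subst garch_c.simps) simp

text \<open>The partial derivative of \<open>garch_c p q u i\<close> in the coordinate \<open>l\<close>, obtained by differentiating the
  recursion of the weights term by term.\<close>

fun garch_dc :: "nat \<Rightarrow> nat \<Rightarrow> (nat \<Rightarrow> real) \<Rightarrow> nat \<Rightarrow> nat \<Rightarrow> real" where
  "garch_dc p q u l i =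
    (if i = 0 then
       (if l = 0 then 1 / (1 - (\<Sum>j=1..q. u (p + j)))
        else if p < l then u 0 / (1 - (\<Sum>j=1..q. u (p + j)))\<^sup>2 else 0)
     else (if i \<le> p \<and> l = i then 1 else 0) +
       (\<Sum>j=1..min (i - 1) q.
          (if l = p + j then garch_c p q u (i - j) else 0) + u (p + j) * garch_dc p q u l (i - j)))"

declare garch_dc.simps [simp del]

lemma garch_dc_pos:
  "i > 0 \<Longrightarrow> garch_dc p q u l i =
    (if i \<le> p \<and> l = i then 1 else 0) +
       (\<Sum>j=1..min (i - 1) q.
          (if l = p + j then garch_c p q u (i - j) else 0) + u (p + j) * garch_dc p q u l (i - j))"
  by (subst garch_dc.simps) simp

lemma garch_dc_0:
  "garch_dc p q u l 0 =
       (if l = 0 then 1 / (1 - (\<Sum>j=1..q. u (p + j)))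
        else if p < l then u 0 / (1 - (\<Sum>j=1..q. u (p + j)))\<^sup>2 else 0)"
  by (subst garch_dc.simps) simp

text \<open>For \<open>i > 0\<close> the weight \<open>garch_c p q u i\<close> is a polynomial of degree at most \<open>i\<close> in the coordinates of \<open>u\<close>,
  with nonnegative coefficients. If every coordinate changes by a factor between \<open>1 - \<eta>\<close> and \<open>1 + \<eta>\<close>,
  then the change of such a polynomial and its deviation from the first-order expansion are at most
  \<open>(1 + \<eta>)\<^sup>i - 1\<close> and \<open>(1 + \<eta>)\<^sup>i - 1 - i\<eta>\<close> times its value. The next lemmas bound these
  two factors.\<close>

lemma power_remainder_1: "0 \<le> (\<eta>::real) \<Longrightarrow> (1 + \<eta>) ^ k - 1 \<le> real k * \<eta> * (1 + \<eta>) ^ k"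
proof (induction k)
  case (Suc k)
  have "1 \<le> (1 + \<eta>) ^ Suc k" by (rule one_le_power) (use Suc.prems in simp)
  from mult_left_mono[OF this Suc.prems] have "\<eta> \<le> \<eta> * (1 + \<eta>) ^ Suc k" by (simp only: mult_1_right)
  moreover have "(1 + \<eta>) * ((1 + \<eta>) ^ k - 1) \<le> (1 + \<eta>) * (real k * \<eta> * (1 + \<eta>) ^ k)"
    by (rule mult_left_mono) (use Suc in auto)
  moreover have "(1 + \<eta>) ^ Suc k - 1 = (1 + \<eta>) * ((1 + \<eta>) ^ k - 1) + \<eta>"
    "real (Suc k) * \<eta> * (1 + \<eta>) ^ Suc k = (1 + \<eta>) * (real k * \<eta> * (1 + \<eta>) ^ k) + \<eta> * (1 + \<eta>) ^ Suc k"
    by (simp_all add: algebra_simps)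
  ultimately show ?case by linarith
qed simp

lemma power_remainder_2: "0 \<le> (\<eta>::real) \<Longrightarrow> (1 + \<eta>) ^ k - 1 - real k * \<eta> \<le> (real k)\<^sup>2 * \<eta>\<^sup>2 * (1 + \<eta>) ^ k"
proof (induction k)
  case (Suc k)
  have "(1 + \<eta>) ^ Suc k - 1 - real (Suc k) * \<eta> = ((1 + \<eta>) ^ k - 1 - real k * \<eta>) + \<eta> * ((1 + \<eta>) ^ k - 1)"
    by (simp add: algebra_simps)
  also have "\<dots> \<le> (real k)\<^sup>2 * \<eta>\<^sup>2 * (1 + \<eta>) ^ k + \<eta> * (real k * \<eta> * (1 + \<eta>) ^ k)"
    using Suc power_remainder_1[of \<eta> k] by (intro add_mono mult_left_mono) auto
  also have "\<dots> = ((real k)\<^sup>2 + real k) * (\<eta>\<^sup>2 * (1 + \<eta>) ^ k)"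
    by (simp add: algebra_simps power2_eq_square)
  also have "\<dots> \<le> (real (Suc k))\<^sup>2 * (\<eta>\<^sup>2 * (1 + \<eta>) ^ Suc k)"
  proof (rule mult_mono)
    have "(1 + \<eta>) ^ k \<le> (1 + \<eta>) ^ Suc k" by (rule power_increasing) (use Suc.prems in auto)
    then show "\<eta>\<^sup>2 * (1 + \<eta>) ^ k \<le> \<eta>\<^sup>2 * (1 + \<eta>) ^ Suc k" by (rule mult_left_mono) simp
  qed (use Suc.prems in \<open>auto simp: power2_eq_square algebra_simps\<close>)
  finally show ?case by (simp add: mult.assoc)
qed simp

lemma power_remainder_mono:
  assumes "0 \<le> (\<eta>::real)" "k \<le> m"
  shows "(1 + \<eta>) ^ k - 1 - real k * \<eta> \<le> (1 + \<eta>) ^ m - 1 - real m * \<eta>"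
  using assms(2)
proof (induction rule: dec_induct)
  case (step m)
  have "(1 + \<eta>) ^ Suc m - 1 - real (Suc m) * \<eta> = ((1 + \<eta>) ^ m - 1 - real m * \<eta>) + \<eta> * ((1 + \<eta>) ^ m - 1)"
    by (simp add: algebra_simps)
  moreover have "0 \<le> \<eta> * ((1 + \<eta>) ^ m - 1)" using assms(1) by (intro mult_nonneg_nonneg) auto
  ultimately show ?case using step by linarith
qed simp

lemma linear_times_geometric_bounded:
  assumes "(a::real) > 1"
  shows "\<exists>C>0. \<forall>i. real i \<le> C * a ^ i"
proof -
  have "(\<lambda>n. of_nat n * inverse a ^ n) \<longlonglongrightarrow> 0"
    using assms by (intro powser_times_n_limit_0) (auto simp: inverse_less_1_iff)
  then have "Bseq (\<lambda>n. of_nat n * inverse a ^ n)" by (intro convergent_imp_Bseq) (auto simp: convergent_def)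
  then obtain C where C: "C > 0" "\<And>n. norm (of_nat n * inverse a ^ n) \<le> C" by (auto elim: BseqE)
  have "real i \<le> C * a ^ i" for i
    using C(2)[of i] assms by (simp add: power_inverse field_simps abs_mult)
  then show ?thesis using C(1) by blast
qed

locale garch_parameter =
  fixes p q :: nat and \<theta> :: "nat \<Rightarrow> real" and \<rho> :: real
  assumes q: "1 \<le> q" and pos: "\<And>l. l \<le> p + q \<Longrightarrow> 0 < \<theta> l"
    and beta_sum: "(\<Sum>j=1..q. \<theta> (p + j)) \<le> \<rho>" and rho: "0 < \<rho>" "\<rho> < 1"
begin

abbreviation c :: "nat \<Rightarrow> real" where "c \<equiv> garch_c p q \<theta>"
abbreviation dc :: "nat \<Rightarrow> nat \<Rightarrow> real" where "dc \<equiv> garch_dc p q \<theta>"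

lemma beta_pos: "1 \<le> j \<Longrightarrow> j \<le> q \<Longrightarrow> 0 < \<theta> (p + j)"
  by (rule pos) simp

lemma c0_pos: "0 < c 0"
  using pos[of 0] beta_sum rho by (auto simp: garch_c_0 intro!: divide_pos_pos)

lemma c_nonneg: "0 \<le> c i"
proof (induction i rule: less_induct)
  case (less i)
  show ?case
  proof (cases "i = 0")
    case True
    then show ?thesis using c0_pos by simp
  next
    case False
    then show ?thesis using less pos[of i]
      by (subst garch_c_pos) (auto intro!: add_nonneg_nonneg sum_nonneg mult_nonneg_nonneg less_imp_le[OF beta_pos])
  qed
qed

text \<open>Beyond index \<open>p\<close> the weights satisfy a homogeneous linear recursion of order \<open>q\<close> whose
  coefficients have sum at most \<open>\<rho> < 1\<close>, so they decay at least like powers of \<open>r = \<rho>\<^bsup>1/q\<^esup>\<close>.\<close>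

lemma c_decay: "\<exists>C r. 0 < C \<and> 0 < r \<and> r < 1 \<and> (\<forall>i. c i \<le> C * r ^ i)"
proof -
  define r where "r = root q \<rho>"
  have r: "0 < r" "r < 1" and rq: "r ^ q = \<rho>" using rho q by (auto simp: r_def)
  \<comment> \<open>Large enough for the indices up to \<open>p\<close>, where the recursion is not homogeneous.\<close>
  define C where "C = (\<Sum>i\<le>p. c i) / r ^ p + 1"
  have C: "0 < C" using r by (auto simp: C_def intro!: add_nonneg_pos divide_nonneg_pos sum_nonneg c_nonneg)
  have "c i \<le> C * r ^ i" for i
  proof (induction i rule: less_induct)
    case (less i)
    show ?case
    proof (cases "i \<le> p")
      case True
      have "c i \<le> (\<Sum>i\<le>p. c i)" using True by (intro member_le_sum c_nonneg) auto
      also have "\<dots> \<le> C * r ^ p" using r by (simp add: C_def field_simps)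
      also have "\<dots> \<le> C * r ^ i" using r C True by (intro mult_left_mono power_decreasing) auto
      finally show ?thesis .
    next
      case False
      then have "c i = (\<Sum>j=1..min (i - 1) q. \<theta> (p + j) * c (i - j))" by (subst garch_c_pos) auto
      also have "\<dots> \<le> (\<Sum>j=1..min (i - 1) q. \<theta> (p + j) * (C * r ^ i / \<rho>))"
      proof (intro sum_mono mult_left_mono)
        fix j assume j: "j \<in> {1..min (i - 1) q}"
        have "c (i - j) \<le> C * r ^ (i - j)" using j by (intro less) auto
        also have "r ^ (i - j) = r ^ i / r ^ j" using j r by (intro power_diff) auto
        also have "C * (r ^ i / r ^ j) \<le> C * (r ^ i / r ^ q)"
          using j r C by (intro mult_left_mono divide_left_mono power_decreasing) auto
        finally show "c (i - j) \<le> C * r ^ i / \<rho>" by (simp add: rq)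
      qed (use beta_pos in \<open>auto intro: less_imp_le\<close>)
      also have "\<dots> = (\<Sum>j=1..min (i - 1) q. \<theta> (p + j)) * (C * r ^ i / \<rho>)" by (rule sum_distrib_right[symmetric])
      also have "\<dots> \<le> \<rho> * (C * r ^ i / \<rho>)"
      proof (intro mult_right_mono)
        have "(\<Sum>j=1..min (i - 1) q. \<theta> (p + j)) \<le> (\<Sum>j=1..q. \<theta> (p + j))"
          by (intro sum_mono2) (auto intro: less_imp_le[OF beta_pos])
        then show "(\<Sum>j=1..min (i - 1) q. \<theta> (p + j)) \<le> \<rho>" using beta_sum by linarith
      qed (use C r rho in auto)
      also have "\<dots> = C * r ^ i" using rho by simp
      finally show ?thesis .
    qed
  qed
  then show ?thesis using C r by blast
qed

lemma dc_nonneg: "l \<le> p + q \<Longrightarrow> 0 \<le> dc l i"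
proof (induction i rule: less_induct)
  case (less i)
  show ?case
  proof (cases "i = 0")
    case True
    then show ?thesis using pos[of 0] beta_sum rho by (auto simp: garch_dc_0)
  next
    case False
    then show ?thesis using less
      by (subst garch_dc_pos)
        (auto intro!: add_nonneg_nonneg sum_nonneg mult_nonneg_nonneg less_imp_le[OF beta_pos] c_nonneg)
  qed
qed

text \<open>Euler's relation for a polynomial of degree at most \<open>i\<close> with nonnegative coefficients, one
  coordinate at a time.\<close>

lemma dc_le: "l \<le> p + q \<Longrightarrow> 0 < i \<Longrightarrow> \<theta> l * dc l i \<le> real i * c i"
proof (induction i rule: less_induct)
  case (less i)
  have "\<theta> l * dc l i = (if i \<le> p \<and> l = i then \<theta> l else 0) +
      (\<Sum>j=1..min (i - 1) q. (if l = p + j then \<theta> l * c (i - j) else 0) + \<theta> (p + j) * (\<theta> l * dc l (i - j)))"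
    using less.prems by (subst garch_dc_pos) (auto simp: algebra_simps sum_distrib_left intro!: sum.cong)
  also have "\<dots> \<le> (if i \<le> p then real i * \<theta> i else 0) +
      (\<Sum>j=1..min (i - 1) q. real i * (\<theta> (p + j) * c (i - j)))"
  proof (intro add_mono sum_mono)
    show "(if i \<le> p \<and> l = i then \<theta> l else 0) \<le> (if i \<le> p then real i * \<theta> i else 0)"
      using less.prems pos[of i] by (auto simp: mult_le_cancel_right1)
  next
    fix j assume j: "j \<in> {1..min (i - 1) q}"
    then have b: "0 < \<theta> (p + j)" by (intro beta_pos) auto
    have "\<theta> (p + j) * (\<theta> l * dc l (i - j)) \<le> \<theta> (p + j) * (real (i - j) * c (i - j))"
      using j b less.prems by (intro mult_left_mono less.IH) auto
    moreover have "(if l = p + j then \<theta> l * c (i - j) else 0) \<le> \<theta> (p + j) * c (i - j)"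
      using b c_nonneg[of "i - j"] by auto
    ultimately have "(if l = p + j then \<theta> l * c (i - j) else 0) + \<theta> (p + j) * (\<theta> l * dc l (i - j))
        \<le> (1 + real (i - j)) * (\<theta> (p + j) * c (i - j))" by (simp add: algebra_simps)
    also have "\<dots> \<le> real i * (\<theta> (p + j) * c (i - j))"
      using j b c_nonneg[of "i - j"] by (intro mult_right_mono) auto
    finally show "(if l = p + j then \<theta> l * c (i - j) else 0) + \<theta> (p + j) * (\<theta> l * dc l (i - j))
        \<le> real i * (\<theta> (p + j) * c (i - j))" .
  qed
  also have "\<dots> = real i * c i"
    using less.prems by (subst (2) garch_c_pos) (auto simp: algebra_simps sum_distrib_left)
  finally show ?case .
qed

text \<open>The recursion satisfied by the derivative of the weights in the direction \<open>h\<close>.\<close>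

lemma directional_pos:
  assumes "0 < i"
  shows "(\<Sum>l\<le>p + q. h l * dc l i) = (if i \<le> p then h i else 0) +
    (\<Sum>j=1..min (i - 1) q. h (p + j) * c (i - j) + \<theta> (p + j) * (\<Sum>l\<le>p + q. h l * dc l (i - j)))"
proof -
  have "(\<Sum>l\<le>p + q. h l * dc l i) = (\<Sum>l\<le>p + q. (if i \<le> p \<and> l = i then h l else 0)) +
      (\<Sum>l\<le>p + q. \<Sum>j=1..min (i - 1) q. (if l = p + j then h l * c (i - j) else 0) + \<theta> (p + j) * (h l * dc l (i - j)))"
    unfolding sum.distrib[symmetric] using assms
    by (intro sum.cong refl, subst garch_dc_pos) (auto simp: algebra_simps sum_distrib_left intro!: sum.cong)
  also have "(\<Sum>l\<le>p + q. (if i \<le> p \<and> l = i then h l else 0)) = (if i \<le> p then h i else 0)"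
    by auto
  also have "(\<Sum>l\<le>p + q. \<Sum>j=1..min (i - 1) q. (if l = p + j then h l * c (i - j) else 0) + \<theta> (p + j) * (h l * dc l (i - j)))
      = (\<Sum>j=1..min (i - 1) q. \<Sum>l\<le>p + q. (if l = p + j then h l * c (i - j) else 0) + \<theta> (p + j) * (h l * dc l (i - j)))"
    by (rule sum.swap)
  also have "\<dots> = (\<Sum>j=1..min (i - 1) q. h (p + j) * c (i - j) + \<theta> (p + j) * (\<Sum>l\<le>p + q. h l * dc l (i - j)))"
    by (intro sum.cong refl) (auto simp: sum.distrib sum_distrib_left)
  finally show ?thesis .
qed

text \<open>The estimate for polynomials with nonnegative coefficients, proved along the recursion. A product of
  a parameter and an earlier weight raises the degree by one, and the bounds close up because
  \<open>f (Suc m) = f m + \<eta> + \<eta> * f m\<close> for \<open>f m = (1 + \<eta>)\<^sup>m - 1\<close> and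
  \<open>g (Suc m) = g m + \<eta> * f m\<close> for \<open>g m = (1 + \<eta>)\<^sup>m - 1 - m\<eta>\<close>.\<close>

lemma c_perturbation:
  assumes \<eta>: "0 \<le> \<eta>" and u: "\<And>l. l \<le> p + q \<Longrightarrow> \<bar>u l - \<theta> l\<bar> \<le> \<eta> * \<theta> l" and i: "0 < i"
  shows "\<bar>garch_c p q u i - c i\<bar> \<le> ((1 + \<eta>) ^ i - 1) * c i \<and>
    \<bar>garch_c p q u i - c i - (\<Sum>l\<le>p + q. (u l - \<theta> l) * dc l i)\<bar> \<le> ((1 + \<eta>) ^ i - 1 - real i * \<eta>) * c i"
  using i
proof (induction i rule: less_induct)
  case (less i)
  define h where "h l = u l - \<theta> l" for l
  let ?cu = "garch_c p q u" and ?L = "\<lambda>i. \<Sum>l\<le>p + q. h l * dc l i"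
  let ?J = "{1..min (i - 1) q}"
  let ?f = "\<lambda>k. (1 + \<eta>) ^ k - 1 :: real" and ?g = "\<lambda>k. (1 + \<eta>) ^ k - 1 - real k * \<eta>"
  have hb: "\<bar>h l\<bar> \<le> \<eta> * \<theta> l" if "l \<le> p + q" for l using u[OF that] by (simp add: h_def)
  have fi: "0 \<le> ?f i" using \<eta> by (simp add: one_le_power)
  have gi: "0 \<le> ?g i" using power_remainder_mono[OF \<eta>, of 0 i] by simp
  have fi1: "\<eta> \<le> ?f i" using power_increasing[of 1 i "1 + \<eta>"] less.prems \<eta> by simp
  have summand: "\<bar>u (p + j) * ?cu (i - j) - \<theta> (p + j) * c (i - j)\<bar> \<le> ?f i * (\<theta> (p + j) * c (i - j)) \<and>
      \<bar>u (p + j) * ?cu (i - j) - \<theta> (p + j) * c (i - j) - (h (p + j) * c (i - j) + \<theta> (p + j) * ?L (i - j))\<bar>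
        \<le> ?g i * (\<theta> (p + j) * c (i - j))"
    if j: "j \<in> ?J" for j
  proof -
    let ?m = "i - j"
    define t hh cu cc L where "t = \<theta> (p + j)" and "hh = h (p + j)" and "cu = ?cu ?m" and "cc = c ?m" and "L = ?L ?m"
    have IH: "\<bar>cu - cc\<bar> \<le> ?f ?m * cc" "\<bar>cu - cc - L\<bar> \<le> ?g ?m * cc"
      using less.IH[of ?m] j less.prems unfolding cu_def cc_def L_def h_def by auto
    have t: "0 < t" unfolding t_def using j by (intro beta_pos) auto
    have cc: "0 \<le> cc" unfolding cc_def by (rule c_nonneg)
    have hh: "\<bar>hh\<bar> \<le> \<eta> * t" unfolding hh_def t_def using j by (intro hb) auto
    have ut: "u (p + j) = t + hh" by (simp add: t_def hh_def h_def)
    have hd: "\<bar>hh * (cu - cc)\<bar> \<le> (\<eta> * t) * (?f ?m * cc)"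
      unfolding abs_mult using hh IH(1) \<eta> t by (intro mult_mono) auto
    have "\<bar>(t + hh) * cu - t * cc\<bar> = \<bar>t * (cu - cc) + hh * cc + hh * (cu - cc)\<bar>" by (simp add: algebra_simps)
    also have "\<dots> \<le> t * \<bar>cu - cc\<bar> + \<bar>hh\<bar> * cc + \<bar>hh * (cu - cc)\<bar>"
      using t cc by (intro order_trans[OF abs_triangle_ineq] add_mono order_trans[OF abs_triangle_ineq]) (auto simp: abs_mult)
    also have "\<dots> \<le> t * (?f ?m * cc) + (\<eta> * t) * cc + (\<eta> * t) * (?f ?m * cc)"
      using IH(1) hh cc t hd by (intro add_mono mult_left_mono mult_right_mono) auto
    also have "\<dots> = ?f (Suc ?m) * (t * cc)" by (simp add: algebra_simps)
    also have "\<dots> \<le> ?f i * (t * cc)"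
      using j t cc \<eta> by (intro mult_right_mono diff_right_mono power_increasing) auto
    finally have 1: "\<bar>(t + hh) * cu - t * cc\<bar> \<le> ?f i * (t * cc)" .
    have "\<bar>(t + hh) * cu - t * cc - (hh * cc + t * L)\<bar> = \<bar>t * (cu - cc - L) + hh * (cu - cc)\<bar>" by (simp add: algebra_simps)
    also have "\<dots> \<le> t * \<bar>cu - cc - L\<bar> + \<bar>hh * (cu - cc)\<bar>"
      using t by (intro order_trans[OF abs_triangle_ineq]) (auto simp: abs_mult)
    also have "\<dots> \<le> t * (?g ?m * cc) + (\<eta> * t) * (?f ?m * cc)"
      using IH(2) t hd by (intro add_mono mult_left_mono) auto
    also have "\<dots> = ?g (Suc ?m) * (t * cc)" by (simp add: algebra_simps)
    also have "\<dots> \<le> ?g i * (t * cc)"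
      using j t cc \<eta> by (intro mult_right_mono power_remainder_mono) auto
    finally have 2: "\<bar>(t + hh) * cu - t * cc - (hh * cc + t * L)\<bar> \<le> ?g i * (t * cc)" .
    show ?thesis using 1 2 unfolding ut unfolding t_def hh_def cu_def cc_def L_def by blast
  qed
  have ci: "c i = (if i \<le> p then \<theta> i else 0) + (\<Sum>j\<in>?J. \<theta> (p + j) * c (i - j))"
    by (rule garch_c_pos[OF less.prems])
  have cui: "?cu i = (if i \<le> p then u i else 0) + (\<Sum>j\<in>?J. u (p + j) * ?cu (i - j))"
    by (rule garch_c_pos[OF less.prems])
  have d: "?cu i - c i = (if i \<le> p then h i else 0) + (\<Sum>j\<in>?J. u (p + j) * ?cu (i - j) - \<theta> (p + j) * c (i - j))"
    unfolding ci cui by (simp add: sum_subtractf h_def)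
  have "\<bar>?cu i - c i\<bar> \<le> (if i \<le> p then ?f i * \<theta> i else 0) + (\<Sum>j\<in>?J. ?f i * (\<theta> (p + j) * c (i - j)))"
    unfolding d
  proof (intro order_trans[OF abs_triangle_ineq] add_mono order_trans[OF sum_abs] sum_mono)
    show "\<bar>if i \<le> p then h i else 0\<bar> \<le> (if i \<le> p then ?f i * \<theta> i else 0)"
      using order_trans[OF hb[of i] mult_right_mono[OF fi1, of "\<theta> i"]] pos[of i] by auto
  qed (use summand in blast)
  also have "\<dots> = ?f i * c i" unfolding ci by (simp add: sum_distrib_left algebra_simps)
  finally have 1: "\<bar>?cu i - c i\<bar> \<le> ?f i * c i" .
  have d2: "?cu i - c i - ?L i = (\<Sum>j\<in>?J. u (p + j) * ?cu (i - j) - \<theta> (p + j) * c (i - j) -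
      (h (p + j) * c (i - j) + \<theta> (p + j) * ?L (i - j)))"
    by (subst sum_subtractf, subst d, subst directional_pos[OF less.prems]) simp
  have "\<bar>?cu i - c i - ?L i\<bar> \<le> (\<Sum>j\<in>?J. ?g i * (\<theta> (p + j) * c (i - j)))"
    unfolding d2 by (intro order_trans[OF sum_abs] sum_mono) (use summand in blast)
  also have "\<dots> = ?g i * (\<Sum>j\<in>?J. \<theta> (p + j) * c (i - j))" by (simp add: sum_distrib_left)
  also have "\<dots> \<le> ?g i * c i"
    using gi pos[of i] unfolding ci by (intro mult_left_mono) auto
  finally have 2: "\<bar>?cu i - c i - ?L i\<bar> \<le> ?g i * c i" .
  show ?case using 1 2 unfolding h_def by blast
qed

text \<open>The weight of index 0 is a quotient instead of a polynomial. With \<open>x\<close> and \<open>y\<close> the relative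
  changes of its numerator and (up to sign) of its denominator, the new value is \<open>(1 + x) / (1 - y)\<close> times the old one,
  and the first-order part of the relative change is \<open>x + y\<close>.\<close>

lemma c0_perturbation:
  "\<exists>C\<ge>1. \<exists>\<eta>0>0. \<forall>\<eta> u. 0 \<le> \<eta> \<longrightarrow> \<eta> \<le> \<eta>0 \<longrightarrow> (\<forall>l\<le>p + q. \<bar>u l - \<theta> l\<bar> \<le> \<eta> * \<theta> l) \<longrightarrow>
    \<bar>garch_c p q u 0 - c 0\<bar> \<le> \<eta> * C * c 0 \<and>
    \<bar>garch_c p q u 0 - c 0 - (\<Sum>l\<le>p + q. (u l - \<theta> l) * dc l 0)\<bar> \<le> \<eta>\<^sup>2 * C * c 0"
proof -
  define T where "T = (\<Sum>j=1..q. \<theta> (p + j))"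
  define d where "d = 1 - T"
  have T: "0 \<le> T" "T < 1" using beta_sum rho unfolding T_def by (auto intro!: sum_nonneg less_imp_le[OF beta_pos])
  have d: "0 < d" "d \<le> 1" using T by (auto simp: d_def)
  define s where "s = \<theta> 0"
  have s: "0 < s" using pos[of 0] by (simp add: s_def)
  have c0: "c 0 = s / d" by (simp add: garch_c_0 s_def d_def T_def)
  define K where "K = 1 / d"
  have K: "1 \<le> K" using d by (simp add: K_def)
  have main: "\<bar>garch_c p q u 0 - c 0\<bar> \<le> \<eta> * (2 * (1 + K) * K) * c 0 \<and>
    \<bar>garch_c p q u 0 - c 0 - (\<Sum>l\<le>p + q. (u l - \<theta> l) * dc l 0)\<bar> \<le> \<eta>\<^sup>2 * (2 * (1 + K) * K) * c 0"
    if \<eta>: "0 \<le> \<eta>" "\<eta> \<le> d / 2" and u: "\<And>l. l \<le> p + q \<Longrightarrow> \<bar>u l - \<theta> l\<bar> \<le> \<eta> * \<theta> l" for \<eta> u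
  proof -
    define h where "h l = u l - \<theta> l" for l
    define H where "H = (\<Sum>j=1..q. h (p + j))"
    define x y where "x = h 0 / s" and "y = H / d"
    have x: "\<bar>x\<bar> \<le> \<eta>" using u[of 0] s by (simp add: x_def h_def s_def field_simps)
    have "\<bar>H\<bar> \<le> (\<Sum>j=1..q. \<eta> * \<theta> (p + j))"
      unfolding H_def h_def by (intro order_trans[OF sum_abs] sum_mono u) auto
    also have "\<dots> = \<eta> * T" by (simp add: T_def sum_distrib_left)
    also have "\<dots> \<le> \<eta>" using T \<eta> by (intro mult_left_le) auto
    finally have H: "\<bar>H\<bar> \<le> \<eta>" .
    have y: "\<bar>y\<bar> \<le> \<eta> * K" "\<bar>y\<bar> \<le> 1 / 2"
      using H d \<eta> by (auto simp: y_def K_def field_simps)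
    have y1: "1 / 2 \<le> 1 - y" using y(2) by linarith
    have inv: "1 / (1 - y) \<le> 2" "0 < 1 / (1 - y)" using y1 by (auto simp: field_simps)
    have cu: "garch_c p q u 0 = c 0 * ((1 + x) / (1 - y))"
    proof -
      have "(\<Sum>j=1..q. u (p + j)) = T + H" unfolding T_def H_def h_def by (simp add: sum_subtractf)
      then have "garch_c p q u 0 = (s + h 0) / (d - H)"
        unfolding garch_c_0 by (simp add: s_def h_def d_def algebra_simps)
      also have "s + h 0 = s * (1 + x)" using s by (simp add: x_def field_simps)
      also have "d - H = d * (1 - y)" using d by (simp add: y_def field_simps)
      finally show ?thesis unfolding c0 by simp
    qed
    have L: "(\<Sum>l\<le>p + q. h l * dc l 0) = c 0 * (x + y)"
    proof -
      have "(\<Sum>l\<le>p + q. h l * dc l 0) = (\<Sum>l\<in>insert 0 {p + 1..p + q}. h l * dc l 0)"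
        by (rule sum.mono_neutral_right) (auto simp: garch_dc_0)
      also have "\<dots> = h 0 * dc 0 0 + (\<Sum>l=p + 1..p + q. h l * dc l 0)" by simp
      also have "(\<Sum>l=p + 1..p + q. h l * dc l 0) = (\<Sum>j=1..q. h (p + j) * dc (p + j) 0)"
        using sum.shift_bounds_cl_nat_ivl[of "\<lambda>l. h l * dc l 0" 1 p q] by (simp add: add.commute)
      also have "\<dots> = (\<Sum>j=1..q. h (p + j) * (s / d\<^sup>2))"
        by (intro sum.cong refl) (auto simp: garch_dc_0 s_def d_def T_def)
      also have "\<dots> = H * (s / d\<^sup>2)" unfolding H_def by (rule sum_distrib_right[symmetric])
      finally have e: "(\<Sum>l\<le>p + q. h l * dc l 0) = h 0 * dc 0 0 + H * (s / d\<^sup>2)" .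
      have dc00: "dc 0 0 = 1 / d" by (simp add: garch_dc_0 d_def T_def)
      show ?thesis unfolding e dc00 c0 x_def y_def
        using s d by (simp add: field_simps power2_eq_square)
    qed
    have xy: "\<bar>x + y\<bar> \<le> \<eta> * (1 + K)" using x y(1) by (simp add: algebra_simps)
    have c0n: "0 \<le> c 0" using c0_pos by simp
    have "garch_c p q u 0 - c 0 = c 0 * ((x + y) * (1 / (1 - y)))"
      unfolding cu using y1 by (simp add: field_simps)
    then have "\<bar>garch_c p q u 0 - c 0\<bar> = c 0 * (\<bar>x + y\<bar> * (1 / (1 - y)))"
      using c0n inv(2) y1 by (simp add: abs_mult)
    also have "\<dots> \<le> c 0 * (\<eta> * (1 + K) * 2)"
      using xy inv c0n \<eta> K by (intro mult_left_mono mult_mono) auto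
    also have "\<dots> \<le> c 0 * (\<eta> * (1 + K) * (2 * K))"
      using K \<eta> c0n by (intro mult_left_mono) auto
    finally have 1: "\<bar>garch_c p q u 0 - c 0\<bar> \<le> \<eta> * (2 * (1 + K) * K) * c 0" by (simp add: algebra_simps)
    have "garch_c p q u 0 - c 0 - (\<Sum>l\<le>p + q. h l * dc l 0) = c 0 * ((x + y) * (y * (1 / (1 - y))))"
      unfolding cu L using y1 by (simp add: field_simps)
    then have "\<bar>garch_c p q u 0 - c 0 - (\<Sum>l\<le>p + q. h l * dc l 0)\<bar> = c 0 * (\<bar>x + y\<bar> * (\<bar>y\<bar> * (1 / (1 - y))))"
      using c0n inv(2) y1 by (simp add: abs_mult)
    also have "\<dots> \<le> c 0 * (\<eta> * (1 + K) * ((\<eta> * K) * 2))"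
      using xy y(1) inv c0n \<eta> K by (intro mult_left_mono mult_mono) auto
    finally have 2: "\<bar>garch_c p q u 0 - c 0 - (\<Sum>l\<le>p + q. h l * dc l 0)\<bar> \<le> \<eta>\<^sup>2 * (2 * (1 + K) * K) * c 0"
      by (simp add: algebra_simps power2_eq_square)
    show ?thesis using 1 2 unfolding h_def by blast
  qed
  have "1 \<le> 2 * (1 + K) * K" using mult_mono[of 1 "2 * (1 + K)" 1 K] K by simp
  then show ?thesis using main d
    by (intro exI[of _ "2 * (1 + K) * K"] conjI exI[of _ "d / 2"]) auto
qed

lemma dc0_le: "\<exists>C\<ge>1. \<forall>l\<le>p + q. \<theta> l * dc l 0 \<le> C * c 0"
proof -
  define d where "d = 1 - (\<Sum>j=1..q. \<theta> (p + j))"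
  have d: "0 < d" using beta_sum rho by (simp add: d_def)
  have c0: "c 0 = \<theta> 0 / d" by (simp add: garch_c_0 d_def)
  define C where "C = 1 + (\<Sum>l\<le>p + q. \<theta> l) / d"
  have S: "0 \<le> (\<Sum>l\<le>p + q. \<theta> l)" by (intro sum_nonneg less_imp_le[OF pos]) auto
  have "\<theta> l * dc l 0 \<le> C * c 0" if l: "l \<le> p + q" for l
  proof -
    have le: "\<theta> l \<le> (\<Sum>l\<le>p + q. \<theta> l)" using l by (intro member_le_sum less_imp_le[OF pos]) auto
    consider "l = 0" | "p < l" "l \<noteq> 0" | "l \<le> p" "l \<noteq> 0" by linarith
    then show ?thesis
    proof cases
      case 1
      have "1 * c 0 \<le> C * c 0" using S d c0_pos by (intro mult_right_mono) (auto simp: C_def)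
      then show ?thesis using 1 by (simp add: garch_dc_0 c0 d_def)
    next
      case 2
      have "\<theta> l * dc l 0 = \<theta> l / d * c 0" using 2 by (simp add: garch_dc_0 c0 d_def power2_eq_square)
      also have "\<dots> \<le> C * c 0"
        using le d c0_pos divide_right_mono[OF le, of d] by (intro mult_right_mono) (auto simp: C_def)
      finally show ?thesis .
    next
      case 3
      then show ?thesis using S d c0_pos by (auto simp: garch_dc_0 C_def intro!: mult_nonneg_nonneg add_nonneg_nonneg)
    qed
  qed
  moreover have "1 \<le> C" using S d by (simp add: C_def)
  ultimately show ?thesis by blast
qed

text \<open>The polynomial factors \<open>i\<close> and \<open>i\<^sup>2\<close> of the two remainders, and the powers \<open>(1 + \<eta>)\<^sup>i\<close> for small
  \<open>\<eta>\<close>, are absorbed into powers of an arbitrary \<open>b > 1\<close>. All bounds are relative to the weight itself, which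
  is what keeps the expansion of the variance under control however heavy the tails of the process are.\<close>

theorem c_expansion:
  assumes b: "1 < b"
  shows "\<exists>C \<eta>0. 1 \<le> C \<and> 0 < \<eta>0 \<and> \<eta>0 \<le> 1 \<and>
    (\<forall>\<eta> u i. 0 \<le> \<eta> \<longrightarrow> \<eta> \<le> \<eta>0 \<longrightarrow> (\<forall>l\<le>p + q. \<bar>u l - \<theta> l\<bar> \<le> \<eta> * \<theta> l) \<longrightarrow>
      \<bar>garch_c p q u i - c i\<bar> \<le> \<eta> * (C * b ^ i * c i) \<and>
      \<bar>garch_c p q u i - c i - (\<Sum>l\<le>p + q. (u l - \<theta> l) * dc l i)\<bar> \<le> \<eta>\<^sup>2 * (C * b ^ i * c i)) \<and>
    (\<forall>l\<le>p + q. \<forall>i. \<theta> l * dc l i \<le> C * b ^ i * c i)"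
proof -
  \<comment> \<open>One factor \<open>a\<^sup>i\<close> for each of the two factors \<open>i\<close> and one for \<open>(1 + \<eta>)\<^sup>i\<close>.\<close>
  define a where "a = root 3 b"
  have a: "1 < a" "a ^ 3 = b" using b by (auto simp: a_def)
  obtain C1 where C1: "C1 > 0" "\<And>i. real i \<le> C1 * a ^ i" using linear_times_geometric_bounded[OF a(1)] by blast
  obtain C2 \<eta>2 where C2: "1 \<le> C2" "0 < \<eta>2"
    "\<And>\<eta> u. 0 \<le> \<eta> \<Longrightarrow> \<eta> \<le> \<eta>2 \<Longrightarrow> (\<forall>l\<le>p + q. \<bar>u l - \<theta> l\<bar> \<le> \<eta> * \<theta> l) \<Longrightarrow>
      \<bar>garch_c p q u 0 - c 0\<bar> \<le> \<eta> * C2 * c 0 \<and>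
      \<bar>garch_c p q u 0 - c 0 - (\<Sum>l\<le>p + q. (u l - \<theta> l) * dc l 0)\<bar> \<le> \<eta>\<^sup>2 * C2 * c 0"
    using c0_perturbation by blast
  obtain C3 where C3: "1 \<le> C3" "\<And>l. l \<le> p + q \<Longrightarrow> \<theta> l * dc l 0 \<le> C3 * c 0" using dc0_le by blast
  define C where "C = C1\<^sup>2 + C1 + C2 + C3"
  have C: "C1\<^sup>2 \<le> C" "C1 \<le> C" "C2 \<le> C" "C3 \<le> C" "1 \<le> C" using C1(1) C2(1) C3(1) zero_le_power2[of C1] unfolding C_def by linarith+
  define \<eta>0 where "\<eta>0 = min 1 (min \<eta>2 (a - 1))"
  have \<eta>0: "0 < \<eta>0" "\<eta>0 \<le> 1" "\<eta>0 \<le> \<eta>2" "1 + \<eta>0 \<le> a" using a C2 by (auto simp: \<eta>0_def)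
  have ab: "a ^ i * a ^ i * a ^ i = b ^ i" for i
    unfolding a(2)[symmetric] by (simp add: power3_eq_cube power_mult_distrib)
  have growth2: "(real i)\<^sup>2 * (1 + \<eta>) ^ i \<le> C * b ^ i" if "0 \<le> \<eta>" "\<eta> \<le> \<eta>0" for i \<eta>
  proof -
    have "(real i)\<^sup>2 * (1 + \<eta>) ^ i \<le> (C1 * a ^ i)\<^sup>2 * a ^ i"
      using C1 that \<eta>0 by (intro mult_mono power_mono) auto
    also have "\<dots> = C1\<^sup>2 * b ^ i" unfolding ab[symmetric] by (simp add: power_mult_distrib power2_eq_square)
    also have "\<dots> \<le> C * b ^ i" using C b by (intro mult_right_mono) auto
    finally show ?thesis .
  qed
  have growth1: "real i * (1 + \<eta>) ^ i \<le> C * b ^ i" if "0 \<le> \<eta>" "\<eta> \<le> \<eta>0" for i \<eta>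
  proof -
    have "real i * (1 + \<eta>) ^ i \<le> (real i)\<^sup>2 * (1 + \<eta>) ^ i"
      using that by (intro mult_right_mono) (auto simp: power2_eq_square mult_le_cancel_left1)
    then show ?thesis using growth2[OF that, of i] by linarith
  qed
  have growth0: "real i \<le> C * b ^ i" for i using growth1[of 0 i] \<eta>0 by simp
  have exp: "\<bar>garch_c p q u i - c i\<bar> \<le> \<eta> * (C * b ^ i * c i) \<and>
      \<bar>garch_c p q u i - c i - (\<Sum>l\<le>p + q. (u l - \<theta> l) * dc l i)\<bar> \<le> \<eta>\<^sup>2 * (C * b ^ i * c i)"
    if \<eta>: "0 \<le> \<eta>" "\<eta> \<le> \<eta>0" and u: "\<forall>l\<le>p + q. \<bar>u l - \<theta> l\<bar> \<le> \<eta> * \<theta> l" for \<eta> u i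
  proof (cases "i = 0")
    case True
    have "\<bar>garch_c p q u 0 - c 0\<bar> \<le> \<eta> * C2 * c 0"
      "\<bar>garch_c p q u 0 - c 0 - (\<Sum>l\<le>p + q. (u l - \<theta> l) * dc l 0)\<bar> \<le> \<eta>\<^sup>2 * C2 * c 0"
      using C2(3)[of \<eta> u] \<eta> \<eta>0 u by auto
    moreover have "\<eta> * C2 * c 0 \<le> \<eta> * C * c 0" "\<eta>\<^sup>2 * C2 * c 0 \<le> \<eta>\<^sup>2 * C * c 0"
      using C \<eta> c0_pos by (auto intro!: mult_right_mono mult_left_mono)
    ultimately show ?thesis unfolding True by (auto simp: mult.assoc)
  next
    case False
    have "\<bar>garch_c p q u i - c i\<bar> \<le> ((1 + \<eta>) ^ i - 1) * c i"
      using c_perturbation[of \<eta> u i] \<eta> u False by auto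
    also have "\<dots> \<le> (real i * \<eta> * (1 + \<eta>) ^ i) * c i"
      using power_remainder_1[OF \<eta>(1)] c_nonneg by (intro mult_right_mono) auto
    also have "\<dots> = \<eta> * ((real i * (1 + \<eta>) ^ i) * c i)" by (simp add: algebra_simps)
    also have "\<dots> \<le> \<eta> * (C * b ^ i * c i)"
      using growth1[OF \<eta>] c_nonneg \<eta> by (intro mult_left_mono mult_right_mono) auto
    finally have 1: "\<bar>garch_c p q u i - c i\<bar> \<le> \<eta> * (C * b ^ i * c i)" .
    have "\<bar>garch_c p q u i - c i - (\<Sum>l\<le>p + q. (u l - \<theta> l) * dc l i)\<bar> \<le> ((1 + \<eta>) ^ i - 1 - real i * \<eta>) * c i"
      using c_perturbation[of \<eta> u i] \<eta> u False by auto
    also have "\<dots> \<le> ((real i)\<^sup>2 * \<eta>\<^sup>2 * (1 + \<eta>) ^ i) * c i"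
      using power_remainder_2[OF \<eta>(1)] c_nonneg by (intro mult_right_mono) auto
    also have "\<dots> = \<eta>\<^sup>2 * (((real i)\<^sup>2 * (1 + \<eta>) ^ i) * c i)" by (simp add: algebra_simps)
    also have "\<dots> \<le> \<eta>\<^sup>2 * (C * b ^ i * c i)"
      using growth2[OF \<eta>] c_nonneg \<eta> by (intro mult_left_mono mult_right_mono) auto
    finally show ?thesis using 1 by blast
  qed
  have der: "\<theta> l * dc l i \<le> C * b ^ i * c i" if l: "l \<le> p + q" for l i
  proof (cases "i = 0")
    case True
    have "C3 * c 0 \<le> C * c 0" using C c0_pos by (intro mult_right_mono) auto
    then show ?thesis using C3(2)[OF l] True by simp
  next
    case False
    have "\<theta> l * dc l i \<le> real i * c i" using False l by (intro dc_le) auto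
    also have "\<dots> \<le> C * b ^ i * c i" using growth0 c_nonneg by (intro mult_right_mono) auto
    finally show ?thesis .
  qed
  show ?thesis using C(5) \<eta>0 exp der by blast
qed

end

section \<open>Inequalities for powers, tightness of a random variable\<close>

lemma powr_add_le:
  assumes "0 \<le> x" "0 \<le> y" "0 < s" "s \<le> (1::real)"
  shows "(x + y) powr s \<le> x powr s + y powr s"
proof (cases "x + y = 0")
  case False
  define z where "z = x + y"
  have z: "0 < z" using False assms by (simp add: z_def)
  have le: "u / z \<le> (u / z) powr s" if "0 \<le> u" "u \<le> z" for u
  proof (cases "u = 0")
    case False
    then show ?thesis using that z assms powr_mono'[of s 1 "u / z"] by simp
  qed simp
  have "z powr s = z powr s * (x / z + y / z)" using z by (simp add: z_def add_divide_distrib[symmetric])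
  also have "\<dots> \<le> z powr s * ((x / z) powr s + (y / z) powr s)"
    using le[of x] le[of y] assms by (intro mult_left_mono add_mono) (auto simp: z_def)
  also have "\<dots> = x powr s + y powr s"
    using z assms by (simp add: distrib_left powr_divide)
  finally show ?thesis by (simp add: z_def)
qed (use assms in auto)

lemma (in prob_space) tight:
  fixes W :: "'a \<Rightarrow> real"
  assumes [measurable]: "W \<in> borel_measurable M" and \<delta>: "0 < \<delta>"
  shows "\<exists>L\<ge>0. prob {\<omega>\<in>space M. L < W \<omega>} < \<delta>"
proof -
  have "(\<lambda>n. prob {\<omega>\<in>space M. real n < W \<omega>}) \<longlonglongrightarrow> prob (\<Inter>n. {\<omega>\<in>space M. real n < W \<omega>})"
    by (intro finite_Lim_measure_decseq) (auto simp: decseq_def)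
  moreover have "(\<Inter>n. {\<omega>\<in>space M. real n < W \<omega>}) = {}"
  proof (rule equals0I)
    fix \<omega> assume a: "\<omega> \<in> (\<Inter>n. {\<omega>\<in>space M. real n < W \<omega>})"
    obtain n :: nat where "W \<omega> \<le> real n" using real_arch_simple by blast
    moreover have "real n < W \<omega>" using a by blast
    ultimately show False by simp
  qed
  ultimately have "(\<lambda>n. prob {\<omega>\<in>space M. real n < W \<omega>}) \<longlonglongrightarrow> 0" by simp
  from order_tendstoD(2)[OF this \<delta>] obtain n where "prob {\<omega>\<in>space M. real n < W \<omega>} < \<delta>"
    by (auto simp: eventually_sequentially)
  then show ?thesis by (intro exI[of _ "real n"]) simp
qed

text \<open>The difference quotients at 0 of \<open>s \<mapsto> exp (s * v)\<close> along \<open>s = 1 / k\<close>, with bounds that serve as integrable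
  majorants; the upper one is Bernoulli's inequality for \<open>exp (v / k)\<close>.\<close>

lemma exp_scaled_bounds:
  fixes v :: real
  assumes k: "0 < k"
  shows "v \<le> (exp (v / real k) - 1) * real k" "(exp (v / real k) - 1) * real k \<le> exp v - 1"
proof -
  have "1 + v / real k \<le> exp (v / real k)" by (rule exp_ge_add_one_self)
  then show "v \<le> (exp (v / real k) - 1) * real k" using k by (simp add: field_simps)
  have "1 + real k * (exp (v / real k) - 1) \<le> (1 + (exp (v / real k) - 1)) ^ k"
    by (rule Bernoulli_inequality) simp
  also have "\<dots> = exp v" using k by (simp add: exp_of_nat_mult[symmetric])
  finally show "(exp (v / real k) - 1) * real k \<le> exp v - 1" by (simp add: algebra_simps)
qed

lemma exp_scaled_tendsto: "(\<lambda>k. (exp (v / real (Suc k)) - 1) * real (Suc k)) \<longlonglongrightarrow> (v::real)"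
proof -
  have "((\<lambda>h. (exp (v * h) - 1) / h) \<longlongrightarrow> v) (at 0)"
  proof -
    have "((\<lambda>x. exp (v * x)) has_field_derivative v) (at 0)"
      by (auto intro!: derivative_eq_intros)
    then show ?thesis by (simp add: has_field_derivative_iff)
  qed
  moreover have "filterlim (\<lambda>k. 1 / real (Suc k)) (at 0) sequentially"
    using LIMSEQ_Suc[OF lim_1_over_n[where 'a = real]] by (auto simp: filterlim_at)
  ultimately have "(\<lambda>k. (exp (v * (1 / real (Suc k))) - 1) / (1 / real (Suc k))) \<longlonglongrightarrow> v"
    by (rule filterlim_compose)
  then show ?thesis by simp
qed

section \<open>Products of GARCH matrices\<close>

text \<open>The action of a matrix on vectors that are encoded as functions on the natural numbers.\<close>

definition mact :: "real mat \<Rightarrow> (nat \<Rightarrow> real) \<Rightarrow> nat \<Rightarrow> real" where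
  "mact A y i = (\<Sum>j<dim_col A. A $$ (i, j) * y j)"

lemma mact_mult:
  assumes "A \<in> carrier_mat d d" "B \<in> carrier_mat d d" "i < d"
  shows "mact (A * B) y i = mact A (mact B y) i"
proof -
  have "mact (A * B) y i = (\<Sum>j<d. (\<Sum>k<d. A $$ (i, k) * B $$ (k, j)) * y j)"
    using assms unfolding mact_def
    by (intro sum.cong) (auto simp: scalar_prod_def atLeast0LessThan)
  also have "\<dots> = (\<Sum>j<d. \<Sum>k<d. A $$ (i, k) * (B $$ (k, j) * y j))"
    by (simp add: sum_distrib_right mult.assoc)
  also have "\<dots> = (\<Sum>k<d. \<Sum>j<d. A $$ (i, k) * (B $$ (k, j) * y j))" by (rule sum.swap)
  also have "\<dots> = mact A (mact B y) i"
    using assms by (simp add: mact_def sum_distrib_left)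
  finally show ?thesis .
qed

lemma mact_add: "mact A (\<lambda>j. y j + z j) i = mact A y i + mact A z i"
  by (simp add: mact_def algebra_simps sum.distrib)

lemma mact_cong: "A \<in> carrier_mat d d \<Longrightarrow> (\<And>j. j < d \<Longrightarrow> y j = z j) \<Longrightarrow> mact A y i = mact A z i"
  by (simp add: mact_def)

lemma row_sum_le_norm:
  "A \<in> carrier_mat d d \<Longrightarrow> i < d \<Longrightarrow> (\<Sum>j<d. \<bar>A $$ (i, j)\<bar>) \<le> row_sum_norm A"
  unfolding row_sum_norm_def by (intro Max_ge) auto

lemma row_sum_norm_le:
  "A \<in> carrier_mat d d \<Longrightarrow> 0 < d \<Longrightarrow> (\<And>i. i < d \<Longrightarrow> (\<Sum>j<d. \<bar>A $$ (i, j)\<bar>) \<le> v) \<Longrightarrow> row_sum_norm A \<le> v"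
  unfolding row_sum_norm_def by (intro Max.boundedI) auto

lemma row_sum_norm_nonneg: "A \<in> carrier_mat d d \<Longrightarrow> 0 < d \<Longrightarrow> 0 \<le> row_sum_norm A"
  by (rule order_trans[OF _ row_sum_le_norm[of A d 0]]) (auto intro: sum_nonneg)

lemma mact_le:
  assumes "A \<in> carrier_mat d d" "i < d" "\<And>j. j < d \<Longrightarrow> \<bar>y j\<bar> \<le> v" "0 \<le> v"
  shows "\<bar>mact A y i\<bar> \<le> row_sum_norm A * v"
proof -
  have "\<bar>mact A y i\<bar> \<le> (\<Sum>j<d. \<bar>A $$ (i, j)\<bar> * v)"
    using assms unfolding mact_def
    by (intro order_trans[OF sum_abs]) (auto simp: abs_mult intro!: sum_mono mult_left_mono)
  also have "\<dots> = (\<Sum>j<d. \<bar>A $$ (i, j)\<bar>) * v" by (simp add: sum_distrib_right)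
  also have "\<dots> \<le> row_sum_norm A * v"
    using assms row_sum_le_norm by (intro mult_right_mono) auto
  finally show ?thesis .
qed

lemma row_sum_norm_mult:
  assumes A: "A \<in> carrier_mat d d" and B: "B \<in> carrier_mat d d" and d: "0 < d"
  shows "row_sum_norm (A * B) \<le> row_sum_norm A * row_sum_norm B"
proof (rule row_sum_norm_le[of _ d])
  fix i assume i: "i < d"
  have "(\<Sum>j<d. \<bar>(A * B) $$ (i, j)\<bar>) \<le> (\<Sum>j<d. \<Sum>k<d. \<bar>A $$ (i, k)\<bar> * \<bar>B $$ (k, j)\<bar>)"
  proof (intro sum_mono)
    fix j assume "j \<in> {..<d}"
    then have "(A * B) $$ (i, j) = (\<Sum>k<d. A $$ (i, k) * B $$ (k, j))"
      using A B i by (auto simp: scalar_prod_def atLeast0LessThan)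
    then show "\<bar>(A * B) $$ (i, j)\<bar> \<le> (\<Sum>k<d. \<bar>A $$ (i, k)\<bar> * \<bar>B $$ (k, j)\<bar>)"
      using sum_abs[of "\<lambda>k. A $$ (i, k) * B $$ (k, j)" "{..<d}"] by (simp add: abs_mult)
  qed
  also have "\<dots> = (\<Sum>k<d. \<bar>A $$ (i, k)\<bar> * (\<Sum>j<d. \<bar>B $$ (k, j)\<bar>))"
    by (subst sum.swap) (simp add: sum_distrib_left)
  also have "\<dots> \<le> (\<Sum>k<d. \<bar>A $$ (i, k)\<bar> * row_sum_norm B)"
    using B row_sum_le_norm by (intro sum_mono mult_left_mono) auto
  also have "\<dots> \<le> row_sum_norm A * row_sum_norm B"
    unfolding sum_distrib_right[symmetric]
    using A B i d row_sum_le_norm row_sum_norm_nonneg by (intro mult_right_mono) auto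
  finally show "(\<Sum>j<d. \<bar>(A * B) $$ (i, j)\<bar>) \<le> row_sum_norm A * row_sum_norm B" .
qed (use A B d in auto)

text \<open>The matrix product of the Lyapunov exponent with the noise sequence itself as sample point, so that
  the product started at any time \<open>t\<close> is this function of \<open>past \<epsilon> t\<close>.\<close>

definition past_prod :: "nat \<Rightarrow> nat \<Rightarrow> (nat \<Rightarrow> real) \<Rightarrow> nat \<Rightarrow> (nat \<Rightarrow> real) \<Rightarrow> real mat" where
  "past_prod p q \<theta> n e = garch_matrix_prod p q \<theta> (\<lambda>t e. e (nat (- t))) n e"

lemma past_prod_0: "past_prod p q \<theta> 0 e = garch_matrix p q \<theta> (e 0)"
  by (simp add: past_prod_def)

lemma past_prod_Suc: "past_prod p q \<theta> (Suc n) e = past_prod p q \<theta> n e * garch_matrix p q \<theta> (e (Suc n))"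
  by (simp add: past_prod_def nat_add_distrib)

lemma garch_matrix_prod_past: "garch_matrix_prod p q \<theta> \<epsilon> n \<omega> = past_prod p q \<theta> n (past \<epsilon> 0 \<omega>)"
proof (induction n)
  case (Suc n)
  show ?case unfolding past_prod_Suc Suc[symmetric] garch_matrix_prod.simps by (simp add: past_def)
qed (simp add: past_prod_0 past_def)

lemma carrier_garch_matrix: "garch_matrix p q \<theta> x \<in> carrier_mat (p + q - 1) (p + q - 1)"
  by (simp add: garch_matrix_def)

lemma carrier_past_prod: "past_prod p q \<theta> n e \<in> carrier_mat (p + q - 1) (p + q - 1)"
proof (induction n)
  case 0
  show ?case unfolding past_prod_0 by (rule carrier_garch_matrix)
next
  case (Suc n)
  show ?case unfolding past_prod_Suc by (rule mult_carrier_mat[OF Suc carrier_garch_matrix])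
qed

lemma depends_past_prod: "depends_on_first (Suc n) (past_prod p q \<theta> n)"
proof (induction n)
  case (Suc n)
  then show ?case unfolding depends_on_first_def past_prod_Suc
    by (metis less_Suc_eq)
qed (simp add: depends_on_first_def past_prod_0)

lemma garch_matrix_measurable:
  assumes "i < p + q - 1" "j < p + q - 1"
  shows "(\<lambda>x. garch_matrix p q \<theta> x $$ (i, j)) \<in> borel_measurable borel"
  using assms unfolding garch_matrix_def by simp

lemma past_prod_measurable:
  assumes "i < p + q - 1" "j < p + q - 1"
  shows "(\<lambda>e. past_prod p q \<theta> n e $$ (i, j)) \<in> borel_measurable seq_borel"
  using assms
proof (induction n arbitrary: i j)
  case 0
  have "(\<lambda>e. e 0) \<in> measurable seq_borel borel" by (rule measurable_component_singleton) simp
  from measurable_compose[OF this garch_matrix_measurable[OF 0]] show ?case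
    by (simp add: past_prod_0)
next
  case (Suc n)
  let ?d = "p + q - 1"
  have eq: "past_prod p q \<theta> (Suc n) e $$ (i, j) =
      (\<Sum>k<?d. past_prod p q \<theta> n e $$ (i, k) * garch_matrix p q \<theta> (e (Suc n)) $$ (k, j))" for e
    using carrier_past_prod[of p q \<theta> n e] carrier_garch_matrix[of p q \<theta> "e (Suc n)"] Suc.prems
    unfolding past_prod_Suc by (auto simp: scalar_prod_def atLeast0LessThan)
  have "(\<lambda>e. e (Suc n)) \<in> measurable seq_borel borel" by (rule measurable_component_singleton) simp
  then have "(\<lambda>e. garch_matrix p q \<theta> (e (Suc n)) $$ (k, j)) \<in> borel_measurable seq_borel" if "k < ?d" for k
    by (rule measurable_compose[OF _ garch_matrix_measurable[OF that Suc.prems(2)]])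
  then show ?case unfolding eq
    by (intro borel_measurable_sum borel_measurable_times Suc.IH) (use Suc.prems in auto)
qed

lemma norm_past_prod_measurable [measurable]:
  assumes "0 < p + q - 1"
  shows "(\<lambda>e. row_sum_norm (past_prod p q \<theta> n e)) \<in> borel_measurable seq_borel"
proof -
  let ?d = "p + q - 1"
  have "row_sum_norm (past_prod p q \<theta> n e) =
      Max ((\<lambda>i. \<Sum>j<?d. \<bar>past_prod p q \<theta> n e $$ (i, j)\<bar>) ` {..<?d})" for e
    using carrier_past_prod[of p q \<theta> n e] by (auto simp: row_sum_norm_def)
  then show ?thesis
    by (simp, intro borel_measurable_Max borel_measurable_sum borel_measurable_abs past_prod_measurable) auto
qed

lemma norm_garch_matrix_le:
  assumes "0 < p + q - 1"
  shows "\<exists>K\<ge>0. \<forall>x. row_sum_norm (garch_matrix p q \<theta> x) \<le> K * (1 + x\<^sup>2)"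
proof -
  let ?d = "p + q - 1"
  define K where "K = real ?d * (1 + (\<Sum>l\<le>p + q + 1. \<bar>\<theta> l\<bar>))"
  let ?m = "1 + (\<Sum>l\<le>p + q + 1. \<bar>\<theta> l\<bar>)"
  have th: "\<bar>\<theta> l\<bar> \<le> (\<Sum>l\<le>p + q + 1. \<bar>\<theta> l\<bar>)" if "l \<le> p + q + 1" for l
    using that by (intro member_le_sum[of l _ "\<lambda>l. \<bar>\<theta> l\<bar>"]) auto
  have S: "0 \<le> (\<Sum>l\<le>p + q + 1. \<bar>\<theta> l\<bar>)" by (intro sum_nonneg) auto
  have "row_sum_norm (garch_matrix p q \<theta> x) \<le> K * (1 + x\<^sup>2)" for x
  proof (rule row_sum_norm_le[OF carrier_garch_matrix assms])
    fix i assume i: "i < ?d"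
    have entry: "\<bar>garch_matrix p q \<theta> x $$ (i, j)\<bar> \<le> ?m * (1 + x\<^sup>2)" if j: "j < ?d" for j
    proof -
      define B where "B = ?m * (1 + x\<^sup>2)"
      have x1: "1 \<le> 1 + x\<^sup>2" by simp
      have big: "z \<le> B" if "z \<le> ?m" for z
        using that mult_left_mono[OF x1, of ?m] S by (simp add: B_def)
      have "\<bar>\<theta> (p + 1) + \<theta> 1 * x\<^sup>2\<bar> \<le> \<bar>\<theta> (p + 1)\<bar> + \<bar>\<theta> 1\<bar> * x\<^sup>2"
        using abs_triangle_ineq[of "\<theta> (p + 1)" "\<theta> 1 * x\<^sup>2"] by (simp add: abs_mult)
      also have "\<dots> \<le> ?m * 1 + ?m * x\<^sup>2"
        using th[of "p + 1"] th[of 1] assms by (intro add_mono mult_right_mono) auto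
      finally have e00: "\<bar>\<theta> (p + 1) + \<theta> 1 * x\<^sup>2\<bar> \<le> B" by (simp add: distrib_left B_def)
      have e2: "\<bar>x\<^sup>2\<bar> \<le> B"
        using mult_right_mono[of 1 ?m "1 + x\<^sup>2"] S by (simp add: B_def)
      have e1: "\<bar>\<theta> (p + j + 1)\<bar> \<le> B" if "j < q" using that th[of "p + j + 1"] by (intro big) auto
      have e3: "\<bar>\<theta> (j - q + 2)\<bar> \<le> B" if "\<not> j < q"
      proof -
        have "j - q + 2 \<le> p + q + 1" using j that by arith
        from th[OF this] show ?thesis by (intro big) linarith
      qed
      have e4: "\<bar>0 :: real\<bar> \<le> B" "\<bar>1 :: real\<bar> \<le> B" using big[of 0] big[of 1] S by simp_all
      have eqn: "garch_matrix p q \<theta> x $$ (i, j) = (if i = 0 then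
          (if j = 0 then \<theta> (p + 1) + \<theta> 1 * x\<^sup>2 else if j < q then \<theta> (p + j + 1) else \<theta> (j - q + 2))
        else if i = q then (if j = 0 then x\<^sup>2 else 0) else (if j = i - 1 then 1 else 0))"
        using i j by (simp add: garch_matrix_def)
      have "\<bar>garch_matrix p q \<theta> x $$ (i, j)\<bar> \<le> B"
        unfolding eqn using e00 e1 e2 e3 e4 by (simp only: split: if_split) blast
      then show ?thesis by (simp only: B_def)
    qed
    have "(\<Sum>j<?d. \<bar>garch_matrix p q \<theta> x $$ (i, j)\<bar>) \<le> (\<Sum>j<?d. ?m * (1 + x\<^sup>2))"
      by (intro sum_mono entry) auto
    also have "\<dots> = K * (1 + x\<^sup>2)" by (simp add: K_def mult.assoc)
    finally show "(\<Sum>j<?d. \<bar>garch_matrix p q \<theta> x $$ (i, j)\<bar>) \<le> K * (1 + x\<^sup>2)" .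
  qed
  moreover have "0 \<le> K" using S by (simp add: K_def)
  ultimately show ?thesis by blast
qed

section \<open>Fractional moments of the stationary solution\<close>

locale garch_process = iid_noise M \<epsilon> + garch_parameter p q \<theta> \<rho>
  for M :: "'a measure" and \<epsilon> :: "int \<Rightarrow> 'a \<Rightarrow> real" and p q :: nat and \<theta> :: "nat \<Rightarrow> real" and \<rho> :: real +
  fixes X \<sigma> :: "int \<Rightarrow> 'a \<Rightarrow> real"
  assumes p: "1 \<le> p"
    and noise_square: "integrable M (\<lambda>\<omega>. (\<epsilon> 0 \<omega>)\<^sup>2)"
    and contraction: "bougerol_picard M p q \<theta> \<epsilon>"
    and solution: "garch_stationary_solution M p q \<theta> \<epsilon> X \<sigma>"
begin

lemma measurable_X [measurable]: "X t \<in> borel_measurable M"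
  and measurable_sigma [measurable]: "\<sigma> t \<in> borel_measurable M"
proof -
  have m: "(\<lambda>\<omega>. (X t \<omega>, \<sigma> t \<omega>)) \<in> measurable M (borel \<Otimes>\<^sub>M borel)"
    using solution unfolding garch_stationary_solution_def strictly_stationary_def by blast
  show "X t \<in> borel_measurable M" "\<sigma> t \<in> borel_measurable M"
    using measurable_compose[OF m measurable_fst] measurable_compose[OF m measurable_snd] by simp_all
qed

text \<open>The model equations on a fixed path. Since time is countable, they hold for all times
  simultaneously on almost every path.\<close>

definition solves :: "'a \<Rightarrow> bool" where
  "solves \<omega> \<longleftrightarrow> (\<forall>t. \<sigma> t \<omega> \<ge> 0 \<and> X t \<omega> = \<sigma> t \<omega> * \<epsilon> t \<omega> \<and>
    (\<sigma> t \<omega>)\<^sup>2 = \<theta> 0 + (\<Sum>i=1..p. \<theta> i * (X (t - int i) \<omega>)\<^sup>2) +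
      (\<Sum>j=1..q. \<theta> (p + j) * (\<sigma> (t - int j) \<omega>)\<^sup>2))"

lemma AE_solves: "AE \<omega> in M. solves \<omega>"
  using solution unfolding solves_def garch_stationary_solution_def garch_equations_def
  by (subst AE_all_countable) blast

text \<open>The volatility as a function of the past noise, as given by causality.\<close>

definition vol :: "(nat \<Rightarrow> real) \<Rightarrow> real" where
  "vol = (SOME f. f \<in> borel_measurable seq_borel \<and> (\<forall>t. AE \<omega> in M. \<sigma> t \<omega> = f (past \<epsilon> (t - 1) \<omega>)))"

lemma measurable_vol [measurable]: "vol \<in> borel_measurable seq_borel"
  and sigma_vol_single: "AE \<omega> in M. \<sigma> t \<omega> = vol (past \<epsilon> (t - 1) \<omega>)"
proof -
  have "\<exists>f. f \<in> borel_measurable seq_borel \<and> (\<forall>t. AE \<omega> in M. \<sigma> t \<omega> = f (past \<epsilon> (t - 1) \<omega>))"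
    using solution unfolding garch_stationary_solution_def causal_def past_def by blast
  from someI_ex[OF this] show "vol \<in> borel_measurable seq_borel" "AE \<omega> in M. \<sigma> t \<omega> = vol (past \<epsilon> (t - 1) \<omega>)"
    unfolding vol_def by blast+
qed

lemma sigma_vol: "AE \<omega> in M. \<forall>t. \<sigma> t \<omega> = vol (past \<epsilon> (t - 1) \<omega>)"
  by (subst AE_all_countable) (use sigma_vol_single in blast)

lemma nn_integral_sigma:
  assumes [measurable]: "g \<in> borel_measurable borel"
  shows "(\<integral>\<^sup>+\<omega>. g (\<sigma> t \<omega>) \<partial>M) = (\<integral>\<^sup>+e. g (vol e) \<partial>past_law)"
proof -
  have "(\<integral>\<^sup>+\<omega>. g (\<sigma> t \<omega>) \<partial>M) = (\<integral>\<^sup>+\<omega>. (\<lambda>e. g (vol e)) (past \<epsilon> (t - 1) \<omega>) \<partial>M)"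
    by (rule nn_integral_cong_AE, rule eventually_mono[OF sigma_vol_single[of t]]) simp
  also have "\<dots> = (\<integral>\<^sup>+e. g (vol e) \<partial>past_law)" by (rule nn_integral_past) measurable
  finally show ?thesis .
qed

lemma prob_sigma:
  assumes "{x. P x} \<in> sets borel"
  shows "prob {\<omega>\<in>space M. P (\<sigma> t \<omega>)} = prob {\<omega>\<in>space M. P (\<sigma> 0 \<omega>)}"
proof -
  have [measurable]: "Measurable.pred borel P" using assms by (simp add: pred_def)
  have "emeasure M {\<omega>\<in>space M. P (\<sigma> t \<omega>)} = (\<integral>\<^sup>+\<omega>. indicator {x. P x} (\<sigma> t \<omega>) \<partial>M)" for t
  proof -
    have "emeasure M {\<omega>\<in>space M. P (\<sigma> t \<omega>)} = (\<integral>\<^sup>+\<omega>. indicator {\<omega>\<in>space M. P (\<sigma> t \<omega>)} \<omega> \<partial>M)"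
      by (rule nn_integral_indicator[symmetric]) measurable
    also have "\<dots> = (\<integral>\<^sup>+\<omega>. indicator {x. P x} (\<sigma> t \<omega>) \<partial>M)"
      by (intro nn_integral_cong) (simp add: indicator_def)
    finally show ?thesis .
  qed
  then show ?thesis using assms by (simp add: measure_def nn_integral_sigma)
qed

abbreviation d :: nat where "d \<equiv> p + q - 1"

lemma d_pos: "0 < d" using p q by simp

lemma d_nonempty: "{..<d} \<noteq> {}" using d_pos by (metis lessThan_iff empty_iff)

abbreviation prodnorm :: "nat \<Rightarrow> (nat \<Rightarrow> real) \<Rightarrow> real" where
  "prodnorm n e \<equiv> row_sum_norm (past_prod p q \<theta> n e)"

lemma prodnorm_nonneg: "0 \<le> prodnorm n e"
  by (rule row_sum_norm_nonneg[OF carrier_past_prod d_pos])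

lemma measurable_prodnorm [measurable]: "prodnorm n \<in> borel_measurable seq_borel"
  by (rule norm_past_prod_measurable[OF d_pos])

lemma depends_prodnorm: "depends_on_first (Suc n) (prodnorm n)"
  using depends_past_prod[of n p q \<theta>] unfolding depends_on_first_def by metis

text \<open>The state vector on which \<open>garch_matrix\<close> acts: \<open>q\<close> conditional variances followed by \<open>p - 1\<close>
  squared observations, most recent first.\<close>

definition state :: "int \<Rightarrow> 'a \<Rightarrow> nat \<Rightarrow> real" where
  "state t \<omega> i = (if i < q then (\<sigma> (t + 1 - int i) \<omega>)\<^sup>2 else (X (t - int (i - q)) \<omega>)\<^sup>2)"

definition const_vec :: "nat \<Rightarrow> real" where
  "const_vec i = (if i = 0 then \<theta> 0 else 0)"

lemma state_recursion:
  assumes sol: "solves \<omega>"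
    and i: "i < d"
  shows "state t \<omega> i = mact (garch_matrix p q \<theta> (\<epsilon> t \<omega>)) (state (t - 1) \<omega>) i + const_vec i"
proof -
  let ?A = "garch_matrix p q \<theta> (\<epsilon> t \<omega>)" and ?y = "state (t - 1) \<omega>" and ?x = "\<epsilon> t \<omega>"
  have mact: "mact ?A ?y i = (\<Sum>j<d. ?A $$ (i, j) * ?y j)"
    by (simp add: mact_def garch_matrix_def)
  have y0: "?y 0 = (\<sigma> t \<omega>)\<^sup>2" using q by (simp add: state_def)
  note eqs = sol[unfolded solves_def]
  have Xt: "(X t \<omega>)\<^sup>2 = ?x\<^sup>2 * (\<sigma> t \<omega>)\<^sup>2" 
  proof -
    have "X t \<omega> = \<sigma> t \<omega> * \<epsilon> t \<omega>" using eqs by blast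
    then show ?thesis by (simp add: power_mult_distrib)
  qed
  consider "i = 0" | "i = q" "i \<noteq> 0" | "i \<noteq> 0" "i \<noteq> q" by blast
  then show ?thesis
  proof cases
    case 1
    have row: "mact ?A ?y 0 = (\<Sum>j<d. (if j = 0 then \<theta> (p + 1) + \<theta> 1 * ?x\<^sup>2
         else if j < q then \<theta> (p + j + 1) else \<theta> (j - q + 2)) * ?y j)"
      unfolding mact[unfolded 1] using i 1 by (intro sum.cong refl) (simp add: garch_matrix_def)
    have split: "{..<d} = {..<q} \<union> {q..<d}" using p by auto
    have "mact ?A ?y 0 = (\<Sum>j<q. (if j = 0 then \<theta> (p + 1) + \<theta> 1 * ?x\<^sup>2 else \<theta> (p + j + 1)) * ?y j) +
        (\<Sum>j=q..<d. \<theta> (j - q + 2) * ?y j)"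
    proof -
      let ?h = "\<lambda>j. (if j = 0 then \<theta> (p + 1) + \<theta> 1 * ?x\<^sup>2
         else if j < q then \<theta> (p + j + 1) else \<theta> (j - q + 2)) * ?y j"
      have disj: "{..<q} \<inter> {q..<d} = {}" by auto
      have "sum ?h {..<d} = sum ?h {..<q} + sum ?h {q..<d}"
      proof -
        have "sum ?h {..<d} = sum ?h ({..<q} \<union> {q..<d})" using split by (rule arg_cong)
        also have "\<dots> = sum ?h {..<q} + sum ?h {q..<d}"
          by (rule sum.union_disjoint[OF finite_lessThan finite_atLeastLessThan disj])
        finally show ?thesis .
      qed
      with row have "mact ?A ?y 0 = sum ?h {..<q} + sum ?h {q..<d}" by (rule trans)
      also have "sum ?h {..<q} = (\<Sum>j<q. (if j = 0 then \<theta> (p + 1) + \<theta> 1 * ?x\<^sup>2 else \<theta> (p + j + 1)) * ?y j)"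
        by (intro sum.cong refl) simp
      also have "sum ?h {q..<d} = (\<Sum>j=q..<d. \<theta> (j - q + 2) * ?y j)"
        using q by (intro sum.cong refl) simp
      finally show ?thesis .
    qed
    also have "(\<Sum>j<q. (if j = 0 then \<theta> (p + 1) + \<theta> 1 * ?x\<^sup>2 else \<theta> (p + j + 1)) * ?y j) =
        (\<Sum>j<q. \<theta> (p + j + 1) * ?y j) + \<theta> 1 * ?x\<^sup>2 * ?y 0"
    proof -
      have "(\<Sum>j<q. (if j = 0 then \<theta> (p + 1) + \<theta> 1 * ?x\<^sup>2 else \<theta> (p + j + 1)) * ?y j) =
          (\<Sum>j<q. \<theta> (p + j + 1) * ?y j + (if j = 0 then \<theta> 1 * ?x\<^sup>2 * ?y 0 else 0))"
        by (intro sum.cong refl) (auto simp: algebra_simps)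
      then show ?thesis using q by (simp add: sum.distrib)
    qed
    also have "(\<Sum>j<q. \<theta> (p + j + 1) * ?y j) = (\<Sum>j=1..q. \<theta> (p + j) * (\<sigma> (t + 1 - int j) \<omega>)\<^sup>2)"
      by (rule sum.reindex_bij_witness[where i = "\<lambda>j. j - 1" and j = Suc]) (auto simp: state_def algebra_simps)
    also have "(\<Sum>j=q..<d. \<theta> (j - q + 2) * ?y j) = (\<Sum>i=2..p. \<theta> i * (X (t + 1 - int i) \<omega>)\<^sup>2)"
      by (rule sum.reindex_bij_witness[where i = "\<lambda>i. i - 2 + q" and j = "\<lambda>j. j - q + 2"])
         (auto simp: state_def algebra_simps of_nat_diff)
    finally have r: "mact ?A ?y 0 = (\<Sum>j=1..q. \<theta> (p + j) * (\<sigma> (t + 1 - int j) \<omega>)\<^sup>2) + \<theta> 1 * (X t \<omega>)\<^sup>2 +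
        (\<Sum>i=2..p. \<theta> i * (X (t + 1 - int i) \<omega>)\<^sup>2)" unfolding y0 Xt by (simp add: algebra_simps)
    have "(\<Sum>i=1..p. \<theta> i * (X (t + 1 - int i) \<omega>)\<^sup>2) = \<theta> 1 * (X t \<omega>)\<^sup>2 + (\<Sum>i=2..p. \<theta> i * (X (t + 1 - int i) \<omega>)\<^sup>2)"
      using p by (subst sum.atLeast_Suc_atMost) (auto simp: numeral_2_eq_2)
    then have "(\<sigma> (t + 1) \<omega>)\<^sup>2 = mact ?A ?y 0 + \<theta> 0"
      using eqs[rule_format, of "t + 1"] r by simp
    then show ?thesis using 1 q by (simp add: state_def const_vec_def)
  next
    case 2
    have "mact ?A ?y i = (\<Sum>j<d. (if j = 0 then ?x\<^sup>2 * ?y 0 else 0))"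
      unfolding mact using i 2 by (intro sum.cong refl) (simp add: garch_matrix_def)
    also have "\<dots> = ?x\<^sup>2 * ?y 0" using d_pos by simp
    finally show ?thesis using 2 Xt y0 by (simp add: state_def const_vec_def)
  next
    case 3
    have "mact ?A ?y i = (\<Sum>j<d. (if j = i - 1 then ?y (i - 1) else 0))"
      unfolding mact using i 3 by (intro sum.cong refl) (simp add: garch_matrix_def)
    also have "\<dots> = ?y (i - 1)" using i by simp
    finally show ?thesis using 3
      by (auto simp: state_def const_vec_def of_nat_diff algebra_simps Suc_diff_le not_less)
  qed
qed

definition state_norm :: "int \<Rightarrow> 'a \<Rightarrow> real" where
  "state_norm t \<omega> = Max ((\<lambda>i. state t \<omega> i) ` {..<d})"

lemma state_nonneg: "0 \<le> state t \<omega> i" by (simp add: state_def)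

lemma state_le_norm: "i < d \<Longrightarrow> state t \<omega> i \<le> state_norm t \<omega>"
  unfolding state_norm_def by (intro Max_ge) auto

lemma state_norm_nonneg: "0 \<le> state_norm t \<omega>"
  using state_le_norm[OF d_pos] state_nonneg order_trans by blast

lemma measurable_state [measurable]: "(\<lambda>\<omega>. state t \<omega> i) \<in> borel_measurable M"
  unfolding state_def by measurable

lemma measurable_state_norm [measurable]: "state_norm t \<in> borel_measurable M"
  unfolding state_norm_def by measurable

text \<open>A bound on the accumulated inhomogeneous terms when the recursion of the state is iterated
  \<open>n + 1\<close> times.\<close>

definition inhom :: "nat \<Rightarrow> (nat \<Rightarrow> real) \<Rightarrow> real" where
  "inhom n e = \<theta> 0 * (1 + (\<Sum>j<n. prodnorm j e))"

lemma state_norm_recursion: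
  assumes sol: "solves \<omega>"
  shows "state_norm t \<omega> \<le> prodnorm n (past \<epsilon> t \<omega>) * state_norm (t - int (Suc n)) \<omega> + inhom n (past \<epsilon> t \<omega>)"
proof -
  let ?e = "past \<epsilon> t \<omega>"
  have th0: "0 < \<theta> 0" using pos[of 0] by simp
  have claim: "\<bar>state t \<omega> i - mact (past_prod p q \<theta> n ?e) (state (t - int (Suc n)) \<omega>) i\<bar> \<le> inhom n ?e"
    if i: "i < d" for i
  proof (induction n)
    case 0
    show ?case using state_recursion[OF sol i, of t] th0
      by (simp add: past_prod_0 past_def inhom_def const_vec_def)
  next
    case (Suc n)
    let ?P = "past_prod p q \<theta> n ?e" and ?s = "t - int (Suc n)"
    let ?A = "garch_matrix p q \<theta> (?e (Suc n))"
    have A: "?A = garch_matrix p q \<theta> (\<epsilon> ?s \<omega>)" by (simp add: past_def)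
    have "mact ?P (state ?s \<omega>) i = mact ?P (\<lambda>j. mact ?A (state (?s - 1) \<omega>) j + const_vec j) i"
      by (rule mact_cong[OF carrier_past_prod]) (use state_recursion[OF sol, of _ ?s] in \<open>simp add: A\<close>)
    also have "\<dots> = mact ?P (mact ?A (state (?s - 1) \<omega>)) i + mact ?P const_vec i" by (rule mact_add)
    also have "mact ?P (mact ?A (state (?s - 1) \<omega>)) i = mact (past_prod p q \<theta> (Suc n) ?e) (state (?s - 1) \<omega>) i"
      unfolding past_prod_Suc by (rule mact_mult[OF carrier_past_prod carrier_garch_matrix i, symmetric])
    finally have e: "mact ?P (state ?s \<omega>) i = mact (past_prod p q \<theta> (Suc n) ?e) (state (?s - 1) \<omega>) i + mact ?P const_vec i" .
    have "\<bar>mact ?P const_vec i\<bar> \<le> prodnorm n ?e * \<theta> 0"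
      using th0 by (intro mact_le[OF carrier_past_prod i]) (auto simp: const_vec_def)
    moreover have "inhom (Suc n) ?e = inhom n ?e + prodnorm n ?e * \<theta> 0" by (simp add: inhom_def algebra_simps)
    moreover have s1: "t - int (Suc (Suc n)) = ?s - 1" by simp
    ultimately show ?case unfolding s1 using Suc e by linarith
  qed
  have "state t \<omega> i \<le> prodnorm n ?e * state_norm (t - int (Suc n)) \<omega> + inhom n ?e" if i: "i < d" for i
  proof -
    have "\<bar>mact (past_prod p q \<theta> n ?e) (state (t - int (Suc n)) \<omega>) i\<bar> \<le> prodnorm n ?e * state_norm (t - int (Suc n)) \<omega>"
      using state_nonneg state_le_norm by (intro mact_le[OF carrier_past_prod i] state_norm_nonneg) (auto simp: abs_of_nonneg)
    then show ?thesis using claim[OF i] by linarith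
  qed
  then show ?thesis unfolding state_norm_def[of t] using d_nonempty by (intro Max.boundedI) auto
qed

lemma prodnorm_integrable: "integrable past_law (prodnorm n)"
proof -
  obtain K where K: "0 \<le> K" "\<And>x. row_sum_norm (garch_matrix p q \<theta> x) \<le> K * (1 + x\<^sup>2)"
    using norm_garch_matrix_le[OF d_pos] by blast
  have m0 [measurable]: "(\<lambda>e. e 0) \<in> borel_measurable seq_borel"
    by (rule measurable_component_singleton) simp
  have int: "integrable M (\<lambda>\<omega>. K * (1 + (\<epsilon> 0 \<omega>)\<^sup>2))"
    using noise_square by simp
  have "(\<integral>\<^sup>+e. ennreal (K * (1 + (e 0)\<^sup>2)) \<partial>past_law) = (\<integral>\<^sup>+\<omega>. ennreal (K * (1 + (past \<epsilon> 0 \<omega> 0)\<^sup>2)) \<partial>M)"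
    by (rule nn_integral_past[symmetric]) measurable
  also have "\<dots> = ennreal (\<integral>\<omega>. K * (1 + (\<epsilon> 0 \<omega>)\<^sup>2) \<partial>M)"
    using nn_integral_eq_integral[OF int] K(1) by (simp add: past_def)
  finally have fin: "(\<integral>\<^sup>+e. ennreal (K * (1 + (e 0)\<^sup>2)) \<partial>past_law) < \<infinity>" by simp
  have "(\<integral>\<^sup>+e. ennreal (prodnorm n e) \<partial>past_law) < \<infinity>"
  proof (induction n)
    case 0
    have "(\<integral>\<^sup>+e. ennreal (prodnorm 0 e) \<partial>past_law) \<le> (\<integral>\<^sup>+e. ennreal (K * (1 + (e 0)\<^sup>2)) \<partial>past_law)"
      by (intro nn_integral_mono ennreal_leI) (simp add: past_prod_0 K(2))
    then show ?case using fin by (rule le_less_trans)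
  next
    case (Suc n)
    let ?g = "\<lambda>e. ennreal (K * (1 + (e 0)\<^sup>2))"
    have "(\<integral>\<^sup>+e. ennreal (prodnorm (Suc n) e) \<partial>past_law) \<le>
        (\<integral>\<^sup>+e. ennreal (prodnorm n e) * ?g (tail_from (Suc n) e) \<partial>past_law)"
    proof (intro nn_integral_mono)
      fix e
      have "prodnorm (Suc n) e \<le> prodnorm n e * row_sum_norm (garch_matrix p q \<theta> (e (Suc n)))"
        unfolding past_prod_Suc by (rule row_sum_norm_mult[OF carrier_past_prod carrier_garch_matrix d_pos])
      also have "\<dots> \<le> prodnorm n e * (K * (1 + (e (Suc n))\<^sup>2))"
        by (intro mult_left_mono K(2) prodnorm_nonneg)
      finally show "ennreal (prodnorm (Suc n) e) \<le> ennreal (prodnorm n e) * ?g (tail_from (Suc n) e)"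
        using K(1) by (subst ennreal_mult'[symmetric]) (auto simp: tail_from_def prodnorm_nonneg intro!: ennreal_leI)
    qed
    also have "\<dots> = (\<integral>\<^sup>+e. ennreal (prodnorm n e) \<partial>past_law) * (\<integral>\<^sup>+e. ?g e \<partial>past_law)"
      by (rule nn_integral_head_tail[OF _ _ depends_on_first_comp[OF depends_prodnorm]]) measurable
    also have "\<dots> < \<infinity>" using Suc fin by (simp add: ennreal_mult_less_top)
    finally show ?case .
  qed
  then show ?thesis by (intro integrableI_nonneg) (auto simp: prodnorm_nonneg)
qed

text \<open>Since the integral of a non-integrable function is 0 by convention, a negative expectation of the logarithm
  already contains its integrability.\<close>

lemma contracting_block: "\<exists>n. integrable past_law (\<lambda>e. ln (prodnorm n e)) \<and> (\<integral>e. ln (prodnorm n e) \<partial>past_law) < 0"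
proof -
  have "top_lyapunov M p q \<theta> \<epsilon> < 0" using contraction by (simp add: bougerol_picard_def)
  then obtain n where "(LINT \<omega>|M. ln (row_sum_norm (garch_matrix_prod p q \<theta> \<epsilon> n \<omega>))) / real (n + 1) < 0"
    unfolding top_lyapunov_def by (auto simp: INF_less_iff)
  then have "(LINT \<omega>|M. ln (prodnorm n (past \<epsilon> 0 \<omega>))) < 0"
    by (simp add: garch_matrix_prod_past divide_less_0_iff)
  then have "(\<integral>e. ln (prodnorm n e) \<partial>past_law) < 0" by (subst (asm) integral_past) measurable
  moreover from this have "integrable past_law (\<lambda>e. ln (prodnorm n e))"
    using not_integrable_integral_eq by fastforce
  ultimately show ?thesis by blast
qed

text \<open>Put \<open>V = ln (prodnorm n e)\<close>. The derivative of \<open>s \<mapsto> E exp (s * V)\<close> at \<open>s = 0\<close> is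
  \<open>E V < 0\<close>, and the value at 0 is 1; so the moment is below 1 for some small \<open>s > 0\<close>. The exchange of limit and
  expectation uses that the norm itself has a finite expectation because the noise has a finite variance.\<close>

lemma contracting_moment:
  "\<exists>n s. 0 < s \<and> s \<le> 1 \<and> (\<integral>\<^sup>+e. ennreal (exp (s * ln (prodnorm n e))) \<partial>past_law) < 1"
proof -
  obtain n where n: "integrable past_law (\<lambda>e. ln (prodnorm n e))" "(\<integral>e. ln (prodnorm n e) \<partial>past_law) < 0"
    using contracting_block by blast
  define V where "V e = ln (prodnorm n e)" for e
  have [measurable]: "V \<in> borel_measurable seq_borel" unfolding V_def by measurable
  have V: "integrable past_law V" "(\<integral>e. V e \<partial>past_law) < 0" using n by (simp_all add: V_def[abs_def])
  have expV: "exp (V e) \<le> 1 + prodnorm n e" for e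
    using prodnorm_nonneg[of n e] by (cases "prodnorm n e = 0") (auto simp: V_def)
  have w: "integrable past_law (\<lambda>e. \<bar>V e\<bar> + (1 + prodnorm n e))"
    using V(1) prodnorm_integrable by simp
  let ?f = "\<lambda>k e. (exp (V e / real (Suc k)) - 1) * real (Suc k)"
  \<comment> \<open>The difference quotients lie between \<open>V\<close> and \<open>exp V - 1\<close>.\<close>
  have dom: "\<bar>?f k e\<bar> \<le> \<bar>V e\<bar> + (1 + prodnorm n e)" for k e
    using exp_scaled_bounds[of "Suc k" "V e"] expV[of e] prodnorm_nonneg[of n e] by linarith
  have "(\<lambda>k. \<integral>e. ?f k e \<partial>past_law) \<longlonglongrightarrow> (\<integral>e. V e \<partial>past_law)"
    by (rule integral_dominated_convergence[OF _ _ w]) (use dom exp_scaled_tendsto in auto)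
  from order_tendstoD(2)[OF this V(2)] obtain k where k: "(\<integral>e. ?f k e \<partial>past_law) < 0"
    by (auto simp: eventually_sequentially)
  define s where "s = 1 / real (Suc k)"
  have int_f: "integrable past_law (?f k)"
    by (rule Bochner_Integration.integrable_bound[OF w]) (use dom in \<open>auto intro: order_trans[OF _ abs_ge_self]\<close>)
  have eq: "exp (s * V e) = 1 + s * ?f k e" for e by (simp add: s_def)
  have int_e: "integrable past_law (\<lambda>e. exp (s * V e))" unfolding eq using int_f by simp
  have "(\<integral>e. exp (s * V e) \<partial>past_law) = 1 + s * (\<integral>e. ?f k e \<partial>past_law)"
    unfolding eq using int_f by simp
  also have "\<dots> < 1" using k by (simp add: s_def mult_less_0_iff divide_less_0_iff)
  finally have "(\<integral>\<^sup>+e. ennreal (exp (s * V e)) \<partial>past_law) < 1"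
    using int_e by (subst nn_integral_eq_integral) (auto simp: ennreal_less_one_iff)
  moreover have "0 < s" "s \<le> 1" by (auto simp: s_def)
  ultimately show ?thesis unfolding V_def by blast
qed

text \<open>A squared observation is dominated by the next conditional variance, because \<open>\<alpha>\<^sub>1 > 0\<close>. It
  transfers tightness and moments from the volatility to the observations.\<close>

lemma arch_bound:
  assumes sol: "solves \<omega>"
  shows "\<theta> 1 * (X t \<omega>)\<^sup>2 \<le> (\<sigma> (t + 1) \<omega>)\<^sup>2"
proof -
  note eqs = sol[unfolded solves_def]
  have "\<theta> 1 * (X (t + 1 - int 1) \<omega>)\<^sup>2 \<le> (\<Sum>i=1..p. \<theta> i * (X (t + 1 - int i) \<omega>)\<^sup>2)"
    using p by (intro member_le_sum[of 1 _ "\<lambda>i. \<theta> i * (X (t + 1 - int i) \<omega>)\<^sup>2"])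
      (auto intro!: mult_nonneg_nonneg less_imp_le[OF pos])
  moreover have "0 \<le> (\<Sum>j=1..q. \<theta> (p + j) * (\<sigma> (t + 1 - int j) \<omega>)\<^sup>2)"
    by (intro sum_nonneg mult_nonneg_nonneg less_imp_le[OF pos]) auto
  moreover have "0 < \<theta> 0" by (rule pos) simp
  ultimately show ?thesis using eqs[rule_format, of "t + 1"] by simp
qed

lemma state_tight:
  assumes \<delta>: "0 < \<delta>"
  shows "\<exists>L\<ge>0. \<forall>t. prob {\<omega>\<in>space M. L < state_norm t \<omega>} < \<delta>"
proof -
  have th1: "0 < \<theta> 1" using pos[of 1] p by simp
  define \<delta>' where "\<delta>' = \<delta> / real d"
  have "0 < \<delta>'" using \<delta> d_pos by (simp add: \<delta>'_def)
  then obtain L where L: "0 \<le> L" "prob {\<omega>\<in>space M. L < (\<sigma> 0 \<omega>)\<^sup>2} < \<delta>'"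
    using tight[of "\<lambda>\<omega>. (\<sigma> 0 \<omega>)\<^sup>2" \<delta>'] by auto
  define L' where "L' = max L (L / \<theta> 1)"
  have comp: "prob {\<omega>\<in>space M. L' < state t \<omega> i} < \<delta>'" if "i < d" for t i
  proof (cases "i < q")
    case True
    have "prob {\<omega>\<in>space M. L' < state t \<omega> i} \<le> prob {\<omega>\<in>space M. L < (\<sigma> (t + 1 - int i) \<omega>)\<^sup>2}"
      using True by (intro finite_measure_mono) (auto simp: state_def L'_def)
    also have "\<dots> = prob {\<omega>\<in>space M. L < (\<sigma> 0 \<omega>)\<^sup>2}"
      by (rule prob_sigma[where P = "\<lambda>x. L < x\<^sup>2"]) measurable
    finally show ?thesis using L(2) by linarith
  next
    case False
    let ?u = "t - int (i - q)"
    have "AE \<omega> in M. L' < state t \<omega> i \<longrightarrow> L < (\<sigma> (?u + 1) \<omega>)\<^sup>2"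
      using AE_solves
    proof (rule eventually_mono)
      fix \<omega> assume sol: "solves \<omega>"
      from arch_bound[OF sol, of ?u]
      show "L' < state t \<omega> i \<longrightarrow> L < (\<sigma> (?u + 1) \<omega>)\<^sup>2"
        using False th1 by (auto simp: state_def L'_def field_simps)
    qed
    then have "prob {\<omega>\<in>space M. L' < state t \<omega> i} \<le> prob {\<omega>\<in>space M. L < (\<sigma> (?u + 1) \<omega>)\<^sup>2}"
      by (intro finite_measure_mono_AE) auto
    also have "\<dots> = prob {\<omega>\<in>space M. L < (\<sigma> 0 \<omega>)\<^sup>2}"
      by (rule prob_sigma[where P = "\<lambda>x. L < x\<^sup>2"]) measurable
    finally show ?thesis using L(2) by linarith
  qed
  have "prob {\<omega>\<in>space M. L' < state_norm t \<omega>} < \<delta>" for t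
  proof -
    have "{\<omega>\<in>space M. L' < state_norm t \<omega>} \<subseteq> (\<Union>i<d. {\<omega>\<in>space M. L' < state t \<omega> i})"
      unfolding state_norm_def using d_nonempty by (auto simp: Max_gr_iff)
    then have "prob {\<omega>\<in>space M. L' < state_norm t \<omega>} \<le> prob (\<Union>i<d. {\<omega>\<in>space M. L' < state t \<omega> i})"
      by (intro finite_measure_mono) auto
    also have "\<dots> \<le> (\<Sum>i<d. prob {\<omega>\<in>space M. L' < state t \<omega> i})"
      by (intro finite_measure_subadditive_finite) auto
    also have "\<dots> < (\<Sum>i<d. \<delta>')"
      using comp d_nonempty by (intro sum_strict_mono) auto
    also have "\<dots> = \<delta>" using d_pos by (simp add: \<delta>'_def)
    finally show ?thesis .
  qed
  moreover have "0 \<le> L'" using L(1) by (simp add: L'_def)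
  ultimately show ?thesis by blast
qed

text \<open>The value at \<open>e\<close> is \<open>\<xi> e * \<xi> (tail_from N e) * \<dots> * g (tail_from (m * N) e)\<close>, with \<open>m\<close> factors \<open>\<xi>\<close>. If
  \<open>\<xi>\<close> depends on the first \<open>N\<close> coordinates only, the factors are independent.\<close>

definition cocycle :: "nat \<Rightarrow> ((nat \<Rightarrow> real) \<Rightarrow> real) \<Rightarrow> ((nat \<Rightarrow> real) \<Rightarrow> real) \<Rightarrow> nat \<Rightarrow> (nat \<Rightarrow> real) \<Rightarrow> real" where
  "cocycle N \<xi> g m = ((\<lambda>h e. \<xi> e * h (tail_from N e)) ^^ m) g"

lemma cocycle_0: "cocycle N \<xi> g 0 = g"
  and cocycle_Suc: "cocycle N \<xi> g (Suc m) e = \<xi> e * cocycle N \<xi> g m (tail_from N e)"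
  by (simp_all add: cocycle_def)

lemma cocycle_nonneg: "(\<And>e. 0 \<le> \<xi> e) \<Longrightarrow> (\<And>e. 0 \<le> g e) \<Longrightarrow> 0 \<le> cocycle N \<xi> g m e"
  by (induction m arbitrary: e) (auto simp: cocycle_0 cocycle_Suc)

lemma measurable_cocycle:
  assumes [measurable]: "\<xi> \<in> borel_measurable seq_borel" "g \<in> borel_measurable seq_borel"
  shows "cocycle N \<xi> g m \<in> borel_measurable seq_borel"
proof (induction m)
  case (Suc m)
  note [measurable] = Suc
  have "cocycle N \<xi> g (Suc m) = (\<lambda>e. \<xi> e * cocycle N \<xi> g m (tail_from N e))" by (auto simp: cocycle_Suc)
  then show ?case by simp
qed (simp add: cocycle_0)

lemma nn_integral_cocycle:
  assumes [measurable]: "\<xi> \<in> borel_measurable seq_borel" "g \<in> borel_measurable seq_borel"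
    and nn: "\<And>e. 0 \<le> \<xi> e" "\<And>e. 0 \<le> g e" and dep: "depends_on_first N \<xi>"
  shows "(\<integral>\<^sup>+e. ennreal (cocycle N \<xi> g m e) \<partial>past_law) =
    (\<integral>\<^sup>+e. ennreal (\<xi> e) \<partial>past_law) ^ m * (\<integral>\<^sup>+e. ennreal (g e) \<partial>past_law)"
proof (induction m)
  case (Suc m)
  note [measurable] = measurable_cocycle[OF assms(1,2)]
  have "(\<integral>\<^sup>+e. ennreal (cocycle N \<xi> g (Suc m) e) \<partial>past_law) =
      (\<integral>\<^sup>+e. ennreal (\<xi> e) * (\<lambda>e. ennreal (cocycle N \<xi> g m e)) (tail_from N e) \<partial>past_law)"
    using nn by (simp add: cocycle_Suc ennreal_mult' cocycle_nonneg)
  also have "\<dots> = (\<integral>\<^sup>+e. ennreal (\<xi> e) \<partial>past_law) * (\<integral>\<^sup>+e. ennreal (cocycle N \<xi> g m e) \<partial>past_law)"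
    by (rule nn_integral_head_tail[OF _ _ depends_on_first_comp[OF dep]]) measurable
  finally show ?case using Suc by (simp add: mult.assoc)
qed (simp add: cocycle_0)

text \<open>Let \<open>Z\<^sub>t\<close> be the \<open>s\<close>-th power of the norm of the state. Iterating the recursion over \<open>j\<close> blocks of
  length \<open>N\<close> bounds \<open>Z\<^sub>t\<close> by a product of \<open>j\<close> independent factors of mean \<open>r < 1\<close> times \<open>Z\<^bsub>t-jN\<^esub>\<close>, plus a sum with
  expectation at most \<open>G / (1 - r)\<close>. By stationarity \<open>Z\<^bsub>t-jN\<^esub>\<close> is tight uniformly in \<open>j\<close>, so the first part tends
  to 0 in probability and the bound \<open>G / (1 - r)\<close> remains for the truncated expectation of \<open>Z\<^sub>t\<close>, whatever the
  level of truncation.\<close>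

lemma sigma_fractional_moment:
  "\<exists>s. 0 < s \<and> s \<le> 1 \<and> (\<exists>R::real. \<forall>t. (\<integral>\<^sup>+\<omega>. ennreal (((\<sigma> t \<omega>)\<^sup>2) powr s) \<partial>M) \<le> ennreal R)"
proof -
  obtain n s where s: "0 < s" "s \<le> 1"
    and r1: "(\<integral>\<^sup>+e. ennreal (exp (s * ln (prodnorm n e))) \<partial>past_law) < 1"
    using contracting_moment by blast
  define N where "N = Suc n"
  define \<xi> where "\<xi> e = exp (s * ln (prodnorm n e))" for e
  define g where "g e = 1 + inhom n e" for e
  define Z where "Z t \<omega> = state_norm t \<omega> powr s" for t \<omega>
  have [measurable]: "\<xi> \<in> borel_measurable seq_borel" unfolding \<xi>_def by measurable
  have inhom_nn: "0 \<le> inhom n e" for e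
    unfolding inhom_def using pos[of 0] prodnorm_nonneg by (auto intro!: mult_nonneg_nonneg add_nonneg_nonneg sum_nonneg)
  have [measurable]: "g \<in> borel_measurable seq_borel" unfolding g_def inhom_def by measurable
  have [measurable]: "Z t \<in> borel_measurable M" for t unfolding Z_def by measurable
  have nn: "0 \<le> \<xi> e" "0 \<le> g e" for e using inhom_nn by (auto simp: \<xi>_def g_def intro: add_nonneg_nonneg)
  have Z_nn: "0 \<le> Z t \<omega>" for t \<omega> by (simp add: Z_def)
  have dep: "depends_on_first N \<xi>"
    unfolding N_def \<xi>_def by (rule depends_on_first_comp[OF depends_prodnorm])
  obtain r where r: "0 \<le> r" "r < 1" "(\<integral>\<^sup>+e. ennreal (\<xi> e) \<partial>past_law) = ennreal r"
  proof -
    have "(\<integral>\<^sup>+e. ennreal (\<xi> e) \<partial>past_law) < 1" using r1 by (simp add: \<xi>_def)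
    then show ?thesis
      by (cases "\<integral>\<^sup>+e. ennreal (\<xi> e) \<partial>past_law") (auto intro: that simp: ennreal_less_one_iff)
  qed
  have "integrable past_law g"
    unfolding g_def inhom_def using prodnorm_integrable by simp
  then have "(\<integral>\<^sup>+e. ennreal (g e) \<partial>past_law) = ennreal (past.expectation g)"
    by (rule nn_integral_eq_integral) (simp add: nn)
  moreover have "0 \<le> past.expectation g" by (rule Bochner_Integration.integral_nonneg) (rule nn)
  ultimately obtain G where G: "0 \<le> G" "(\<integral>\<^sup>+e. ennreal (g e) \<partial>past_law) = ennreal G" by blast
  have step: "Z t \<omega> \<le> \<xi> (past \<epsilon> t \<omega>) * Z (t - int N) \<omega> + g (past \<epsilon> t \<omega>)"
    if "state_norm t \<omega> \<le> prodnorm n (past \<epsilon> t \<omega>) * state_norm (t - int (Suc n)) \<omega> + inhom n (past \<epsilon> t \<omega>)" for t \<omega>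
  proof -
    let ?P = "prodnorm n (past \<epsilon> t \<omega>)" and ?S = "state_norm (t - int (Suc n)) \<omega>" and ?B = "inhom n (past \<epsilon> t \<omega>)"
    have "Z t \<omega> \<le> (?P * ?S + ?B) powr s"
      unfolding Z_def using that s state_norm_nonneg by (intro powr_mono2) auto
    also have "\<dots> \<le> (?P * ?S) powr s + ?B powr s"
      using s inhom_nn prodnorm_nonneg state_norm_nonneg by (intro powr_add_le) auto
    also have "(?P * ?S) powr s = ?P powr s * Z (t - int N) \<omega>"
      using prodnorm_nonneg state_norm_nonneg by (simp add: powr_mult Z_def N_def)
    also have "?P powr s \<le> \<xi> (past \<epsilon> t \<omega>)" by (simp add: powr_def \<xi>_def)
    also have "?B powr s \<le> g (past \<epsilon> t \<omega>)"
    proof (cases "?B \<le> 1")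
      case True
      then have "?B powr s \<le> 1" using inhom_nn s by (intro powr_le1) auto
      then show ?thesis using inhom_nn[of "past \<epsilon> t \<omega>"] by (simp add: g_def)
    next
      case False
      then have "?B powr s \<le> ?B powr 1" using s by (intro powr_mono) auto
      then show ?thesis using False by (simp add: g_def)
    qed
    finally show ?thesis using Z_nn by (simp add: mult_right_mono)
  qed
  have iter: "AE \<omega> in M. \<forall>j t. Z t \<omega> \<le> cocycle N \<xi> (\<lambda>_. 1) j (past \<epsilon> t \<omega>) * Z (t - int (j * N)) \<omega> +
      (\<Sum>m<j. cocycle N \<xi> g m (past \<epsilon> t \<omega>))"
    using AE_solves
  proof (rule eventually_mono)
    fix \<omega> assume sol: "solves \<omega>"
    have st: "Z t \<omega> \<le> \<xi> (past \<epsilon> t \<omega>) * Z (t - int N) \<omega> + g (past \<epsilon> t \<omega>)" for t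
      by (rule step[OF state_norm_recursion[OF sol]])
    have "Z t \<omega> \<le> cocycle N \<xi> (\<lambda>_. 1) j (past \<epsilon> t \<omega>) * Z (t - int (j * N)) \<omega> +
      (\<Sum>m<j. cocycle N \<xi> g m (past \<epsilon> t \<omega>))" for j t
    proof (induction j arbitrary: t)
      case (Suc j)
      let ?e = "past \<epsilon> t \<omega>"
      have tl: "past \<epsilon> (t - int N) \<omega> = tail_from N ?e" by (simp add: tail_from_past)
      have "Z t \<omega> \<le> \<xi> ?e * Z (t - int N) \<omega> + g ?e" by (rule st)
      also have "\<dots> \<le> \<xi> ?e * (cocycle N \<xi> (\<lambda>_. 1) j (tail_from N ?e) * Z (t - int N - int (j * N)) \<omega> +
          (\<Sum>m<j. cocycle N \<xi> g m (tail_from N ?e))) + g ?e"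
        using Suc[of "t - int N"] nn(1) unfolding tl by (intro add_right_mono mult_left_mono)
      also have "\<dots> = cocycle N \<xi> (\<lambda>_. 1) (Suc j) ?e * Z (t - int N - int (j * N)) \<omega> +
          (g ?e + (\<Sum>m<j. cocycle N \<xi> g (Suc m) ?e))"
        by (simp add: cocycle_Suc distrib_left sum_distrib_left mult.assoc)
      also have "g ?e + (\<Sum>m<j. cocycle N \<xi> g (Suc m) ?e) = (\<Sum>m<Suc j. cocycle N \<xi> g m ?e)"
        by (subst sum.lessThan_Suc_shift) (simp add: cocycle_0)
      also have "t - int N - int (j * N) = t - int (Suc j * N)" by simp
      finally show ?case .
    qed (simp add: cocycle_0)
    then show "\<forall>j t. Z t \<omega> \<le> cocycle N \<xi> (\<lambda>_. 1) j (past \<epsilon> t \<omega>) * Z (t - int (j * N)) \<omega> +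
      (\<Sum>m<j. cocycle N \<xi> g m (past \<epsilon> t \<omega>))" by blast
  qed
  define R where "R = G / (1 - r)"
  have mc [measurable]: "cocycle N \<xi> g m \<in> borel_measurable seq_borel"
    "cocycle N \<xi> (\<lambda>_. 1) m \<in> borel_measurable seq_borel" for m
    by (rule measurable_cocycle; measurable)+
  \<comment> \<open>\<open>L\<close> is a level that all norms of the state exceed with small probability; \<open>j\<close> is chosen after \<open>L\<close>.\<close>
  have trunc: "(\<integral>\<^sup>+\<omega>. ennreal (min (Z t \<omega>) K) \<partial>M) \<le> ennreal (R + \<eta>)"
    if K: "0 < K" and \<eta>: "0 < \<eta>" for K \<eta> t
  proof -
    obtain L where L: "0 \<le> L" "\<And>t. prob {\<omega>\<in>space M. L < state_norm t \<omega>} < \<eta> / (2 * K)"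
      using state_tight[of "\<eta> / (2 * K)"] K \<eta> by auto
    have "(\<lambda>j. r ^ j * L powr s) \<longlonglongrightarrow> 0 * L powr s"
      using r by (intro tendsto_mult LIMSEQ_realpow_zero tendsto_const) auto
    then have "\<exists>j. r ^ j * L powr s < \<eta> / 2"
      using order_tendstoD(2)[of "\<lambda>j. r ^ j * L powr s" 0 sequentially "\<eta> / 2"] \<eta>
      by (auto simp: eventually_sequentially)
    then obtain j where j: "r ^ j * L powr s < \<eta> / 2" by blast
    let ?u = "t - int (j * N)"
    let ?E = "{\<omega>\<in>space M. L < state_norm ?u \<omega>}"
    let ?c1 = "\<lambda>\<omega>. cocycle N \<xi> (\<lambda>_. 1) j (past \<epsilon> t \<omega>)" and ?c2 = "\<lambda>m \<omega>. cocycle N \<xi> g m (past \<epsilon> t \<omega>)"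
    have c_nn: "0 \<le> ?c1 \<omega>" "0 \<le> ?c2 m \<omega>" for m \<omega> using nn by (auto intro!: cocycle_nonneg)
    have "(\<integral>\<^sup>+\<omega>. ennreal (min (Z t \<omega>) K) \<partial>M) \<le>
        (\<integral>\<^sup>+\<omega>. ennreal (L powr s) * ennreal (?c1 \<omega>) + (ennreal K * indicator ?E \<omega> + (\<Sum>m<j. ennreal (?c2 m \<omega>))) \<partial>M)"
    proof (rule nn_integral_mono_AE)
      from iter AE_space show "AE \<omega> in M. ennreal (min (Z t \<omega>) K) \<le>
        ennreal (L powr s) * ennreal (?c1 \<omega>) + (ennreal K * indicator ?E \<omega> + (\<Sum>m<j. ennreal (?c2 m \<omega>)))"
      proof eventually_elim
        case (elim \<omega>)
        have it: "Z t \<omega> \<le> ?c1 \<omega> * Z ?u \<omega> + (\<Sum>m<j. ?c2 m \<omega>)" using elim(1) by blast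
        have sum_nn: "0 \<le> (\<Sum>m<j. ?c2 m \<omega>)" by (intro sum_nonneg c_nn)
        have "min (Z t \<omega>) K \<le> L powr s * ?c1 \<omega> + (K * indicator ?E \<omega> + (\<Sum>m<j. ?c2 m \<omega>))"
        proof (cases "L < state_norm ?u \<omega>")
          case True
          then have "(indicator ?E \<omega> :: real) = 1" using elim(2) by simp
          then show ?thesis using sum_nn c_nn(1)[of \<omega>] by (simp add: min_le_iff_disj)
        next
          case False
          then have "Z ?u \<omega> \<le> L powr s" unfolding Z_def using s state_norm_nonneg by (intro powr_mono2) auto
          then have "?c1 \<omega> * Z ?u \<omega> \<le> L powr s * ?c1 \<omega>" using c_nn(1)[of \<omega>] by (simp add: mult.commute mult_right_mono)
          moreover have "0 \<le> K * indicator ?E \<omega>" using K by simp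
          ultimately show ?thesis using it by linarith
        qed
        then have "ennreal (min (Z t \<omega>) K) \<le> ennreal (L powr s * ?c1 \<omega> + (K * indicator ?E \<omega> + (\<Sum>m<j. ?c2 m \<omega>)))"
          by (rule ennreal_leI)
        also have "\<dots> = ennreal (L powr s) * ennreal (?c1 \<omega>) + (ennreal K * indicator ?E \<omega> + (\<Sum>m<j. ennreal (?c2 m \<omega>)))"
          using K c_nn sum_nn by (simp add: ennreal_mult' ennreal_plus sum_ennreal ennreal_indicator)
        finally show ?case .
      qed
    qed
    also have "\<dots> = ennreal (L powr s) * (\<integral>\<^sup>+\<omega>. ennreal (?c1 \<omega>) \<partial>M) +
        (ennreal K * emeasure M ?E + (\<Sum>m<j. \<integral>\<^sup>+\<omega>. ennreal (?c2 m \<omega>) \<partial>M))"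
      by (simp add: nn_integral_add nn_integral_cmult nn_integral_sum nn_integral_cmult_indicator)
    also have "(\<integral>\<^sup>+\<omega>. ennreal (?c1 \<omega>) \<partial>M) = ennreal (r ^ j)"
    proof -
      have "(\<integral>\<^sup>+\<omega>. ennreal (?c1 \<omega>) \<partial>M) = (\<integral>\<^sup>+e. ennreal (cocycle N \<xi> (\<lambda>_. 1) j e) \<partial>past_law)"
        by (rule nn_integral_past) measurable
      also have "\<dots> = ennreal r ^ j * (\<integral>\<^sup>+e. ennreal 1 \<partial>past_law)"
        by (subst nn_integral_cocycle) (use nn dep in \<open>auto simp: r(3)\<close>)
      finally show ?thesis using r(1) past.emeasure_space_1 by (simp add: ennreal_power)
    qed
    also have "(\<lambda>m. \<integral>\<^sup>+\<omega>. ennreal (?c2 m \<omega>) \<partial>M) = (\<lambda>m. ennreal (r ^ m * G))"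
    proof
      fix m
      have "(\<integral>\<^sup>+\<omega>. ennreal (?c2 m \<omega>) \<partial>M) = (\<integral>\<^sup>+e. ennreal (cocycle N \<xi> g m e) \<partial>past_law)"
        by (rule nn_integral_past) measurable
      also have "\<dots> = ennreal r ^ m * ennreal G"
        by (subst nn_integral_cocycle) (use nn dep in \<open>auto simp: r(3) G(2)\<close>)
      finally show "(\<integral>\<^sup>+\<omega>. ennreal (?c2 m \<omega>) \<partial>M) = ennreal (r ^ m * G)"
        using r(1) G(1) by (simp add: ennreal_power ennreal_mult')
    qed
    also have "ennreal (L powr s) * ennreal (r ^ j) + (ennreal K * emeasure M ?E + (\<Sum>m<j. ennreal (r ^ m * G))) =
        ennreal (L powr s * r ^ j + (K * prob ?E + (\<Sum>m<j. r ^ m * G)))"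
    proof -
      have "0 \<le> (\<Sum>m<j. r ^ m * G)" using r G by (intro sum_nonneg) auto
      moreover have "(\<Sum>m<j. ennreal (r ^ m * G)) = ennreal (\<Sum>m<j. r ^ m * G)"
        using r G by (intro sum_ennreal) auto
      moreover have "ennreal x * ennreal y + (ennreal K * ennreal P + ennreal S) = ennreal (x * y + (K * P + S))"
        if "0 \<le> x" "0 \<le> y" "0 \<le> P" "0 \<le> S" for x y P S :: real
        using that K by (simp add: ennreal_mult' ennreal_plus)
      ultimately show ?thesis using r by (simp only: emeasure_eq_measure powr_ge_zero zero_le_power measure_nonneg)
    qed
    also have "\<dots> \<le> ennreal (R + \<eta>)"
    proof (rule ennreal_leI)
      have "(\<Sum>m<j. r ^ m * G) = (1 - r ^ j) / (1 - r) * G"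
        using r by (simp add: sum_distrib_right[symmetric] sum_gp_strict)
      also have "\<dots> \<le> 1 / (1 - r) * G"
        using r G by (intro mult_right_mono divide_right_mono) auto
      finally have "(\<Sum>m<j. r ^ m * G) \<le> R" by (simp add: R_def)
      moreover have "K * prob ?E \<le> K * (\<eta> / (2 * K))" using L(2) K by (intro mult_left_mono) (auto intro: less_imp_le)
      moreover have "K * (\<eta> / (2 * K)) = \<eta> / 2" using K by simp
      ultimately show "L powr s * r ^ j + (K * prob ?E + (\<Sum>m<j. r ^ m * G)) \<le> R + \<eta>"
        using j by (simp add: mult.commute)
    qed
    finally show ?thesis .
  qed
  have Z_le: "(\<integral>\<^sup>+\<omega>. ennreal (Z t \<omega>) \<partial>M) \<le> ennreal (R + 1)" for t
  proof -
    have "(\<integral>\<^sup>+\<omega>. ennreal (Z t \<omega>) \<partial>M) = (\<integral>\<^sup>+\<omega>. (SUP k. ennreal (min (Z t \<omega>) (real (Suc k)))) \<partial>M)"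
    proof (intro nn_integral_cong)
      fix \<omega>
      obtain k :: nat where k: "Z t \<omega> \<le> real (Suc k)" using real_arch_simple[of "Z t \<omega>"] by (metis of_nat_le_iff order_trans le_SucI order_refl)
      show "ennreal (Z t \<omega>) = (SUP k. ennreal (min (Z t \<omega>) (real (Suc k))))"
      proof (rule antisym)
        have "ennreal (Z t \<omega>) = ennreal (min (Z t \<omega>) (real (Suc k)))" using k by simp
        also have "\<dots> \<le> (SUP k. ennreal (min (Z t \<omega>) (real (Suc k))))" by (rule SUP_upper) simp
        finally show "ennreal (Z t \<omega>) \<le> (SUP k. ennreal (min (Z t \<omega>) (real (Suc k))))" .
      qed (auto intro!: SUP_least ennreal_leI)
    qed
    also have "\<dots> = (SUP k. \<integral>\<^sup>+\<omega>. ennreal (min (Z t \<omega>) (real (Suc k))) \<partial>M)"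
      by (intro nn_integral_monotone_convergence_SUP) (auto simp: incseq_def le_fun_def intro!: ennreal_leI)
    also have "\<dots> \<le> ennreal (R + 1)" by (intro SUP_least trunc) auto
    finally show ?thesis .
  qed
  have "(\<integral>\<^sup>+\<omega>. ennreal (((\<sigma> t \<omega>)\<^sup>2) powr s) \<partial>M) \<le> ennreal (R + 1)" for t
  proof -
    have "(\<sigma> t \<omega>)\<^sup>2 \<le> state_norm (t - 1) \<omega>" for \<omega>
      using state_le_norm[OF d_pos, of "t - 1" \<omega>] q by (simp add: state_def)
    then have "(\<integral>\<^sup>+\<omega>. ennreal (((\<sigma> t \<omega>)\<^sup>2) powr s) \<partial>M) \<le> (\<integral>\<^sup>+\<omega>. ennreal (Z (t - 1) \<omega>) \<partial>M)"
      unfolding Z_def using s by (intro nn_integral_mono ennreal_leI powr_mono2) auto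
    also have "\<dots> \<le> ennreal (R + 1)" by (rule Z_le)
    finally show ?thesis .
  qed
  then show ?thesis using s by blast
qed

lemma fractional_moment:
  "\<exists>s. 0 < s \<and> s \<le> 1 \<and> (\<exists>R::real. \<forall>t. (\<integral>\<^sup>+\<omega>. ennreal (((\<sigma> t \<omega>)\<^sup>2) powr s) \<partial>M) \<le> ennreal R \<and>
    (\<integral>\<^sup>+\<omega>. ennreal (((X t \<omega>)\<^sup>2) powr s) \<partial>M) \<le> ennreal R)"
proof -
  obtain s R where s: "0 < s" "s \<le> 1" and R: "\<And>t. (\<integral>\<^sup>+\<omega>. ennreal (((\<sigma> t \<omega>)\<^sup>2) powr s) \<partial>M) \<le> ennreal R"
    using sigma_fractional_moment by blast
  define a where "a = (1 / \<theta> 1) powr s"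
  have th1: "0 < \<theta> 1" using pos[of 1] p by simp
  have "(\<integral>\<^sup>+\<omega>. ennreal (((X t \<omega>)\<^sup>2) powr s) \<partial>M) \<le> ennreal (a * \<bar>R\<bar>)" for t
  proof -
    have "(\<integral>\<^sup>+\<omega>. ennreal (((X t \<omega>)\<^sup>2) powr s) \<partial>M) \<le> (\<integral>\<^sup>+\<omega>. ennreal a * ennreal (((\<sigma> (t + 1) \<omega>)\<^sup>2) powr s) \<partial>M)"
    proof (rule nn_integral_mono_AE)
      from AE_solves show "AE \<omega> in M. ennreal (((X t \<omega>)\<^sup>2) powr s) \<le> ennreal a * ennreal (((\<sigma> (t + 1) \<omega>)\<^sup>2) powr s)"
      proof eventually_elim
        case (elim \<omega>)
        have "(X t \<omega>)\<^sup>2 \<le> 1 / \<theta> 1 * (\<sigma> (t + 1) \<omega>)\<^sup>2"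
          using arch_bound[OF elim, of t] th1 by (simp add: field_simps)
        then have "((X t \<omega>)\<^sup>2) powr s \<le> (1 / \<theta> 1 * (\<sigma> (t + 1) \<omega>)\<^sup>2) powr s"
          using s by (intro powr_mono2) auto
        also have "\<dots> = a * ((\<sigma> (t + 1) \<omega>)\<^sup>2) powr s" using th1 unfolding a_def by (intro powr_mult)
        finally show ?case by (simp add: ennreal_mult'[symmetric] a_def ennreal_leI)
      qed
    qed
    also have "\<dots> = ennreal a * (\<integral>\<^sup>+\<omega>. ennreal (((\<sigma> (t + 1) \<omega>)\<^sup>2) powr s) \<partial>M)"
      by (rule nn_integral_cmult) measurable
    also have "\<dots> \<le> ennreal a * ennreal \<bar>R\<bar>"
      by (intro mult_left_mono order_trans[OF R]) (auto intro: ennreal_leI)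
    finally show ?thesis by (simp add: ennreal_mult' a_def)
  qed
  then have "\<forall>t. (\<integral>\<^sup>+\<omega>. ennreal (((\<sigma> t \<omega>)\<^sup>2) powr s) \<partial>M) \<le> ennreal (max R (a * \<bar>R\<bar>)) \<and>
    (\<integral>\<^sup>+\<omega>. ennreal (((X t \<omega>)\<^sup>2) powr s) \<partial>M) \<le> ennreal (max R (a * \<bar>R\<bar>))"
    using R by (meson ennreal_leI max.cobounded1 max.cobounded2 order_trans)
  then show ?thesis using s by blast
qed

end

section \<open>The conditional variance as a weighted sum of past squares\<close>

lemma ennreal_le_suminf: "f i \<le> suminf f" for f :: "nat \<Rightarrow> ennreal"
  using sum_le_suminf[of f "{i}"] by simp

text \<open>Uniformly bounded fractional moments exclude exponential growth: the series
  \<open>\<Sum>i. b\<^bsup>-si\<^esup> W\<^sub>i\<^sup>s\<close> has a finite expectation.\<close>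

lemma (in prob_space) AE_geometric_growth:
  fixes W :: "nat \<Rightarrow> 'a \<Rightarrow> real"
  assumes [measurable]: "\<And>i. W i \<in> borel_measurable M" and nn: "\<And>i \<omega>. 0 \<le> W i \<omega>"
    and s: "0 < s" and b: "1 < b"
    and R: "\<And>i. (\<integral>\<^sup>+\<omega>. ennreal (W i \<omega> powr s) \<partial>M) \<le> ennreal R"
  shows "AE \<omega> in M. \<exists>B\<ge>0. \<forall>i. W i \<omega> \<le> B * b ^ i"
proof -
  define a where "a = b powr (- s)"
  have a: "0 < a" "a < 1" using b s powr_less_mono[of "- s" 0 b] by (auto simp: a_def)
  let ?f = "\<lambda>i \<omega>. ennreal (a ^ i) * ennreal (W i \<omega> powr s)"
  have "(\<integral>\<^sup>+\<omega>. (\<Sum>i. ?f i \<omega>) \<partial>M) = (\<Sum>i. \<integral>\<^sup>+\<omega>. ?f i \<omega> \<partial>M)" by (rule nn_integral_suminf) measurable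
  also have "\<dots> = (\<Sum>i. ennreal (a ^ i) * (\<integral>\<^sup>+\<omega>. ennreal (W i \<omega> powr s) \<partial>M))"
    by (intro suminf_cong nn_integral_cmult) measurable
  also have "\<dots> \<le> (\<Sum>i. ennreal (a ^ i) * ennreal \<bar>R\<bar>)"
    by (intro suminf_le mult_left_mono order_trans[OF R] ennreal_leI) auto
  also have "\<dots> = (\<Sum>i. ennreal (a ^ i * \<bar>R\<bar>))"
    using a by (intro suminf_cong ennreal_mult'[symmetric]) simp
  also have "\<dots> = ennreal (\<Sum>i. a ^ i * \<bar>R\<bar>)"
    using a by (intro suminf_ennreal2 summable_mult2 summable_geometric) auto
  also have "\<dots> < \<infinity>" by simp
  finally have "(\<integral>\<^sup>+\<omega>. (\<Sum>i. ?f i \<omega>) \<partial>M) \<noteq> \<infinity>" by simp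
  then have "AE \<omega> in M. (\<Sum>i. ?f i \<omega>) \<noteq> \<infinity>" by (intro nn_integral_noteq_infinite) measurable
  then show ?thesis
  proof eventually_elim
    case (elim \<omega>)
    then obtain S where S: "0 \<le> S" "(\<Sum>i. ?f i \<omega>) = ennreal S"
      by (cases "\<Sum>i. ?f i \<omega>") auto
    have "W i \<omega> \<le> S powr (1 / s) * b ^ i" for i
    proof -
      have "?f i \<omega> \<le> (\<Sum>i. ?f i \<omega>)" by (rule ennreal_le_suminf)
      then have "ennreal (a ^ i * W i \<omega> powr s) \<le> ennreal S" using a S by (simp add: ennreal_mult')
      then have le: "a ^ i * W i \<omega> powr s \<le> S" using S(1) by simp
      have "a ^ i = (b ^ i) powr (- s)"
        using b by (simp add: a_def powr_powr powr_realpow[symmetric] mult.commute)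
      then have one: "a ^ i * (b ^ i) powr s = 1" using b by (simp add: powr_minus)
      have "W i \<omega> powr s = W i \<omega> powr s * (a ^ i * (b ^ i) powr s)" unfolding one by simp
      also have "\<dots> = (a ^ i * W i \<omega> powr s) * (b ^ i) powr s" by (simp only: mult_ac)
      also have "\<dots> \<le> S * (b ^ i) powr s" by (intro mult_right_mono le) simp
      finally have "W i \<omega> powr s \<le> S * (b ^ i) powr s" .
      then have "(W i \<omega> powr s) powr (1 / s) \<le> (S * (b ^ i) powr s) powr (1 / s)"
        using s by (intro powr_mono2) auto
      then show ?thesis using nn[of i \<omega>] s b S(1) by (simp add: powr_powr powr_mult)
    qed
    then show ?case by (intro exI[of _ "S powr (1 / s)"]) simp
  qed
qed

context garch_parameter begin

text \<open>The weighted sum of past squares as seen from time \<open>t - j\<close>, reindexed by the lag counted from \<open>t\<close>.\<close>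

lemma c_lag_shift:
  assumes sm: "summable (\<lambda>i. c i * (if i = 0 then 1 else x (t - int j - int i)))"
  shows "(\<lambda>i. if j < i then c (i - j) * x (t - int i) else 0) sums
    ((\<Sum>i. c i * (if i = 0 then 1 else x (t - int j - int i))) - c 0)"
proof -
  let ?f = "\<lambda>i. c i * (if i = 0 then 1 else x (t - int j - int i))"
  have "(\<lambda>i. if i = 0 then c 0 else 0) sums c 0" using sums_single[of 0 "\<lambda>_. c 0"] by simp
  from sums_diff[OF summable_sums[OF sm] this]
  have "(\<lambda>i. ?f i - (if i = 0 then c 0 else 0)) sums (suminf ?f - c 0)" .
  also have "(\<lambda>i. ?f i - (if i = 0 then c 0 else 0)) = (\<lambda>i. if 0 < i then c i * x (t - int j - int i) else 0)"
    by auto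
  also have "\<dots> = (\<lambda>i. if j < i + j then c (i + j - j) * x (t - int (i + j)) else 0)"
    by (auto simp: algebra_simps)
  finally have "(\<lambda>i. (\<lambda>i. if j < i then c (i - j) * x (t - int i) else 0) (i + j)) sums (suminf ?f - c 0)" .
  then show ?thesis by (subst (asm) sums_zero_iff_shift) auto
qed

text \<open>The weighted sum \<open>w\<close> of past squares satisfies the same recursion as \<open>v\<close>, by the recursion of the weights. The
  difference \<open>D = v - w\<close> satisfies the homogeneous recursion with coefficients of sum at most \<open>\<rho> < 1\<close>;
  going back \<open>m\<close> steps gains a factor \<open>\<rho>\<^sup>m\<close> and reaches at most \<open>q * m\<close> time units into the past, where
  \<open>D\<close> is of size at most \<open>b\<^bsup>qm\<^esup>\<close>. As \<open>b\<^sup>q \<rho> < 1\<close>, this forces \<open>D = 0\<close>.\<close>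

lemma arch_infinity_representation:
  fixes x v :: "int \<Rightarrow> real"
  assumes nn: "\<And>t. 0 \<le> x t"
    and rec: "\<And>t. v t = \<theta> 0 + (\<Sum>i=1..p. \<theta> i * x (t - int i)) + (\<Sum>j=1..q. \<theta> (p + j) * v (t - int j))"
    and decay: "\<And>i. c i \<le> Cr * r ^ i" and r: "0 < r" "b * r < 1"
    and b: "1 < b" "b ^ q * \<rho> < 1"
    and growth: "\<And>t. \<exists>B\<ge>0. \<forall>i. x (t - int i) \<le> B * b ^ i \<and> \<bar>v (t - int i)\<bar> \<le> B * b ^ i"
  shows "(\<lambda>i. c i * (if i = 0 then 1 else x (t - int i))) sums v t"
proof -
  let ?f = "\<lambda>t i. c i * (if i = 0 then 1 else x (t - int i))"
  define w where "w t = suminf (?f t)" for t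
  have Cr: "0 \<le> Cr" using decay[of 0] c0_pos by simp
  have br: "0 < b * r" using b r by simp
  have fn: "0 \<le> ?f t i" for t i using c_nonneg nn by simp
  \<comment> \<open>A geometric majorant for the weights seen from time \<open>t - k\<close>.\<close>
  have maj: "?f (t - int k) i \<le> (Cr * (1 + B) * b ^ k) * (b * r) ^ i"
    if B: "0 \<le> B" "\<And>i. x (t - int i) \<le> B * b ^ i" for t k i B
  proof (cases "i = 0")
    case True
    have "c 0 \<le> Cr * 1" using decay[of 0] by simp
    also have "\<dots> \<le> Cr * ((1 + B) * b ^ k)"
      using Cr B b mult_mono[of 1 "1 + B" 1 "b ^ k"] by (intro mult_left_mono) (auto simp: one_le_power)
    finally show ?thesis using True by (simp add: mult.assoc)
  next
    case False
    have "?f (t - int k) i \<le> (Cr * r ^ i) * (B * b ^ (k + i))"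
      using False decay[of i] B(2)[of "k + i"] c_nonneg[of i] nn Cr r
      by (simp, intro mult_mono) (auto simp: algebra_simps)
    also have "\<dots> = Cr * B * b ^ k * (b * r) ^ i" by (simp add: power_add power_mult_distrib)
    also have "\<dots> \<le> (Cr * (1 + B) * b ^ k) * (b * r) ^ i"
      using Cr B b br by (intro mult_right_mono mult_left_mono) auto
    finally show ?thesis .
  qed
  have geo: "summable (\<lambda>i. K * (b * r) ^ i)" for K
    using r br by (intro summable_mult summable_geometric) auto
  have sm: "summable (?f t)" for t
  proof -
    obtain B where "0 \<le> B" "\<And>i. x (t - int i) \<le> B * b ^ i" using growth by metis
    note B = this
    show ?thesis
    proof (rule summable_comparison_test'[OF geo[of "Cr * (1 + B)"], of 0])
      fix i
      show "norm (?f t i) \<le> Cr * (1 + B) * (b * r) ^ i"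
        unfolding real_norm_def abs_of_nonneg[OF fn] using maj[OF B, of i 0]
        by (simp only: of_nat_0 diff_0_right power_0 mult_1_right)
    qed
  qed
  have w_growth: "\<exists>B\<ge>0. \<forall>k. \<bar>w (t - int k)\<bar> \<le> B * b ^ k" for t
  proof -
    obtain B where B: "0 \<le> B" "\<And>i. x (t - int i) \<le> B * b ^ i" using growth by metis
    have "\<bar>w (t - int k)\<bar> \<le> (Cr * (1 + B) * (\<Sum>i. (b * r) ^ i)) * b ^ k" for k
    proof -
      have "w (t - int k) \<le> (\<Sum>i. (Cr * (1 + B) * b ^ k) * (b * r) ^ i)"
        unfolding w_def by (intro suminf_le maj B sm geo)
      also have "\<dots> = (Cr * (1 + B) * b ^ k) * (\<Sum>i. (b * r) ^ i)"
        using r br by (intro suminf_mult summable_geometric) auto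
      finally have "w (t - int k) \<le> (Cr * (1 + B) * (\<Sum>i. (b * r) ^ i)) * b ^ k" by (simp add: mult_ac)
      moreover have "0 \<le> w (t - int k)" unfolding w_def by (intro suminf_nonneg sm fn)
      ultimately show ?thesis by simp
    qed
    moreover have "0 \<le> Cr * (1 + B) * (\<Sum>i. (b * r) ^ i)"
      using Cr B r br by (intro mult_nonneg_nonneg suminf_nonneg summable_geometric) auto
    ultimately show ?thesis by blast
  qed
  have w_rec: "w t = \<theta> 0 + (\<Sum>i=1..p. \<theta> i * x (t - int i)) + (\<Sum>j=1..q. \<theta> (p + j) * w (t - int j))" for t
  proof -
    have f_split: "?f t i = (if i = 0 then c 0 else 0) + (if i \<in> {1..p} then \<theta> i * x (t - int i) else 0) +
        (\<Sum>j=1..q. \<theta> (p + j) * (if j < i then c (i - j) * x (t - int i) else 0))" for i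
    proof (cases "i = 0")
      case False
      have "(\<Sum>j=1..min (i - 1) q. \<theta> (p + j) * c (i - j)) * x (t - int i) =
          (\<Sum>j\<in>{1..min (i - 1) q}. \<theta> (p + j) * (c (i - j) * x (t - int i)))"
        by (simp add: sum_distrib_right mult.assoc)
      also have "\<dots> = (\<Sum>j\<in>{1..min (i - 1) q}. \<theta> (p + j) * (if j < i then c (i - j) * x (t - int i) else 0))"
        using False by (intro sum.cong refl) auto
      also have "\<dots> = (\<Sum>j=1..q. \<theta> (p + j) * (if j < i then c (i - j) * x (t - int i) else 0))"
        by (intro sum.mono_neutral_left) auto
      finally have e: "(\<Sum>j=1..min (i - 1) q. \<theta> (p + j) * c (i - j)) * x (t - int i) =
        (\<Sum>j=1..q. \<theta> (p + j) * (if j < i then c (i - j) * x (t - int i) else 0))" .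
      have "?f t i = (if i \<le> p then \<theta> i else 0) * x (t - int i) +
          (\<Sum>j=1..min (i - 1) q. \<theta> (p + j) * c (i - j)) * x (t - int i)"
        using False garch_c_pos[of i p q \<theta>] by (simp add: distrib_right)
      then show ?thesis unfolding e using False by auto
    qed auto
    have "(\<lambda>i. if i = 0 then c 0 else 0) sums c 0" using sums_single[of 0 "\<lambda>_. c 0"] by simp
    moreover have "(\<lambda>i. if i \<in> {1..p} then \<theta> i * x (t - int i) else 0) sums (\<Sum>i=1..p. \<theta> i * x (t - int i))"
      by (rule sums_If_finite_set) simp
    moreover have "(\<lambda>i. \<Sum>j=1..q. \<theta> (p + j) * (if j < i then c (i - j) * x (t - int i) else 0)) sums
        (\<Sum>j=1..q. \<theta> (p + j) * (w (t - int j) - c 0))"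
      unfolding w_def by (intro sums_sum sums_mult c_lag_shift sm)
    ultimately have "?f t sums (c 0 + (\<Sum>i=1..p. \<theta> i * x (t - int i)) + (\<Sum>j=1..q. \<theta> (p + j) * (w (t - int j) - c 0)))"
      unfolding f_split by (intro sums_add)
    then have "w t = c 0 + (\<Sum>i=1..p. \<theta> i * x (t - int i)) + (\<Sum>j=1..q. \<theta> (p + j) * (w (t - int j) - c 0))"
      unfolding w_def by (simp add: sums_iff)
    also have "(\<Sum>j=1..q. \<theta> (p + j) * (w (t - int j) - c 0)) =
        (\<Sum>j=1..q. \<theta> (p + j) * w (t - int j)) - (\<Sum>j=1..q. \<theta> (p + j)) * c 0"
      by (simp add: right_diff_distrib sum_subtractf sum_distrib_right)
    also have "(\<Sum>j=1..q. \<theta> (p + j)) * c 0 = c 0 - \<theta> 0"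
      using beta_sum rho by (simp add: garch_c_0 field_simps)
    finally show ?thesis by simp
  qed
  define D where "D t = v t - w t" for t
  have D_rec: "D t = (\<Sum>j=1..q. \<theta> (p + j) * D (t - int j))" for t
    unfolding D_def by (subst rec, subst w_rec) (simp add: right_diff_distrib sum_subtractf)
  have D0: "D t = 0" for t
  proof -
    obtain B1 where B1: "0 \<le> B1" "\<And>i. \<bar>v (t - int i)\<bar> \<le> B1 * b ^ i" using growth by metis
    obtain B2 where B2: "0 \<le> B2" "\<And>i. \<bar>w (t - int i)\<bar> \<le> B2 * b ^ i" using w_growth by metis
    define B where "B = B1 + B2"
    have "\<bar>D (t - int i)\<bar> \<le> \<rho> ^ m * (B * b ^ (i + q * m))" for m i
    proof (induction m arbitrary: i)
      case 0
      show ?case using B1(2)[of i] B2(2)[of i] by (simp add: D_def B_def algebra_simps)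
    next
      case (Suc m)
      have nn: "0 \<le> \<rho> ^ m * B * b ^ k" for k
        using rho B1(1) B2(1) b by (auto simp: B_def intro!: mult_nonneg_nonneg)
      have "\<bar>D (t - int i)\<bar> \<le> (\<Sum>j=1..q. \<theta> (p + j) * \<bar>D (t - int (i + j))\<bar>)"
        unfolding D_rec[of "t - int i"]
        by (intro order_trans[OF sum_abs] sum_mono) (simp add: abs_mult abs_of_pos[OF beta_pos] diff_diff_eq)
      also have "\<dots> \<le> (\<Sum>j=1..q. \<theta> (p + j) * (\<rho> ^ m * (B * b ^ (i + q * Suc m))))"
      proof (intro sum_mono mult_left_mono)
        fix j assume j: "j \<in> {1..q}"
        have "\<bar>D (t - int (i + j))\<bar> \<le> \<rho> ^ m * (B * b ^ (i + j + q * m))" by (rule Suc)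
        also have "\<dots> \<le> \<rho> ^ m * (B * b ^ (i + q * Suc m))"
          using j b rho B1(1) B2(1) by (intro mult_left_mono power_increasing) (auto simp: B_def)
        finally show "\<bar>D (t - int (i + j))\<bar> \<le> \<rho> ^ m * (B * b ^ (i + q * Suc m))" .
      qed (auto intro: less_imp_le[OF beta_pos])
      also have "\<dots> = (\<Sum>j=1..q. \<theta> (p + j)) * (\<rho> ^ m * (B * b ^ (i + q * Suc m)))"
        by (rule sum_distrib_right[symmetric])
      also have "\<dots> \<le> \<rho> * (\<rho> ^ m * (B * b ^ (i + q * Suc m)))"
        using beta_sum nn[of "i + q * Suc m"] by (intro mult_right_mono) (auto simp: mult.assoc)
      finally show ?case by (simp add: mult.assoc)
    qed
    note bound = this
    have le: "\<bar>D t\<bar> \<le> B * (b ^ q * \<rho>) ^ m" for m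
    proof -
      have "\<bar>D t\<bar> \<le> \<rho> ^ m * (B * b ^ (q * m))" using bound[of 0 m] by simp
      also have "\<dots> = B * (b ^ q * \<rho>) ^ m" unfolding power_mult power_mult_distrib by (simp only: mult_ac)
      finally show ?thesis .
    qed
    have "(\<lambda>m. B * (b ^ q * \<rho>) ^ m) \<longlonglongrightarrow> 0"
      using b rho by (intro tendsto_mult_right_zero LIMSEQ_realpow_zero) auto
    then have "\<bar>D t\<bar> \<le> 0" by (rule LIMSEQ_le_const) (use le in blast)
    then show ?thesis by simp
  qed
  have "v t = w t" using D0[of t] by (simp add: D_def)
  then show ?thesis using summable_sums[OF sm[of t]] by (simp add: w_def)
qed

end

section \<open>The relative score and its moments\<close>

text \<open>The constants are fixed once and for all: \<open>s\<close> is the exponent of a finite moment, \<open>r\<close> the rate of decay of the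
  weights, and \<open>b > 1\<close> the rate of growth that is conceded to the squared observations and to the relative errors
  of the weights. It is so close to 1 that all products occurring below still decay geometrically.\<close>

locale garch_estimates = garch_process M \<epsilon> p q \<theta> \<rho> X \<sigma>
  for M :: "'a measure" and \<epsilon> :: "int \<Rightarrow> 'a \<Rightarrow> real" and p q :: nat and \<theta> :: "nat \<Rightarrow> real" and \<rho> :: real
    and X \<sigma> :: "int \<Rightarrow> 'a \<Rightarrow> real" +
  fixes s R Cr r b C \<eta>0 :: real
  assumes s: "0 < s" "s \<le> 1"
    and sigma_moment: "\<And>t. (\<integral>\<^sup>+\<omega>. ennreal (((\<sigma> t \<omega>)\<^sup>2) powr s) \<partial>M) \<le> ennreal R"
    and X_moment: "\<And>t. (\<integral>\<^sup>+\<omega>. ennreal (((X t \<omega>)\<^sup>2) powr s) \<partial>M) \<le> ennreal R"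
    and decay: "\<And>i. c i \<le> Cr * r ^ i" and r: "0 < r" "r < 1"
    and b: "1 < b" "b ^ q * \<rho> < 1" "b * r powr (s / 4) < 1"
    and C: "1 \<le> C" and \<eta>0: "0 < \<eta>0" "\<eta>0 \<le> 1"
    and expansion: "\<And>\<eta> u i. 0 \<le> \<eta> \<Longrightarrow> \<eta> \<le> \<eta>0 \<Longrightarrow> (\<forall>l\<le>p + q. \<bar>u l - \<theta> l\<bar> \<le> \<eta> * \<theta> l) \<Longrightarrow>
      \<bar>garch_c p q u i - c i\<bar> \<le> \<eta> * (C * b ^ i * c i) \<and>
      \<bar>garch_c p q u i - c i - (\<Sum>l\<le>p + q. (u l - \<theta> l) * dc l i)\<bar> \<le> \<eta>\<^sup>2 * (C * b ^ i * c i)"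
    and dc_bound: "\<And>l i. l \<le> p + q \<Longrightarrow> \<theta> l * dc l i \<le> C * b ^ i * c i"
begin

lemma b2r: "b * b * r < 1"
proof -
  have "r powr (s / 4) * r powr (s / 4) = r powr (s / 2)" by (simp add: powr_add[symmetric])
  moreover have "r powr 1 \<le> r powr (s / 2)" using r s by (intro powr_mono') auto
  ultimately have "b * b * r \<le> (b * r powr (s / 4)) * (b * r powr (s / 4))"
    using r b by (simp add: mult_ac mult_left_mono)
  also have "\<dots> < 1 * 1" using b by (intro mult_strict_mono) auto
  finally show ?thesis by simp
qed

lemma br: "b * r < 1"
proof -
  have "1 * (b * r) \<le> b * (b * r)" using b r by (intro mult_right_mono) auto
  then show ?thesis using b2r by (simp add: mult.assoc)
qed

lemma Cr_pos: "0 < Cr" using decay[of 0] c0_pos by simp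

text \<open>The terms multiplied by the weights in the representation of the variance at time \<open>t\<close> (1 for the constant
  term, squared observations otherwise), as functions of the noise up to time \<open>t - 1\<close>.\<close>

definition lag :: "nat \<Rightarrow> (nat \<Rightarrow> real) \<Rightarrow> real" where
  "lag i e = (if i = 0 then 1 else (vol (tail_from i e) * e (i - 1))\<^sup>2)"

text \<open>A common majorant, at a given time, for the relative errors of the fitted variance and for its relative
  derivatives.\<close>

definition score_bound :: "(nat \<Rightarrow> real) \<Rightarrow> real" where
  "score_bound e = (\<Sum>i. C * b ^ i * c i * lag i e) / (vol e)\<^sup>2"

text \<open>The derivative of the logarithm of the conditional variance in the coordinate \<open>l\<close> of the parameter.\<close>

definition score :: "nat \<Rightarrow> (nat \<Rightarrow> real) \<Rightarrow> real" where
  "score l e = (\<Sum>i. dc l i * lag i e) / (vol e)\<^sup>2"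

lemma lag_nonneg: "0 \<le> lag i e" by (simp add: lag_def)

lemma measurable_coord: "(\<lambda>e. e i) \<in> borel_measurable seq_borel"
  by (rule measurable_component_singleton) simp

lemma measurable_lag [measurable]: "lag i \<in> borel_measurable seq_borel"
proof -
  note [measurable] = measurable_coord[of "i - 1"]
  show ?thesis unfolding lag_def by measurable
qed

lemma measurable_score_bound [measurable]: "score_bound \<in> borel_measurable seq_borel"
  unfolding score_bound_def by measurable

lemma measurable_score [measurable]: "score l \<in> borel_measurable seq_borel"
  unfolding score_def by measurable

text \<open>The paths on which all deterministic estimates hold; almost every path is one of them.\<close>

definition typical :: "'a \<Rightarrow> bool" where
  "typical \<omega> \<longleftrightarrow>
    solves \<omega> \<and>
    (\<forall>t. \<sigma> t \<omega> = vol (past \<epsilon> (t - 1) \<omega>)) \<and>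
    (\<forall>t. \<exists>B\<ge>0. \<forall>i. (X (t - int i) \<omega>)\<^sup>2 \<le> B * b ^ i \<and> \<bar>(\<sigma> (t - int i) \<omega>)\<^sup>2\<bar> \<le> B * b ^ i)"

lemma AE_typical: "AE \<omega> in M. typical \<omega>"
proof -
  have "AE \<omega> in M. \<forall>t. (\<exists>B\<ge>0. \<forall>i. (X (t - int i) \<omega>)\<^sup>2 \<le> B * b ^ i) \<and> (\<exists>B\<ge>0. \<forall>i. (\<sigma> (t - int i) \<omega>)\<^sup>2 \<le> B * b ^ i)"
  proof (subst AE_all_countable, intro allI AE_conjI)
    fix t
    show "AE \<omega> in M. \<exists>B\<ge>0. \<forall>i. (X (t - int i) \<omega>)\<^sup>2 \<le> B * b ^ i"
      by (rule AE_geometric_growth[where s = s and R = R]) (use s b X_moment in auto)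
    show "AE \<omega> in M. \<exists>B\<ge>0. \<forall>i. (\<sigma> (t - int i) \<omega>)\<^sup>2 \<le> B * b ^ i"
      by (rule AE_geometric_growth[where s = s and R = R]) (use s b sigma_moment in auto)
  qed
  with AE_solves sigma_vol show ?thesis
  proof eventually_elim
    case (elim \<omega>)
    have "\<exists>B\<ge>0. \<forall>i. (X (t - int i) \<omega>)\<^sup>2 \<le> B * b ^ i \<and> \<bar>(\<sigma> (t - int i) \<omega>)\<^sup>2\<bar> \<le> B * b ^ i" for t
    proof -
      obtain B1 B2 where B: "0 \<le> B1" "\<And>i. (X (t - int i) \<omega>)\<^sup>2 \<le> B1 * b ^ i"
        "0 \<le> B2" "\<And>i. (\<sigma> (t - int i) \<omega>)\<^sup>2 \<le> B2 * b ^ i" using elim(3) by metis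
      have "(X (t - int i) \<omega>)\<^sup>2 \<le> max B1 B2 * b ^ i \<and> \<bar>(\<sigma> (t - int i) \<omega>)\<^sup>2\<bar> \<le> max B1 B2 * b ^ i" for i
      proof -
        have "B1 * b ^ i \<le> max B1 B2 * b ^ i" "B2 * b ^ i \<le> max B1 B2 * b ^ i"
          using b by (auto intro!: mult_right_mono)
        then show ?thesis using B(2)[of i] B(4)[of i] by (auto intro: order_trans)
      qed
      then show ?thesis using B(1) by (intro exI[of _ "max B1 B2"]) auto
    qed
    then show ?case unfolding typical_def using elim(1,2) by blast
  qed
qed

context
  fixes \<omega> assumes typical: "typical \<omega>"
begin

lemma typical_sigma_vol: "\<sigma> t \<omega> = vol (past \<epsilon> (t - 1) \<omega>)"
  using typical unfolding typical_def solves_def by blast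

lemma typical_X: "X t \<omega> = \<sigma> t \<omega> * \<epsilon> t \<omega>"
  using typical unfolding typical_def solves_def by blast

lemma typical_lag: "lag i (past \<epsilon> (t - 1) \<omega>) = (if i = 0 then 1 else (X (t - int i) \<omega>)\<^sup>2)"
proof (cases "i = 0")
  case False
  have "vol (tail_from i (past \<epsilon> (t - 1) \<omega>)) = \<sigma> (t - int i) \<omega>"
    unfolding tail_from_past typical_sigma_vol by (simp add: algebra_simps)
  moreover have "past \<epsilon> (t - 1) \<omega> (i - 1) = \<epsilon> (t - int i) \<omega>"
    using False by (simp add: past_def of_nat_diff)
  ultimately show ?thesis using False by (simp add: lag_def typical_X)
qed (simp add: lag_def)

lemma typical_growth: "\<exists>B\<ge>0. \<forall>i. (X (t - int i) \<omega>)\<^sup>2 \<le> B * b ^ i"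
  using typical unfolding typical_def solves_def by blast

lemma representation: "(\<lambda>i. c i * lag i (past \<epsilon> (t - 1) \<omega>)) sums (\<sigma> t \<omega>)\<^sup>2"
  unfolding typical_lag
proof (rule arch_infinity_representation[OF _ _ decay r(1) br b(1,2)])
  show "0 \<le> (X t \<omega>)\<^sup>2" for t by simp
qed (use typical in \<open>unfold typical_def solves_def, blast+\<close>)

lemma weighted_summable: "summable (\<lambda>i. b ^ i * c i * lag i (past \<epsilon> (t - 1) \<omega>))"
proof -
  obtain B where B: "0 \<le> B" "\<And>i. (X (t - int i) \<omega>)\<^sup>2 \<le> B * b ^ i" using typical_growth by metis
  have maj: "norm (b ^ i * c i * lag i (past \<epsilon> (t - 1) \<omega>)) \<le> (Cr * (1 + B)) * (b * b * r) ^ i" for i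
  proof -
    have "lag i (past \<epsilon> (t - 1) \<omega>) \<le> (1 + B) * b ^ i"
    proof -
      have "1 \<le> b ^ i" using b by (intro one_le_power) simp
      moreover from this have "0 \<le> B * b ^ i" using B(1) by (intro mult_nonneg_nonneg) auto
      ultimately show ?thesis using B(2)[of i] unfolding typical_lag distrib_right by auto
    qed
    then have "b ^ i * c i * lag i (past \<epsilon> (t - 1) \<omega>) \<le> b ^ i * (Cr * r ^ i) * ((1 + B) * b ^ i)"
      using b decay[of i] c_nonneg[of i] lag_nonneg Cr_pos r by (intro mult_mono) auto
    then show ?thesis using b c_nonneg[of i] lag_nonneg
      by (simp add: abs_of_nonneg power_mult_distrib mult_ac)
  qed
  have "summable (\<lambda>i. (Cr * (1 + B)) * (b * b * r) ^ i)"
    by (intro summable_mult summable_geometric) (use b r b2r in simp)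
  then show ?thesis by (rule summable_comparison_test'[where N = 0]) (rule maj)
qed

lemma sigma2_ge: "c 0 \<le> (\<sigma> t \<omega>)\<^sup>2" "c i * lag i (past \<epsilon> (t - 1) \<omega>) \<le> (\<sigma> t \<omega>)\<^sup>2"
proof -
  show *: "c i * lag i (past \<epsilon> (t - 1) \<omega>) \<le> (\<sigma> t \<omega>)\<^sup>2" for i
    using sum_le_suminf[of "\<lambda>i. c i * lag i (past \<epsilon> (t - 1) \<omega>)" "{i}"] representation[of t] c_nonneg lag_nonneg
    by (auto simp: sums_iff)
  show "c 0 \<le> (\<sigma> t \<omega>)\<^sup>2" using *[of 0] by (simp add: lag_def)
qed

lemma sigma2_pos: "0 < (\<sigma> t \<omega>)\<^sup>2" using sigma2_ge(1)[of t] c0_pos by linarith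

lemma score_bound_sums:
  "(\<lambda>i. C * b ^ i * (c i * lag i (past \<epsilon> (t - 1) \<omega>) / (\<sigma> t \<omega>)\<^sup>2)) sums score_bound (past \<epsilon> (t - 1) \<omega>)"
proof -
  from sums_divide[OF sums_mult[OF summable_sums[OF weighted_summable], of C], of t "(\<sigma> t \<omega>)\<^sup>2"]
  show ?thesis unfolding score_bound_def typical_sigma_vol[symmetric]
    using suminf_mult[OF weighted_summable, of C t] by (simp add: mult_ac)
qed

lemma score_bound_ge_1: "1 \<le> score_bound (past \<epsilon> (t - 1) \<omega>)"
proof (rule sums_le[OF _ _ score_bound_sums])
  show "(\<lambda>i. c i * lag i (past \<epsilon> (t - 1) \<omega>) / (\<sigma> t \<omega>)\<^sup>2) sums 1"
    using sums_divide[OF representation[of t], of "(\<sigma> t \<omega>)\<^sup>2"] sigma2_pos[of t] by simp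
  fix i
  have "1 \<le> C * b ^ i" using C b mult_mono[of 1 C 1 "b ^ i"] by (simp add: one_le_power)
  moreover have "0 \<le> c i * lag i (past \<epsilon> (t - 1) \<omega>) / (\<sigma> t \<omega>)\<^sup>2" using c_nonneg lag_nonneg by simp
  ultimately show "c i * lag i (past \<epsilon> (t - 1) \<omega>) / (\<sigma> t \<omega>)\<^sup>2 \<le> C * b ^ i * (c i * lag i (past \<epsilon> (t - 1) \<omega>) / (\<sigma> t \<omega>)\<^sup>2)"
    using mult_right_mono[of 1 "C * b ^ i"] by fastforce
qed

lemma score_sums:
  assumes l: "l \<le> p + q"
  shows "(\<lambda>i. dc l i * (lag i (past \<epsilon> (t - 1) \<omega>) / (\<sigma> t \<omega>)\<^sup>2)) sums score l (past \<epsilon> (t - 1) \<omega>)"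
proof -
  let ?x = "\<lambda>i. lag i (past \<epsilon> (t - 1) \<omega>)"
  have "summable (\<lambda>i. dc l i * ?x i)"
  proof (rule summable_comparison_test'[of "\<lambda>i. C / \<theta> l * (b ^ i * c i * ?x i)" 0])
    fix i
    have "dc l i \<le> C / \<theta> l * (b ^ i * c i)"
      using dc_bound[OF l, of i] pos[OF l] by (simp add: field_simps)
    then have "dc l i * ?x i \<le> C / \<theta> l * (b ^ i * c i) * ?x i" by (rule mult_right_mono[OF _ lag_nonneg])
    then show "norm (dc l i * ?x i) \<le> C / \<theta> l * (b ^ i * c i * ?x i)"
      using dc_nonneg[OF l, of i] lag_nonneg[of i] by (simp add: abs_mult mult_ac)
  qed (intro summable_mult weighted_summable)
  from sums_divide[OF summable_sums[OF this], of "(\<sigma> t \<omega>)\<^sup>2"]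
  show ?thesis unfolding score_def typical_sigma_vol[symmetric] by simp
qed

lemma score_nonneg: "l \<le> p + q \<Longrightarrow> 0 \<le> score l (past \<epsilon> (t - 1) \<omega>)"
  by (rule sums_le[OF _ sums_zero score_sums]) (use dc_nonneg lag_nonneg in auto)

lemma score_le:
  assumes l: "l \<le> p + q"
  shows "\<theta> l * score l (past \<epsilon> (t - 1) \<omega>) \<le> score_bound (past \<epsilon> (t - 1) \<omega>)"
proof (rule sums_le[OF _ sums_mult[OF score_sums[OF l]] score_bound_sums])
  fix i
  have "0 \<le> lag i (past \<epsilon> (t - 1) \<omega>) / (\<sigma> t \<omega>)\<^sup>2" using lag_nonneg by simp
  from mult_right_mono[OF dc_bound[OF l, of i] this]
  show "\<theta> l * (dc l i * (lag i (past \<epsilon> (t - 1) \<omega>) / (\<sigma> t \<omega>)\<^sup>2)) \<le> C * b ^ i * (c i * lag i (past \<epsilon> (t - 1) \<omega>) / (\<sigma> t \<omega>)\<^sup>2)"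
    by (simp add: mult_ac)
qed

end

lemma lag_moment: "(\<integral>\<^sup>+e. ennreal (lag i e powr s) \<partial>past_law) \<le> ennreal (max 1 R)"
proof (cases "i = 0")
  case True
  have "(\<integral>\<^sup>+e. ennreal (lag i e powr s) \<partial>past_law) = 1"
    using True past.emeasure_space_1 by (simp add: lag_def)
  then show ?thesis using ennreal_leI[of 1 "max 1 R"] by simp
next
  case False
  have "(\<integral>\<^sup>+e. ennreal (lag i e powr s) \<partial>past_law) = (\<integral>\<^sup>+\<omega>. ennreal (lag i (past \<epsilon> (0 - 1) \<omega>) powr s) \<partial>M)"
    by (rule nn_integral_past[symmetric]) measurable
  also have "\<dots> = (\<integral>\<^sup>+\<omega>. ennreal ((X (0 - int i) \<omega>)\<^sup>2 powr s) \<partial>M)"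
    by (rule nn_integral_cong_AE, rule eventually_mono[OF AE_typical]) (use False in \<open>simp only: typical_lag if_False\<close>)
  also have "\<dots> \<le> ennreal R" by (rule X_moment)
  also have "\<dots> \<le> ennreal (max 1 R)" by (rule ennreal_leI) simp
  finally show ?thesis .
qed

text \<open>Each ratio \<open>c i * lag i e / (vol e)\<^sup>2\<close> lies between 0 and 1, hence is at most its \<open>s/4\<close>-th power, in
  which the denominator may be replaced by \<open>c 0\<close>. So the fourth power of the score bound is controlled by the
  \<open>s\<close>-th moment of the lagged squares, however small \<open>s\<close> is, provided that \<open>b * r powr (s / 4) < 1\<close>.\<close>

lemma score_bound_moment: "(\<integral>\<^sup>+e. ennreal (score_bound e ^ 4) \<partial>past_law) < \<infinity>"
proof -
  define \<delta> where "\<delta> = s / 4"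
  \<comment> \<open>Half of the geometric decay makes the series summable, the other half remains as weight of the moments.\<close>
  define \<mu> where "\<mu> = sqrt (b * r powr \<delta>)"
  have \<delta>: "0 < \<delta>" "\<delta> \<le> 1" using s by (auto simp: \<delta>_def)
  have pos': "0 < b * r powr \<delta>" using b r by simp
  have \<mu>: "0 < \<mu>" "\<mu> < 1" "\<mu> * \<mu> = b * r powr \<delta>"
    using pos' b(3) by (auto simp: \<mu>_def \<delta>_def)
  define K0 where "K0 = C * (Cr / c 0) powr \<delta>"
  have K0: "0 < K0" using C Cr_pos c0_pos by (simp add: K0_def)
  define K1 where "K1 = (K0 / (1 - \<mu>)) ^ 4"
  have K1: "0 < K1" using K0 \<mu> by (simp add: K1_def)
  let ?S = "\<lambda>e. \<Sum>i. ennreal ((\<mu> ^ 4) ^ i * lag i e powr s)"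
  have bound: "ennreal (score_bound e ^ 4) \<le> ennreal K1 * ?S e"
    if \<omega>: "typical \<omega>" and e: "e = past \<epsilon> (0 - 1) \<omega>" for \<omega> e
  proof (cases "?S e = \<infinity>")
    case True
    then show ?thesis using K1 by (simp add: ennreal_mult_top)
  next
    case False
    obtain S where S: "0 \<le> S" "?S e = ennreal S"
    proof (cases "?S e" rule: ennreal_cases)
      case (real r)
      then show thesis by (intro that)
    next
      case top
      with False show thesis by (simp only: infinity_ennreal_def)
    qed
    let ?v = "(\<sigma> 0 \<omega>)\<^sup>2"
    have summand: "(\<mu> ^ i * lag i e powr \<delta>) \<le> S powr (1 / 4)" for i
    proof -
      have "ennreal ((\<mu> ^ 4) ^ i * lag i e powr s) \<le> ?S e"
        by (rule ennreal_le_suminf)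
      then have "ennreal ((\<mu> ^ 4) ^ i * lag i e powr s) \<le> ennreal S" unfolding S(2) .
      then have "(\<mu> ^ 4) ^ i * lag i e powr s \<le> S" unfolding ennreal_le_iff[OF S(1)] .
      then have "((\<mu> ^ 4) ^ i * lag i e powr s) powr (1 / 4) \<le> S powr (1 / 4)"
        using \<mu> by (intro powr_mono2) auto
      also have "((\<mu> ^ 4) ^ i * lag i e powr s) powr (1 / 4) = (\<mu> ^ i * lag i e powr \<delta>)"
      proof -
        have "((\<mu> ^ 4) ^ i) powr (1 / 4) = ((\<mu> ^ i) ^ 4) powr (1 / 4)"
          by (simp add: power_mult[symmetric] mult.commute)
        also have "\<dots> = ((\<mu> ^ i) powr 4) powr (1 / 4)"
        proof -
          have "(\<mu> ^ i) powr 4 = (\<mu> ^ i) ^ 4" using \<mu> by simp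
          then show ?thesis by (simp only:)
        qed
        also have "\<dots> = (\<mu> ^ i) powr (4 * (1 / 4))" by (rule powr_powr)
        also have "\<dots> = \<mu> ^ i" using \<mu> by simp
        finally show ?thesis using \<mu> by (simp add: powr_mult powr_powr \<delta>_def)
      qed
      finally show ?thesis .
    qed
    have le: "C * b ^ i * (c i * lag i e / ?v) \<le> K0 * S powr (1 / 4) * \<mu> ^ i" for i
    proof -
      define z where "z = c i * lag i e / ?v"
      have v: "c 0 \<le> ?v" by (rule sigma2_ge(1)[OF \<omega>])
      have z: "0 \<le> z" "z \<le> 1" using sigma2_ge(2)[OF \<omega>, of i 0] sigma2_pos[OF \<omega>, of 0] c_nonneg lag_nonneg
        by (auto simp: z_def e)
      have "z \<le> z powr \<delta>"
        using z \<delta> powr_mono'[of \<delta> 1 z] by (cases "z = 0") auto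
      also have "\<dots> \<le> ((Cr * r ^ i) * lag i e / c 0) powr \<delta>"
        unfolding z_def using z(1) v c0_pos c_nonneg lag_nonneg[of i e] decay[of i] \<delta> Cr_pos r
        by (intro powr_mono2 frac_le mult_right_mono) auto
      also have "\<dots> = (Cr / c 0) powr \<delta> * (r powr \<delta>) ^ i * lag i e powr \<delta>"
      proof -
        define k0 where "k0 = Cr / c 0"
        have "0 \<le> k0" using Cr_pos c0_pos by (simp add: k0_def)
        have "(Cr * r ^ i) * lag i e / c 0 = k0 * (r ^ i) * lag i e" by (simp add: k0_def)
        moreover have "(r ^ i) powr \<delta> = (r powr \<delta>) ^ i"
          using r by (simp add: powr_realpow[symmetric] powr_powr mult.commute)
        ultimately show ?thesis using \<open>0 \<le> k0\<close> r lag_nonneg[of i e]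
          unfolding k0_def[symmetric] by (simp add: powr_mult)
      qed
      finally have "C * b ^ i * z \<le> C * b ^ i * ((Cr / c 0) powr \<delta> * (r powr \<delta>) ^ i * lag i e powr \<delta>)"
        using C b by (intro mult_left_mono) auto
      also have "\<dots> = K0 * (b * r powr \<delta>) ^ i * lag i e powr \<delta>"
        by (simp add: K0_def power_mult_distrib mult_ac)
      also have "\<dots> = K0 * \<mu> ^ i * (\<mu> ^ i * lag i e powr \<delta>)"
        unfolding \<mu>(3)[symmetric] by (simp add: power_mult_distrib mult_ac)
      also have "\<dots> \<le> K0 * \<mu> ^ i * S powr (1 / 4)"
        using K0 \<mu> by (intro mult_left_mono summand) auto
      finally show ?thesis by (simp add: z_def mult_ac)
    qed
    have "score_bound e \<le> K0 * S powr (1 / 4) * (1 / (1 - \<mu>))"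
      unfolding e
    proof (rule sums_le[OF _ score_bound_sums[OF \<omega>] sums_mult[OF geometric_sums]])
      show "C * b ^ i * (c i * lag i (past \<epsilon> (0 - 1) \<omega>) / ?v) \<le> K0 * S powr (1 / 4) * \<mu> ^ i" for i
        using le[of i] unfolding e .
    qed (use \<mu> in auto)
    then have "score_bound e ^ 4 \<le> (K0 * S powr (1 / 4) * (1 / (1 - \<mu>))) ^ 4"
      using score_bound_ge_1[OF \<omega>, of 0] by (intro power_mono) (auto simp: e)
    also have "\<dots> = K1 * (S powr (1 / 4)) ^ 4" by (simp add: K1_def power_mult_distrib power_divide)
    also have "(S powr (1 / 4)) ^ 4 = S"
      using S(1) by (cases "S = 0") (auto simp: powr_realpow[symmetric] powr_powr simp del: powr_numeral)
    finally show ?thesis using K1 S by (simp add: ennreal_mult'[symmetric] ennreal_leI)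
  qed
  have "(\<integral>\<^sup>+e. ennreal (score_bound e ^ 4) \<partial>past_law) = (\<integral>\<^sup>+\<omega>. ennreal (score_bound (past \<epsilon> (0 - 1) \<omega>) ^ 4) \<partial>M)"
    by (rule nn_integral_past[symmetric]) measurable
  also have "\<dots> \<le> (\<integral>\<^sup>+\<omega>. ennreal K1 * ?S (past \<epsilon> (0 - 1) \<omega>) \<partial>M)"
    by (rule nn_integral_mono_AE, rule eventually_mono[OF AE_typical]) (use bound in blast)
  also have "\<dots> = (\<integral>\<^sup>+e. ennreal K1 * ?S e \<partial>past_law)"
    by (rule nn_integral_past) measurable
  also have "\<dots> = ennreal K1 * (\<Sum>i. \<integral>\<^sup>+e. ennreal ((\<mu> ^ 4) ^ i * lag i e powr s) \<partial>past_law)"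
    by (subst nn_integral_cmult, measurable) (subst nn_integral_suminf, auto)
  also have "\<dots> \<le> ennreal K1 * (\<Sum>i. ennreal ((\<mu> ^ 4) ^ i * max 1 R))"
  proof (intro mult_left_mono suminf_le)
    fix i
    have "(\<integral>\<^sup>+e. ennreal ((\<mu> ^ 4) ^ i * lag i e powr s) \<partial>past_law) =
        ennreal ((\<mu> ^ 4) ^ i) * (\<integral>\<^sup>+e. ennreal (lag i e powr s) \<partial>past_law)"
      using \<mu> by (subst nn_integral_cmult[symmetric]) (auto simp: ennreal_mult')
    also have "\<dots> \<le> ennreal ((\<mu> ^ 4) ^ i) * ennreal (max 1 R)"
      by (intro mult_left_mono lag_moment) simp
    finally show "(\<integral>\<^sup>+e. ennreal ((\<mu> ^ 4) ^ i * lag i e powr s) \<partial>past_law) \<le> ennreal ((\<mu> ^ 4) ^ i * max 1 R)"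
      using \<mu> by (simp add: ennreal_mult')
  qed auto
  also have "(\<Sum>i. ennreal ((\<mu> ^ 4) ^ i * max 1 R)) = ennreal (\<Sum>i. (\<mu> ^ 4) ^ i * max 1 R)"
    using \<mu> by (intro suminf_ennreal2 summable_mult2 summable_geometric) (auto simp: power_less_one_iff)
  also have "ennreal K1 * \<dots> < \<infinity>" by (simp add: ennreal_mult_less_top)
  finally show ?thesis .
qed

end

section \<open>Expansion of the powers of the residuals\<close>

text \<open>With \<open>z = sqrt (1 + y)\<close> one has \<open>y = (z - 1) (z + 1)\<close>, and the two quantities are \<open>(1 - z) / z\<close> and
  \<open>(z - 1)\<^sup>2 (z + 2) / (2 z)\<close>.\<close>

lemma inverse_sqrt_expansion:
  fixes y :: real
  assumes y: "\<bar>y\<bar> \<le> 1 / 2"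
  shows "\<bar>1 / sqrt (1 + y) - 1\<bar> \<le> 2 * \<bar>y\<bar>" "\<bar>1 / sqrt (1 + y) - 1 + y / 2\<bar> \<le> 4 * y\<^sup>2"
proof -
  define z where "z = sqrt (1 + y)"
  have z2: "z\<^sup>2 = 1 + y" using y by (simp add: z_def)
  have z0: "0 \<le> z" using y by (simp add: z_def)
  have zl: "1 / 2 \<le> z"
    by (rule power2_le_imp_le[OF _ z0]) (use z2 y in \<open>simp add: power2_eq_square\<close>)
  have zu: "z \<le> 2" by (rule power2_le_imp_le) (use z2 y in \<open>simp_all add: power2_eq_square\<close>)
  have y_eq: "y = (z - 1) * (z + 1)" using z2 by (simp add: power2_eq_square algebra_simps)
  have "\<bar>z - 1\<bar> * 1 \<le> \<bar>z - 1\<bar> * (z + 1)" using z0 by (intro mult_left_mono) auto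
  then have dz: "\<bar>z - 1\<bar> \<le> \<bar>y\<bar>" using z0 by (simp add: y_eq abs_mult)
  have iz: "1 / z \<le> 2" "0 < 1 / z" using zl by (auto simp: field_simps)
  have "\<bar>1 / z - 1\<bar> = \<bar>z - 1\<bar> * (1 / z)"
    using zl by (subst abs_of_pos[OF iz(2), symmetric], subst abs_mult[symmetric])
      (simp add: field_simps abs_minus_commute)
  also have "\<dots> \<le> \<bar>y\<bar> * 2" using dz iz by (intro mult_mono) auto
  finally show "\<bar>1 / sqrt (1 + y) - 1\<bar> \<le> 2 * \<bar>y\<bar>" by (simp add: z_def)
  have "1 / z - 1 + y / 2 = (z - 1)\<^sup>2 * ((z + 2) / 2 * (1 / z))"
    using zl unfolding y_eq by (simp add: field_simps power2_eq_square)
  then have "\<bar>1 / z - 1 + y / 2\<bar> = (z - 1)\<^sup>2 * ((z + 2) / 2 * (1 / z))"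
    using z0 by (simp add: abs_of_nonneg)
  also have "\<dots> \<le> y\<^sup>2 * (2 * 2)"
    using zu z0 iz abs_le_square_iff[of "z - 1" y] dz by (intro mult_mono) auto
  finally show "\<bar>1 / sqrt (1 + y) - 1 + y / 2\<bar> \<le> 4 * y\<^sup>2" by (simp add: z_def)
qed

lemma power_near_one:
  "\<exists>K\<ge>0. \<forall>z::real. \<bar>z - 1\<bar> \<le> 1 \<longrightarrow> \<bar>z ^ k - 1 - real k * (z - 1)\<bar> \<le> K * (z - 1)\<^sup>2"
proof (induction k)
  case 0
  show ?case by (intro exI[of _ 0]) simp
next
  case (Suc k)
  then obtain K where K: "0 \<le> K" "\<And>z::real. \<bar>z - 1\<bar> \<le> 1 \<Longrightarrow> \<bar>z ^ k - 1 - real k * (z - 1)\<bar> \<le> K * (z - 1)\<^sup>2" by blast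
  have "\<bar>z ^ Suc k - 1 - real (Suc k) * (z - 1)\<bar> \<le> (2 * K + real k) * (z - 1)\<^sup>2" if z: "\<bar>z - 1\<bar> \<le> 1" for z :: real
  proof -
    have "z ^ Suc k - 1 - real (Suc k) * (z - 1) = z * (z ^ k - 1 - real k * (z - 1)) + real k * (z - 1)\<^sup>2"
      by (simp add: algebra_simps power2_eq_square)
    also have "\<bar>\<dots>\<bar> \<le> \<bar>z\<bar> * \<bar>z ^ k - 1 - real k * (z - 1)\<bar> + real k * (z - 1)\<^sup>2"
      by (intro order_trans[OF abs_triangle_ineq]) (simp add: abs_mult)
    also have "\<dots> \<le> 2 * (K * (z - 1)\<^sup>2) + real k * (z - 1)\<^sup>2"
      using z K(2)[OF z] by (intro add_right_mono mult_mono) auto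
    finally show ?thesis by (simp add: algebra_simps)
  qed
  then show ?case using K(1) by (intro exI[of _ "2 * K + real k"]) auto
qed

lemma inverse_sqrt_power_expansion:
  "\<exists>K\<ge>0. \<forall>y. \<bar>y\<bar> \<le> 1 / 2 \<longrightarrow> \<bar>(1 / sqrt (1 + y)) ^ k - 1 + real k / 2 * y\<bar> \<le> K * y\<^sup>2"
proof -
  obtain K where K: "0 \<le> K" "\<And>z::real. \<bar>z - 1\<bar> \<le> 1 \<Longrightarrow> \<bar>z ^ k - 1 - real k * (z - 1)\<bar> \<le> K * (z - 1)\<^sup>2"
    using power_near_one by blast
  have "\<bar>(1 / sqrt (1 + y)) ^ k - 1 + real k / 2 * y\<bar> \<le> (4 * K + 4 * real k) * y\<^sup>2" if y: "\<bar>y\<bar> \<le> 1 / 2" for y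
  proof -
    define z where "z = 1 / sqrt (1 + y)"
    have z: "\<bar>z - 1\<bar> \<le> 2 * \<bar>y\<bar>" "\<bar>z - 1 + y / 2\<bar> \<le> 4 * y\<^sup>2"
      unfolding z_def by (rule inverse_sqrt_expansion[OF y])+
    have z2: "(z - 1)\<^sup>2 \<le> 4 * y\<^sup>2"
      using power_mono[OF z(1), of 2] by (simp add: power_mult_distrib)
    have "z ^ k - 1 + real k / 2 * y = (z ^ k - 1 - real k * (z - 1)) + real k * (z - 1 + y / 2)"
      by (simp add: algebra_simps)
    also have "\<bar>\<dots>\<bar> \<le> \<bar>z ^ k - 1 - real k * (z - 1)\<bar> + real k * \<bar>z - 1 + y / 2\<bar>"
      by (intro order_trans[OF abs_triangle_ineq]) (simp add: abs_mult)
    also have "\<dots> \<le> K * (4 * y\<^sup>2) + real k * (4 * y\<^sup>2)"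
      using K z z2 y by (intro add_mono mult_left_mono order_trans[OF K(2)]) auto
    finally show ?thesis by (simp add: z_def algebra_simps)
  qed
  then show ?thesis using K(1) by (intro exI[of _ "4 * K + 4 * real k"]) auto
qed

lemma abs_sums_le:
  fixes f g :: "nat \<Rightarrow> real"
  assumes "f sums x" "g sums y" "\<And>i. \<bar>f i\<bar> \<le> g i"
  shows "\<bar>x\<bar> \<le> y"
proof -
  have "x \<le> y" by (rule sums_le[OF _ assms(1,2)]) (use assms(3) in \<open>auto simp: abs_le_iff\<close>)
  moreover have "- x \<le> y" by (rule sums_le[OF _ sums_minus[OF assms(1)] assms(2)]) (use assms(3) in \<open>auto simp: abs_le_iff\<close>)
  ultimately show ?thesis by simp
qed

lemma garch_c_nonneg_of_nonneg:
  "(\<And>l. l \<le> p + q \<Longrightarrow> 0 \<le> u l) \<Longrightarrow> 0 < i \<Longrightarrow> 0 \<le> garch_c p q u i"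
proof (induction i rule: less_induct)
  case (less i)
  have "0 \<le> (\<Sum>j=1..min (i - 1) q. u (p + j) * garch_c p q u (i - j))"
    using less by (intro sum_nonneg mult_nonneg_nonneg) auto
  then show ?case using less.prems by (subst garch_c_pos) auto
qed

context garch_estimates begin

text \<open>Bounds, up to the factor \<open>(b r)\<^sup>t\<close>, the part of the variance at time \<open>t\<close> that stems from observations before
  time 0, which the fitted variance does not see.\<close>

definition tail_bound :: "'a \<Rightarrow> real" where
  "tail_bound \<omega> = C * Cr / c 0 * (\<Sum>j. (b * r) ^ j * (X (- int j) \<omega>)\<^sup>2)"

lemma measurable_tail_bound [measurable]: "tail_bound \<in> borel_measurable M"
  unfolding tail_bound_def by measurable

context
  fixes \<omega> assumes typical: "typical \<omega>"
begin

lemma past_square_summable: "summable (\<lambda>j. (b * r) ^ j * (X (- int j) \<omega>)\<^sup>2)"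
proof -
  obtain B where B: "0 \<le> B" "\<And>i. (X (0 - int i) \<omega>)\<^sup>2 \<le> B * b ^ i" using typical_growth[OF typical, of 0] by metis
  have maj: "norm ((b * r) ^ j * (X (- int j) \<omega>)\<^sup>2) \<le> B * (b * b * r) ^ j" for j
  proof -
    have "(b * r) ^ j * (X (- int j) \<omega>)\<^sup>2 \<le> (b * r) ^ j * (B * b ^ j)"
      using B(2)[of j] b r by (intro mult_left_mono) auto
    also have "\<dots> = B * (b * b * r) ^ j" by (simp add: power_mult_distrib mult_ac)
    finally show ?thesis using b r by simp
  qed
  have "summable (\<lambda>i. B * (b * b * r) ^ i)"
    by (intro summable_mult summable_geometric) (use b r b2r in simp)
  then show ?thesis by (rule summable_comparison_test'[where N = 0]) (rule maj)
qed

lemma tail_bound_nonneg: "0 \<le> tail_bound \<omega>"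
  unfolding tail_bound_def using C Cr_pos c0_pos b r
  by (intro mult_nonneg_nonneg suminf_nonneg past_square_summable) auto

lemma truncation_tail:
  fixes t :: nat
  defines "e \<equiv> past \<epsilon> (int t - 1) \<omega>"
  shows "\<exists>T. (\<lambda>i. if t < i then C * b ^ i * (c i * lag i e / (\<sigma> (int t) \<omega>)\<^sup>2) else 0) sums T \<and>
    T \<le> (b * r) ^ t * tail_bound \<omega>"
proof -
  let ?g = "\<lambda>i. C * b ^ i * (c i * lag i e / (\<sigma> (int t) \<omega>)\<^sup>2)"
  let ?f = "\<lambda>i. if t < i then ?g i else 0"
  let ?m = "\<lambda>k. (b * r) ^ t * (C * Cr / c 0 * ((b * r) ^ k * (X (- int k) \<omega>)\<^sup>2))"
  have m: "?m sums ((b * r) ^ t * tail_bound \<omega>)"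
    unfolding tail_bound_def by (intro sums_mult summable_sums past_square_summable)
  have g_nn: "0 \<le> ?g i" for i using C b c_nonneg lag_nonneg by simp
  have le: "?f (k + t) \<le> ?m k" for k
  proof (cases "k = 0")
    case True
    then show ?thesis using b r C Cr_pos c0_pos by simp
  next
    case False
    have v: "c 0 \<le> (\<sigma> (int t) \<omega>)\<^sup>2" by (rule sigma2_ge(1)[OF typical])
    have l: "lag (k + t) e = (X (- int k) \<omega>)\<^sup>2"
      using False unfolding e_def typical_lag[OF typical] by simp
    have "?g (k + t) \<le> C * b ^ (k + t) * (Cr * r ^ (k + t) * (X (- int k) \<omega>)\<^sup>2 / c 0)"
      unfolding l using v c0_pos C b decay[of "k + t"] c_nonneg Cr_pos r
      by (intro mult_left_mono frac_le mult_right_mono) auto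
    also have "\<dots> = ?m k" by (simp add: power_add power_mult_distrib mult_ac)
    finally show ?thesis using False by simp
  qed
  have sm: "summable (\<lambda>k. ?f (k + t))"
    by (rule summable_comparison_test'[OF sums_summable[OF m], where N = 0]) (use le g_nn in auto)
  then have "(\<lambda>k. ?f (k + t)) sums (\<Sum>k. ?f (k + t))" by (rule summable_sums)
  then have "?f sums (\<Sum>k. ?f (k + t))" by (subst (asm) sums_zero_iff_shift) auto
  moreover have "(\<Sum>k. ?f (k + t)) \<le> (b * r) ^ t * tail_bound \<omega>"
    using sums_le[OF le summable_sums[OF sm] m] .
  ultimately show ?thesis by blast
qed

text \<open>Here \<open>y + 1\<close> is the ratio of the fitted and the true variance. Both are sums over lags; up to lag \<open>t\<close> the
  difference of the weights is expanded, beyond lag \<open>t\<close> everything is charged to the geometric tail.\<close>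

lemma volatility_ratio_expansion:
  fixes t :: nat and u :: "nat \<Rightarrow> real"
  defines "e \<equiv> past \<epsilon> (int t - 1) \<omega>"
    and "y \<equiv> sigma2_hat p q u (\<lambda>s. X s \<omega>) t / (\<sigma> (int t) \<omega>)\<^sup>2 - 1"
  assumes \<eta>: "0 \<le> \<eta>" "\<eta> \<le> \<eta>0" and u: "\<forall>l\<le>p + q. \<bar>u l - \<theta> l\<bar> \<le> \<eta> * \<theta> l"
  shows "\<bar>y\<bar> \<le> \<eta> * score_bound e + (b * r) ^ t * tail_bound \<omega>"
    "\<bar>y - (\<Sum>l\<le>p + q. (u l - \<theta> l) * score l e)\<bar> \<le> \<eta>\<^sup>2 * score_bound e + real (p + q + 2) * ((b * r) ^ t * tail_bound \<omega>)"
proof -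
  let ?cu = "garch_c p q u"
  define a where "a i = lag i e / (\<sigma> (int t) \<omega>)\<^sup>2" for i
  define g where "g i = C * b ^ i * (c i * a i)" for i
  define L where "L i = (\<Sum>l\<le>p + q. (u l - \<theta> l) * dc l i)" for i
  have a_nn: "0 \<le> a i" for i using lag_nonneg by (simp add: a_def)
  have ca_le: "c i * a i \<le> g i" for i
  proof -
    have "1 \<le> C * b ^ i" using C b mult_mono[of 1 C 1 "b ^ i"] by (simp add: one_le_power)
    from mult_right_mono[OF this, of "c i * a i"] show ?thesis
      using a_nn c_nonneg by (simp add: g_def)
  qed
  have g_nn: "0 \<le> g i" for i using ca_le[of i] a_nn[of i] c_nonneg[of i] by (meson mult_nonneg_nonneg order_trans)
  have G: "g sums score_bound e"
    using score_bound_sums[OF typical, of "int t"] by (simp add: g_def[abs_def] a_def e_def)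
  obtain T where T: "(\<lambda>i. if t < i then g i else 0) sums T" "T \<le> (b * r) ^ t * tail_bound \<omega>"
  proof -
    have "g = (\<lambda>i. C * b ^ i * (c i * lag i e / (\<sigma> (int t) \<omega>)\<^sup>2))" by (simp add: g_def a_def fun_eq_iff)
    then show thesis using truncation_tail[of t] that unfolding e_def by blast
  qed
  have y_sums: "(\<lambda>i. (if i \<in> {..t} then ?cu i * a i else 0) - c i * a i) sums y"
  proof -
    have "sigma2_hat p q u (\<lambda>s. X s \<omega>) t = (\<Sum>i\<in>{..t}. ?cu i * lag i e)"
    proof -
      have "(\<Sum>i\<in>{..t}. ?cu i * lag i e) = ?cu 0 * lag 0 e + (\<Sum>i=1..t. ?cu i * lag i e)"
      proof -
        have "{..t} = insert 0 {1..t}" by auto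
        then show ?thesis by simp
      qed
      then show ?thesis
        by (simp add: sigma2_hat_def e_def typical_lag[OF typical])
    qed
    then have "sigma2_hat p q u (\<lambda>s. X s \<omega>) t / (\<sigma> (int t) \<omega>)\<^sup>2 = (\<Sum>i\<in>{..t}. ?cu i * a i)"
      by (simp add: a_def sum_divide_distrib)
    moreover have "(\<lambda>i. if i \<in> {..t} then ?cu i * a i else 0) sums (\<Sum>i\<in>{..t}. ?cu i * a i)"
      by (rule sums_If_finite_set) simp
    moreover have "(\<lambda>i. c i * a i) sums 1"
      using sums_divide[OF representation[OF typical, of "int t"], of "(\<sigma> (int t) \<omega>)\<^sup>2"] sigma2_pos[OF typical, of "int t"]
      by (simp add: a_def e_def)
    ultimately show ?thesis unfolding y_def by (auto intro: sums_diff)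
  qed
  have ex: "\<bar>?cu i - c i\<bar> \<le> \<eta> * (C * b ^ i * c i)" "\<bar>?cu i - c i - L i\<bar> \<le> \<eta>\<^sup>2 * (C * b ^ i * c i)" for i
    using expansion[OF \<eta> u, of i] by (simp_all add: L_def)
  have "\<bar>y\<bar> \<le> \<eta> * score_bound e + T"
  proof (rule abs_sums_le[OF y_sums sums_add[OF sums_mult[OF G] T(1)]])
    fix i
    show "\<bar>(if i \<in> {..t} then ?cu i * a i else 0) - c i * a i\<bar> \<le> \<eta> * g i + (if t < i then g i else 0)"
    proof (cases "i \<le> t")
      case True
      have "\<bar>?cu i * a i - c i * a i\<bar> = \<bar>?cu i - c i\<bar> * a i"
        using a_nn by (simp add: left_diff_distrib[symmetric] abs_mult)
      also have "\<dots> \<le> \<eta> * (C * b ^ i * c i) * a i" by (rule mult_right_mono[OF ex(1) a_nn])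
      finally show ?thesis using True by (simp add: g_def mult_ac)
    next
      case False
      have "0 \<le> \<eta> * g i" using \<eta> g_nn by simp
      then show ?thesis using False ca_le[of i] a_nn[of i] c_nonneg[of i] by simp
    qed
  qed
  then show "\<bar>y\<bar> \<le> \<eta> * score_bound e + (b * r) ^ t * tail_bound \<omega>" using T(2) by linarith
  have L_sums: "(\<lambda>i. L i * a i) sums (\<Sum>l\<le>p + q. (u l - \<theta> l) * score l e)"
  proof -
    have "(\<lambda>i. \<Sum>l\<le>p + q. (u l - \<theta> l) * (dc l i * a i)) sums (\<Sum>l\<le>p + q. (u l - \<theta> l) * score l e)"
      unfolding a_def e_def by (intro sums_sum sums_mult score_sums[OF typical]) simp
    then show ?thesis by (simp add: L_def sum_distrib_right mult.assoc)
  qed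
  have L_le: "\<bar>L i\<bar> * a i \<le> real (p + q + 1) * g i" for i
  proof -
    have "\<bar>L i\<bar> \<le> (\<Sum>l\<le>p + q. C * b ^ i * c i)"
      unfolding L_def
    proof (intro order_trans[OF sum_abs] sum_mono)
      fix l assume "l \<in> {..p + q}"
      then have l: "l \<le> p + q" by simp
      have "\<bar>(u l - \<theta> l) * dc l i\<bar> \<le> \<eta> * \<theta> l * dc l i"
        unfolding abs_mult using u l dc_nonneg[OF l] by (simp add: mult_right_mono)
      also have "\<dots> = \<eta> * (\<theta> l * dc l i)" by simp
      also have "\<dots> \<le> 1 * (C * b ^ i * c i)"
        by (rule mult_mono) (use \<eta> \<eta>0 dc_bound[OF l, of i] dc_nonneg[OF l, of i] pos[OF l] in auto)
      finally show "\<bar>(u l - \<theta> l) * dc l i\<bar> \<le> C * b ^ i * c i" by simp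
    qed
    then have "\<bar>L i\<bar> * a i \<le> (\<Sum>l\<le>p + q. C * b ^ i * c i) * a i" by (rule mult_right_mono[OF _ a_nn])
    then show ?thesis by (simp add: g_def mult_ac)
  qed
  have "\<bar>y - (\<Sum>l\<le>p + q. (u l - \<theta> l) * score l e)\<bar> \<le> \<eta>\<^sup>2 * score_bound e + real (p + q + 2) * T"
  proof (rule abs_sums_le[OF sums_diff[OF y_sums L_sums] sums_add[OF sums_mult[OF G] sums_mult[OF T(1)]]])
    fix i
    show "\<bar>(if i \<in> {..t} then ?cu i * a i else 0) - c i * a i - L i * a i\<bar> \<le>
        \<eta>\<^sup>2 * g i + real (p + q + 2) * (if t < i then g i else 0)"
    proof (cases "i \<le> t")
      case True
      have "\<bar>?cu i * a i - c i * a i - L i * a i\<bar> = \<bar>?cu i - c i - L i\<bar> * a i"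
        using a_nn by (simp add: left_diff_distrib[symmetric] abs_mult)
      also have "\<dots> \<le> \<eta>\<^sup>2 * (C * b ^ i * c i) * a i" by (rule mult_right_mono[OF ex(2) a_nn])
      finally show ?thesis using True by (simp add: g_def mult_ac)
    next
      case False
      have "\<bar>0 - c i * a i - L i * a i\<bar> \<le> c i * a i + \<bar>L i\<bar> * a i"
        using a_nn[of i] c_nonneg[of i] abs_triangle_ineq[of "c i * a i" "L i * a i"]
        by (simp add: abs_mult)
      also have "\<dots> \<le> g i + real (p + q + 1) * g i" by (intro add_mono ca_le L_le)
      also have "\<dots> = real (p + q + 2) * g i" by (simp add: algebra_simps)
      also have "\<dots> \<le> \<eta>\<^sup>2 * g i + real (p + q + 2) * g i" using g_nn[of i] by simp
      finally show ?thesis using False by simp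
    qed
  qed
  also have "\<dots> \<le> \<eta>\<^sup>2 * score_bound e + real (p + q + 2) * ((b * r) ^ t * tail_bound \<omega>)"
    using T(2) by (intro add_left_mono mult_left_mono) auto
  finally show "\<bar>y - (\<Sum>l\<le>p + q. (u l - \<theta> l) * score l e)\<bar> \<le>
    \<eta>\<^sup>2 * score_bound e + real (p + q + 2) * ((b * r) ^ t * tail_bound \<omega>)" .
qed

end

text \<open>A bound for the linearization error that uses only a lower bound of the fitted variance. It serves
  at the finitely many times at which the unobserved past is not yet negligible.\<close>

definition crude :: "nat \<Rightarrow> nat \<Rightarrow> 'a \<Rightarrow> real" where
  "crude k t \<omega> = (\<bar>X (int t) \<omega>\<bar> / sqrt (c 0 / 2)) ^ k + \<bar>\<epsilon> (int t) \<omega>\<bar> ^ k +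
     real k / 2 * \<bar>\<epsilon> (int t) \<omega>\<bar> ^ k * (real (p + q + 1) * score_bound (past \<epsilon> (int t - 1) \<omega>))"

text \<open>The relative score enters with the factor \<open>- k / 2\<close> because the residual is the noise times the power
  \<open>- 1 / 2\<close> of the variance ratio.\<close>

definition linearization_error :: "nat \<Rightarrow> (nat \<Rightarrow> real) \<Rightarrow> nat \<Rightarrow> 'a \<Rightarrow> real" where
  "linearization_error k u t \<omega> = residual p q u (\<lambda>s. X s \<omega>) t ^ k - \<epsilon> (int t) \<omega> ^ k +
     real k / 2 * (\<Sum>l\<le>p + q. (u l - \<theta> l) * (\<epsilon> (int t) \<omega> ^ k * score l (past \<epsilon> (int t - 1) \<omega>)))"

lemma residual_expansion:
  "\<exists>K\<ge>0. \<forall>\<omega> t \<eta> u. typical \<omega> \<longrightarrow> 0 \<le> \<eta> \<longrightarrow> \<eta> \<le> \<eta>0 \<longrightarrow> (\<forall>l\<le>p + q. \<bar>u l - \<theta> l\<bar> \<le> \<eta> * \<theta> l) \<longrightarrow>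
    \<eta> * score_bound (past \<epsilon> (int t - 1) \<omega>) \<le> 1 / 4 \<longrightarrow> (b * r) ^ t * tail_bound \<omega> \<le> 1 / 4 \<longrightarrow>
    \<bar>linearization_error k u t \<omega>\<bar>
    \<le> K * (\<bar>\<epsilon> (int t) \<omega>\<bar> ^ k * (\<eta>\<^sup>2 * (score_bound (past \<epsilon> (int t - 1) \<omega>))\<^sup>2 + (b * r) ^ t * tail_bound \<omega>))"
proof -
  obtain K where K: "0 \<le> K" "\<And>y. \<bar>y\<bar> \<le> 1 / 2 \<Longrightarrow> \<bar>(1 / sqrt (1 + y)) ^ k - 1 + real k / 2 * y\<bar> \<le> K * y\<^sup>2"
    using inverse_sqrt_power_expansion by blast
  define D where "D = real (p + q + 2)"
  define K' where "K' = 2 * K + real k / 2 * D"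
  have D: "1 \<le> D" by (simp add: D_def)
  have "\<bar>linearization_error k u t \<omega>\<bar>
    \<le> K' * (\<bar>\<epsilon> (int t) \<omega>\<bar> ^ k * (\<eta>\<^sup>2 * (score_bound (past \<epsilon> (int t - 1) \<omega>))\<^sup>2 + (b * r) ^ t * tail_bound \<omega>))"
    if typical: "typical \<omega>" and \<eta>: "0 \<le> \<eta>" "\<eta> \<le> \<eta>0" and u: "\<forall>l\<le>p + q. \<bar>u l - \<theta> l\<bar> \<le> \<eta> * \<theta> l"
      and small: "\<eta> * score_bound (past \<epsilon> (int t - 1) \<omega>) \<le> 1 / 4" "(b * r) ^ t * tail_bound \<omega> \<le> 1 / 4"
    for \<omega> t \<eta> u
  proof -
    define e where "e = past \<epsilon> (int t - 1) \<omega>"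
    define G where "G = score_bound e"
    define T where "T = (b * r) ^ t * tail_bound \<omega>"
    define W where "W = (\<Sum>l\<le>p + q. (u l - \<theta> l) * score l e)"
    define y where "y = sigma2_hat p q u (\<lambda>s. X s \<omega>) t / (\<sigma> (int t) \<omega>)\<^sup>2 - 1"
    define v where "v = \<sigma> (int t) \<omega>"
    define x where "x = \<epsilon> (int t) \<omega>"
    have y1: "\<bar>y\<bar> \<le> \<eta> * G + T" and y2: "\<bar>y - W\<bar> \<le> \<eta>\<^sup>2 * G + D * T"
      using volatility_ratio_expansion[OF typical \<eta> u, of t] unfolding y_def G_def T_def W_def D_def e_def by simp_all
    have T: "0 \<le> T" "T \<le> 1 / 4" using tail_bound_nonneg[OF typical] b r small by (simp_all add: T_def)
    have G1: "1 \<le> G" unfolding G_def e_def by (rule score_bound_ge_1[OF typical])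
    have \<eta>G: "0 \<le> \<eta> * G" "\<eta> * G \<le> 1 / 4" using \<eta> G1 small by (simp_all add: G_def e_def)
    have yh: "\<bar>y\<bar> \<le> 1 / 2" using y1 T \<eta>G by linarith
    have v: "0 < v"
    proof -
      have "0 \<le> \<sigma> (int t) \<omega>" using typical unfolding typical_def solves_def by blast
      moreover have "\<sigma> (int t) \<omega> \<noteq> 0" using sigma2_pos[OF typical, of "int t"] by auto
      ultimately show ?thesis by (simp add: v_def)
    qed
    have "sigma2_hat p q u (\<lambda>s. X s \<omega>) t = v\<^sup>2 * (1 + y)" using v by (simp add: y_def v_def)
    then have "residual p q u (\<lambda>s. X s \<omega>) t = v * x / sqrt (v\<^sup>2 * (1 + y))"
      by (simp add: residual_def typical_X[OF typical] v_def x_def)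
    also have "\<dots> = x * (1 / sqrt (1 + y))" using v by (simp add: real_sqrt_mult)
    finally have res: "residual p q u (\<lambda>s. X s \<omega>) t ^ k = x ^ k * (1 / sqrt (1 + y)) ^ k"
      by (simp only: power_mult_distrib)
    have sumW: "(\<Sum>l\<le>p + q. (u l - \<theta> l) * (x ^ k * score l e)) = x ^ k * W"
      by (simp add: W_def sum_distrib_left mult_ac)
    have "y\<^sup>2 \<le> (\<eta> * G + T)\<^sup>2" using y1 \<eta>G T abs_le_square_iff[of y "\<eta> * G + T"] by simp
    also have "\<dots> \<le> 2 * (\<eta> * G)\<^sup>2 + 2 * T\<^sup>2" using zero_le_power2[of "\<eta> * G - T"] by (simp add: power2_eq_square algebra_simps)
    also have "T\<^sup>2 \<le> T" using T mult_left_le[of T T] by (simp add: power2_eq_square)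
    finally have ysq: "y\<^sup>2 \<le> 2 * (\<eta>\<^sup>2 * G\<^sup>2 + T)" by (simp add: power_mult_distrib)
    have "G \<le> G\<^sup>2" using G1 by (simp add: power2_eq_square)
    then have "\<eta>\<^sup>2 * G \<le> \<eta>\<^sup>2 * G\<^sup>2" by (intro mult_left_mono) auto
    also have "\<dots> \<le> D * (\<eta>\<^sup>2 * G\<^sup>2)" using mult_right_mono[OF D, of "\<eta>\<^sup>2 * G\<^sup>2"] by simp
    finally have yW: "\<bar>y - W\<bar> \<le> D * (\<eta>\<^sup>2 * G\<^sup>2 + T)" using y2 by (simp add: distrib_left)
    have "x ^ k * (1 / sqrt (1 + y)) ^ k - x ^ k + real k / 2 * (x ^ k * W) =
        x ^ k * (((1 / sqrt (1 + y)) ^ k - 1 + real k / 2 * y) - real k / 2 * (y - W))"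
      by (simp only: right_diff_distrib distrib_left) simp
    also have "\<bar>\<dots>\<bar> \<le> \<bar>x\<bar> ^ k * (\<bar>(1 / sqrt (1 + y)) ^ k - 1 + real k / 2 * y\<bar> + real k / 2 * \<bar>y - W\<bar>)"
      unfolding abs_mult power_abs
      by (intro mult_left_mono order_trans[OF abs_triangle_ineq4]) (simp_all add: abs_mult)
    also have "\<dots> \<le> \<bar>x\<bar> ^ k * (K * (2 * (\<eta>\<^sup>2 * G\<^sup>2 + T)) + real k / 2 * (D * (\<eta>\<^sup>2 * G\<^sup>2 + T)))"
      using K(1) by (intro mult_left_mono add_mono order_trans[OF K(2)[OF yh]] ysq yW) auto
    also have "\<dots> = K' * (\<bar>x\<bar> ^ k * (\<eta>\<^sup>2 * G\<^sup>2 + T))" by (simp add: K'_def algebra_simps)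
    finally show ?thesis
      unfolding linearization_error_def res[unfolded x_def] sumW[unfolded x_def e_def] G_def T_def e_def x_def .
  qed
  moreover have "0 \<le> K'" using K D by (simp add: K'_def)
  ultimately show ?thesis by blast
qed

lemma residual_crude:
  assumes typical: "typical \<omega>" and \<eta>: "0 \<le> \<eta>" "\<eta> \<le> \<eta>0" "\<eta> * C \<le> 1 / 2"
    and u: "\<forall>l\<le>p + q. \<bar>u l - \<theta> l\<bar> \<le> \<eta> * \<theta> l"
  shows "\<bar>linearization_error k u t \<omega>\<bar> \<le> crude k t \<omega>"
proof -
  define e where "e = past \<epsilon> (int t - 1) \<omega>"
  define x where "x = \<epsilon> (int t) \<omega>"
  let ?Y = "sigma2_hat p q u (\<lambda>s. X s \<omega>) t"
  have u_nn: "0 \<le> u l" if "l \<le> p + q" for l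
  proof -
    have "\<eta> * \<theta> l \<le> 1 * \<theta> l" using \<eta> \<eta>0 pos[OF that] by (intro mult_right_mono) auto
    then show ?thesis using u that by (auto simp: abs_le_iff)
  qed
  have "\<bar>garch_c p q u 0 - c 0\<bar> \<le> \<eta> * (C * b ^ 0 * c 0)" using expansion[OF \<eta>(1,2) u, of 0] by blast
  also have "\<dots> = (\<eta> * C) * c 0" by simp
  also have "\<dots> \<le> 1 / 2 * c 0" using \<eta>(3) c0_pos by (intro mult_right_mono) auto
  finally have "c 0 / 2 \<le> garch_c p q u 0" by linarith
  moreover have "0 \<le> (\<Sum>i=1..t. garch_c p q u i * (X (int t - int i) \<omega>)\<^sup>2)"
    by (intro sum_nonneg mult_nonneg_nonneg garch_c_nonneg_of_nonneg u_nn) auto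
  ultimately have Y: "c 0 / 2 \<le> ?Y" by (simp add: sigma2_hat_def)
  have "\<bar>residual p q u (\<lambda>s. X s \<omega>) t\<bar> = \<bar>X (int t) \<omega>\<bar> / sqrt ?Y"
    using Y c0_pos by (simp add: residual_def)
  also have "\<dots> \<le> \<bar>X (int t) \<omega>\<bar> / sqrt (c 0 / 2)"
    using Y c0_pos by (intro divide_left_mono) auto
  finally have 1: "\<bar>residual p q u (\<lambda>s. X s \<omega>) t ^ k\<bar> \<le> (\<bar>X (int t) \<omega>\<bar> / sqrt (c 0 / 2)) ^ k"
    unfolding power_abs by (intro power_mono) auto
  have "\<bar>\<Sum>l\<le>p + q. (u l - \<theta> l) * score l e\<bar> \<le> (\<Sum>l\<le>p + q. score_bound e)"
  proof (intro order_trans[OF sum_abs] sum_mono)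
    fix l assume "l \<in> {..p + q}"
    then have l: "l \<le> p + q" by simp
    have sl: "0 \<le> score l e" unfolding e_def by (rule score_nonneg[OF typical l])
    have "\<bar>(u l - \<theta> l) * score l e\<bar> \<le> \<eta> * \<theta> l * score l e"
      unfolding abs_mult using u l sl by (simp add: mult_right_mono)
    also have "\<dots> = \<eta> * (\<theta> l * score l e)" by simp
    also have "\<dots> \<le> 1 * score_bound e"
      by (rule mult_mono) (use \<eta> \<eta>0 score_le[OF typical l, of "int t"] sl pos[OF l] in \<open>auto simp: e_def\<close>)
    finally show "\<bar>(u l - \<theta> l) * score l e\<bar> \<le> score_bound e" by simp
  qed
  then have W: "\<bar>\<Sum>l\<le>p + q. (u l - \<theta> l) * score l e\<bar> \<le> real (p + q + 1) * score_bound e" by simp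
  have sumW: "(\<Sum>l\<le>p + q. (u l - \<theta> l) * (x ^ k * score l e)) = x ^ k * (\<Sum>l\<le>p + q. (u l - \<theta> l) * score l e)"
    by (simp add: sum_distrib_left mult_ac)
  have "\<bar>real k / 2 * (x ^ k * (\<Sum>l\<le>p + q. (u l - \<theta> l) * score l e))\<bar> =
      real k / 2 * \<bar>x\<bar> ^ k * \<bar>\<Sum>l\<le>p + q. (u l - \<theta> l) * score l e\<bar>"
    by (simp add: abs_mult power_abs)
  also have "\<dots> \<le> real k / 2 * \<bar>x\<bar> ^ k * (real (p + q + 1) * score_bound e)"
    by (intro mult_left_mono W) auto
  finally have 2: "\<bar>real k / 2 * (\<Sum>l\<le>p + q. (u l - \<theta> l) * (x ^ k * score l e))\<bar> \<le> real k / 2 * \<bar>x\<bar> ^ k * (real (p + q + 1) * score_bound e)"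
    unfolding sumW .
  have tri: "\<bar>A - B + E\<bar> \<le> A' + B' + E'" if "\<bar>A\<bar> \<le> A'" "\<bar>B\<bar> \<le> B'" "\<bar>E\<bar> \<le> E'" for A B E A' B' E' :: real
    using that by linarith
  show ?thesis
    unfolding crude_def linearization_error_def by (rule tri[OF 1 _ 2[unfolded e_def x_def]]) (simp add: power_abs)
qed

definition remainder :: "real \<Rightarrow> nat \<Rightarrow> nat \<Rightarrow> 'a \<Rightarrow> real" where
  "remainder K k t \<omega> = K * (\<bar>\<epsilon> (int t) \<omega>\<bar> ^ k * ((b * r) ^ t * tail_bound \<omega>)) +
     (if 1 / 4 < (b * r) ^ t * tail_bound \<omega> then crude k t \<omega> else 0)"

lemma crude_nonneg: "typical \<omega> \<Longrightarrow> 0 \<le> crude k t \<omega>"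
  unfolding crude_def using score_bound_ge_1[of \<omega> "int t"] c0_pos
  by (intro add_nonneg_nonneg mult_nonneg_nonneg) auto

lemma remainder_nonneg: "typical \<omega> \<Longrightarrow> 0 \<le> K \<Longrightarrow> 0 \<le> remainder K k t \<omega>"
  unfolding remainder_def using crude_nonneg[of \<omega> k t] tail_bound_nonneg[of \<omega>] b r
  by (intro add_nonneg_nonneg mult_nonneg_nonneg) auto

lemma measurable_remainder [measurable]: "remainder K k t \<in> borel_measurable M"
  unfolding remainder_def crude_def by measurable

lemma residual_power_expansion:
  "\<exists>K\<ge>0. \<forall>\<omega> t \<eta> u. typical \<omega> \<longrightarrow> 0 \<le> \<eta> \<longrightarrow> \<eta> \<le> \<eta>0 \<longrightarrow> \<eta> * C \<le> 1 / 2 \<longrightarrow>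
    (\<forall>l\<le>p + q. \<bar>u l - \<theta> l\<bar> \<le> \<eta> * \<theta> l) \<longrightarrow> \<eta> * score_bound (past \<epsilon> (int t - 1) \<omega>) \<le> 1 / 4 \<longrightarrow>
    \<bar>linearization_error k u t \<omega>\<bar>
    \<le> K * \<eta>\<^sup>2 * (\<bar>\<epsilon> (int t) \<omega>\<bar> ^ k * (score_bound (past \<epsilon> (int t - 1) \<omega>))\<^sup>2) + remainder K k t \<omega>"
proof -
  obtain K where K: "0 \<le> K" and ex: "\<forall>\<omega> t \<eta> u. typical \<omega> \<longrightarrow> 0 \<le> \<eta> \<longrightarrow> \<eta> \<le> \<eta>0 \<longrightarrow>
    (\<forall>l\<le>p + q. \<bar>u l - \<theta> l\<bar> \<le> \<eta> * \<theta> l) \<longrightarrow>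
    \<eta> * score_bound (past \<epsilon> (int t - 1) \<omega>) \<le> 1 / 4 \<longrightarrow> (b * r) ^ t * tail_bound \<omega> \<le> 1 / 4 \<longrightarrow>
    \<bar>linearization_error k u t \<omega>\<bar>
    \<le> K * (\<bar>\<epsilon> (int t) \<omega>\<bar> ^ k * (\<eta>\<^sup>2 * (score_bound (past \<epsilon> (int t - 1) \<omega>))\<^sup>2 + (b * r) ^ t * tail_bound \<omega>))"
    using residual_expansion[of k] by blast
  show ?thesis
  proof (intro exI[of _ K] conjI K allI impI)
    fix \<omega> t \<eta> u
    assume typical: "typical \<omega>" and \<eta>: "0 \<le> \<eta>" "\<eta> \<le> \<eta>0" "\<eta> * C \<le> 1 / 2" and u: "\<forall>l\<le>p + q. \<bar>u l - \<theta> l\<bar> \<le> \<eta> * \<theta> l"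
      and small: "\<eta> * score_bound (past \<epsilon> (int t - 1) \<omega>) \<le> 1 / 4"
    let ?A = "\<bar>linearization_error k u t \<omega>\<bar>"
    let ?B = "K * \<eta>\<^sup>2 * (\<bar>\<epsilon> (int t) \<omega>\<bar> ^ k * (score_bound (past \<epsilon> (int t - 1) \<omega>))\<^sup>2)"
    show "?A \<le> ?B + remainder K k t \<omega>"
    proof (cases "1 / 4 < (b * r) ^ t * tail_bound \<omega>")
      case True
      have "0 \<le> ?B" "0 \<le> K * (\<bar>\<epsilon> (int t) \<omega>\<bar> ^ k * ((b * r) ^ t * tail_bound \<omega>))"
        using K tail_bound_nonneg[OF typical] b r by (auto intro!: mult_nonneg_nonneg)
      then show ?thesis using residual_crude[OF typical \<eta> u, of k t] True by (simp add: remainder_def)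
    next
      case False
      then have "(b * r) ^ t * tail_bound \<omega> \<le> 1 / 4" by simp
      with ex typical \<eta>(1,2) u small have "?A \<le> K * (\<bar>\<epsilon> (int t) \<omega>\<bar> ^ k * (\<eta>\<^sup>2 * (score_bound (past \<epsilon> (int t - 1) \<omega>))\<^sup>2 + (b * r) ^ t * tail_bound \<omega>))"
        by blast
      also have "\<dots> = ?B + remainder K k t \<omega>" using False by (simp add: remainder_def algebra_simps)
      finally show ?thesis .
    qed
  qed
qed

text \<open>The noise grows subexponentially, so the geometric part is summable, and on each path the crude bound is
  used finitely often only. Divided by \<open>sqrt n\<close>, the sum of the remainders therefore vanishes in the limit.\<close>

lemma remainder_summable:
  assumes int: "integrable M (\<lambda>\<omega>. \<bar>\<epsilon> 0 \<omega>\<bar> ^ k)"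
  shows "AE \<omega> in M. summable (\<lambda>t. remainder K k t \<omega>)"
proof -
  define m where "m = (\<integral>\<omega>. \<bar>\<epsilon> 0 \<omega>\<bar> ^ k \<partial>M)"
  have "AE \<omega> in M. \<exists>B\<ge>0. \<forall>i. \<bar>\<epsilon> (int i) \<omega>\<bar> ^ k \<le> B * b ^ i"
  proof (rule AE_geometric_growth[where s = 1 and R = m])
    fix i
    note [measurable] = measurable_coord[of 0]
    have "(\<integral>\<^sup>+\<omega>. ennreal ((\<bar>\<epsilon> t \<omega>\<bar> ^ k) powr 1) \<partial>M) = (\<integral>\<^sup>+e. ennreal (\<bar>e 0\<bar> ^ k) \<partial>past_law)" for t
      using nn_integral_past[of "\<lambda>e. ennreal (\<bar>e 0\<bar> ^ k)" t] by (simp add: past_def)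
    then have "(\<integral>\<^sup>+\<omega>. ennreal ((\<bar>\<epsilon> (int i) \<omega>\<bar> ^ k) powr 1) \<partial>M) = (\<integral>\<^sup>+\<omega>. ennreal ((\<bar>\<epsilon> 0 \<omega>\<bar> ^ k) powr 1) \<partial>M)" by simp
    also have "\<dots> = ennreal m" using nn_integral_eq_integral[OF int] by (simp add: m_def)
    finally show "(\<integral>\<^sup>+\<omega>. ennreal ((\<bar>\<epsilon> (int i) \<omega>\<bar> ^ k) powr 1) \<partial>M) \<le> ennreal m" by simp
  qed (use b in auto)
  with AE_typical show ?thesis
  proof eventually_elim
    case (elim \<omega>)
    obtain B where B: "0 \<le> B" "\<And>i. \<bar>\<epsilon> (int i) \<omega>\<bar> ^ k \<le> B * b ^ i" using elim(2) by blast
    let ?T = "tail_bound \<omega>"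
    have T: "0 \<le> ?T" by (rule tail_bound_nonneg[OF elim(1)])
    have maj: "norm (\<bar>\<epsilon> (int t) \<omega>\<bar> ^ k * ((b * r) ^ t * ?T)) \<le> (B * ?T) * (b * b * r) ^ t" for t
    proof -
      have "\<bar>\<epsilon> (int t) \<omega>\<bar> ^ k * ((b * r) ^ t * ?T) \<le> (B * b ^ t) * ((b * r) ^ t * ?T)"
        using B(2)[of t] b r T by (intro mult_right_mono) auto
      also have "\<dots> = (B * ?T) * (b * b * r) ^ t" by (simp add: power_mult_distrib mult_ac)
      finally show ?thesis using b r T by (simp add: abs_mult)
    qed
    have "summable (\<lambda>t. (B * ?T) * (b * b * r) ^ t)"
      by (intro summable_mult summable_geometric) (use b r b2r in simp)
    then have s1: "summable (\<lambda>t. \<bar>\<epsilon> (int t) \<omega>\<bar> ^ k * ((b * r) ^ t * ?T))"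
      by (rule summable_comparison_test'[where N = 0]) (rule maj)
    have "(\<lambda>t. (b * r) ^ t * ?T) \<longlonglongrightarrow> 0 * ?T"
      using b r br by (intro tendsto_mult tendsto_const LIMSEQ_realpow_zero) auto
    from order_tendstoD(2)[OF this, of "1 / 4"]
    obtain N where N: "\<And>t. N \<le> t \<Longrightarrow> (b * r) ^ t * ?T < 1 / 4" by (auto simp: eventually_sequentially)
    have s2: "summable (\<lambda>t. if 1 / 4 < (b * r) ^ t * ?T then crude k t \<omega> else 0)"
    proof (rule summable_finite[of "{..<N}"])
      fix t assume "t \<notin> {..<N}"
      then have "(b * r) ^ t * ?T < 1 / 4" by (intro N) simp
      then show "(if 1 / 4 < (b * r) ^ t * ?T then crude k t \<omega> else 0) = 0" by simp
    qed simp
    show ?case unfolding remainder_def by (intro summable_add summable_mult s1 s2)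
  qed
qed

end

section \<open>The supremum over the unit interval\<close>

text \<open>On the interval where \<open>\<lfloor>n * u\<rfloor> = j\<close> the function is convex in \<open>u\<close>, so its supremum there is attained or
  approached at the end points. The supremum over all \<open>u\<close> thus is a maximum of finitely many random variables, which
  gives measurability.\<close>

lemma sup_bridge_eq_Max:
  fixes a :: "nat \<Rightarrow> real"
  assumes n: "0 < n" and w: "0 \<le> w"
  defines "f \<equiv> \<lambda>u::real. w * \<bar>a (nat \<lfloor>real n * u\<rfloor>) - u * a n\<bar>"
    and "g \<equiv> \<lambda>j. max (w * \<bar>a j - real j / real n * a n\<bar>) (w * \<bar>a j - real (Suc j) / real n * a n\<bar>)"
  shows "bdd_above (f ` {0..1})" "(SUP u\<in>{0..1}. f u) = Max (g ` {..<n})"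
proof -
  have between: "\<bar>A - W\<bar> \<le> max \<bar>A - L\<bar> \<bar>A - U\<bar>" if "L \<le> W \<and> W \<le> U \<or> U \<le> W \<and> W \<le> L"
    for A W L U :: real
    using that by (auto simp: max_def)
  have le: "f u \<le> Max (g ` {..<n})" if u: "u \<in> {0..1}" for u
  proof (cases "u = 1")
    case True
    have "0 \<le> g 0" using w by (simp add: g_def le_max_iff_disj)
    also have "\<dots> \<le> Max (g ` {..<n})" using n by (intro Max_ge) auto
    finally show ?thesis using True by (simp add: f_def)
  next
    case False
    define j where "j = nat \<lfloor>real n * u\<rfloor>"
    have jl: "real j \<le> real n * u" using u unfolding j_def by (simp add: of_nat_nat)
    have "real j = real_of_int \<lfloor>real n * u\<rfloor>" using u unfolding j_def by (simp add: of_nat_nat)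
    then have ju: "real n * u < real (Suc j)" 
      using floor_correct[of "real n * u"] unfolding of_nat_Suc by linarith
    have "u < 1" using u False by simp
    then have "real n * u < real n" using n by simp
    then have jn: "j < n" using jl by linarith
    have u1: "real j / real n \<le> u" "u \<le> real (Suc j) / real n" using jl ju n by (simp_all add: field_simps)
    have "\<bar>a j - u * a n\<bar> \<le> max \<bar>a j - real j / real n * a n\<bar> \<bar>a j - real (Suc j) / real n * a n\<bar>"
    proof (rule between)
      show "real j / real n * a n \<le> u * a n \<and> u * a n \<le> real (Suc j) / real n * a n \<or>
          real (Suc j) / real n * a n \<le> u * a n \<and> u * a n \<le> real j / real n * a n"
      proof (cases "0 \<le> a n")
        case True
        from mult_right_mono[OF u1(1) this] mult_right_mono[OF u1(2) this] show ?thesis by blast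
      next
        case False
        then have "a n \<le> 0" by simp
        from mult_right_mono_neg[OF u1(1) this] mult_right_mono_neg[OF u1(2) this] show ?thesis by blast
      qed
    qed
    then have "w * \<bar>a j - u * a n\<bar> \<le> w * max \<bar>a j - real j / real n * a n\<bar> \<bar>a j - real (Suc j) / real n * a n\<bar>"
      using w by (rule mult_left_mono)
    also have "\<dots> = g j" using w by (simp add: g_def max_mult_distrib_left)
    also have "\<dots> \<le> Max (g ` {..<n})" using jn by (intro Max_ge) auto
    finally show ?thesis by (simp add: f_def j_def)
  qed
  then show bdd: "bdd_above (f ` {0..1})" by (intro bdd_aboveI[of _ "Max (g ` {..<n})"]) auto
  show "(SUP u\<in>{0..1}. f u) = Max (g ` {..<n})"
  proof (rule antisym)
    show "(SUP u\<in>{0..1}. f u) \<le> Max (g ` {..<n})" by (rule cSUP_least) (use le in auto)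
    have "g j \<le> (SUP u\<in>{0..1}. f u)" if j: "j < n" for j
    proof -
      have floor: "nat \<lfloor>real n * ((real j + x) / real n)\<rfloor> = j" if "0 \<le> x" "x < 1" for x
      proof -
        have "real n * ((real j + x) / real n) = real j + x" using n by simp
        moreover have "\<lfloor>real j + x\<rfloor> = int j" using that by (simp add: floor_unique)
        ultimately show ?thesis by (simp only: nat_int)
      qed
      have in01: "(real j + x) / real n \<in> {0..1}" if "0 \<le> x" "x < 1" for x
        using that j n by (auto simp: field_simps)
      have up: "w * \<bar>a j - (real j + x) / real n * a n\<bar> \<le> (SUP u\<in>{0..1}. f u)" if "0 \<le> x" "x < 1" for x
        using cSUP_upper[OF in01[OF that] bdd] floor[OF that] by (simp add: f_def)
      have left: "w * \<bar>a j - real j / real n * a n\<bar> \<le> (SUP u\<in>{0..1}. f u)" using up[of 0] by simp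
      \<comment> \<open>The right end of the \<open>j\<close>-th step is not attained, but approached from the left.\<close>
      have "(\<lambda>m. w * \<bar>a j - (real j + (1 - 1 / real (Suc m))) / real n * a n\<bar>) \<longlonglongrightarrow>
          w * \<bar>a j - (real j + (1 - 0)) / real n * a n\<bar>"
        by (intro tendsto_intros LIMSEQ_Suc[OF lim_1_over_n]) (use n in auto)
      then have "w * \<bar>a j - (real j + (1 - 0)) / real n * a n\<bar> \<le> (SUP u\<in>{0..1}. f u)"
        by (rule LIMSEQ_le_const2) (intro exI[of _ 0] allI impI up, auto)
      then have "w * \<bar>a j - real (Suc j) / real n * a n\<bar> \<le> (SUP u\<in>{0..1}. f u)" by (simp add: add.commute)
      with left show ?thesis by (simp add: g_def)
    qed
    then show "Max (g ` {..<n}) \<le> (SUP u\<in>{0..1}. f u)" using n by (intro Max.boundedI) auto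
  qed
qed

lemma measurable_garch_c:
  assumes u: "\<And>l. l \<le> p + q \<Longrightarrow> (\<lambda>\<omega>. u \<omega> l) \<in> borel_measurable M"
  shows "(\<lambda>\<omega>. garch_c p q (u \<omega>) i) \<in> borel_measurable M"
proof (induction i rule: less_induct)
  case (less i)
  show ?case
  proof (cases "i = 0")
    case True
    have "(\<lambda>\<omega>. \<Sum>j=1..q. u \<omega> (p + j)) \<in> borel_measurable M"
      by (intro borel_measurable_sum u) auto
    moreover have "(\<lambda>\<omega>. u \<omega> 0) \<in> borel_measurable M" by (rule u) simp
    ultimately show ?thesis unfolding True garch_c_0 by measurable
  next
    case False
    have "(\<lambda>\<omega>. \<Sum>j=1..min (i - 1) q. u \<omega> (p + j) * garch_c p q (u \<omega>) (i - j)) \<in> borel_measurable M"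
      by (intro borel_measurable_sum borel_measurable_times u less) auto
    moreover have "(\<lambda>\<omega>. if i \<le> p then u \<omega> i else 0) \<in> borel_measurable M"
      by (cases "i \<le> p") (auto intro: u)
    ultimately show ?thesis using False by (subst garch_c_pos) (auto intro: borel_measurable_add)
  qed
qed

lemma measurable_residual:
  assumes "\<And>l. l \<le> p + q \<Longrightarrow> (\<lambda>\<omega>. u \<omega> l) \<in> borel_measurable M"
    and [measurable]: "\<And>t. X t \<in> borel_measurable M"
  shows "(\<lambda>\<omega>. residual p q (u \<omega>) (\<lambda>s. X s \<omega>) t) \<in> borel_measurable M"
proof -
  note [measurable] = measurable_garch_c[OF assms(1)]
  show ?thesis unfolding residual_def sigma2_hat_def by measurable
qed

lemma estimator_component_measurable:
  assumes est: "estimator_seq M d X th" and X: "\<And>t. X t \<in> borel_measurable M" and l: "l \<le> d"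
  shows "(\<lambda>\<omega>. th n \<omega> l) \<in> borel_measurable M"
proof -
  obtain g where g: "g \<in> measurable (\<Pi>\<^sub>M i\<in>{..n}. borel) (\<Pi>\<^sub>M i\<in>{..d}. borel)"
    "\<And>\<omega>. \<omega> \<in> space M \<Longrightarrow> th n \<omega> = g (\<lambda>i\<in>{..n}. X (int i) \<omega>)"
    using est unfolding estimator_seq_def by blast
  have "(\<lambda>\<omega>. \<lambda>i\<in>{..n}. X (int i) \<omega>) \<in> measurable M (\<Pi>\<^sub>M i\<in>{..n}. borel)"
    by (intro measurable_restrict X)
  from measurable_compose[OF this g(1)]
  have "(\<lambda>\<omega>. g (\<lambda>i\<in>{..n}. X (int i) \<omega>)) \<in> measurable M (\<Pi>\<^sub>M i\<in>{..d}. borel)" .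
  from measurable_compose[OF this measurable_component_singleton[of l]]
  have "(\<lambda>\<omega>. g (\<lambda>i\<in>{..n}. X (int i) \<omega>) l) \<in> borel_measurable M" using l by simp
  then show ?thesis by (subst measurable_cong) (auto simp: g(2))
qed

context garch_estimates begin

section \<open>Partial sums of the powers of the residuals\<close>

text \<open>Transfers properties of typical paths, which are formulated on the original probability space, to the
  law of the noise sequence.\<close>

lemma AE_past_law_of_typical:
  assumes P: "Measurable.pred seq_borel P" and "\<And>\<omega>. typical \<omega> \<Longrightarrow> P (past \<epsilon> (0 - 1) \<omega>)"
  shows "AE e in past_law. P e"
proof -
  have "AE \<omega> in M. P (past \<epsilon> (0 - 1) \<omega>)" by (rule eventually_mono[OF AE_typical assms(2)])
  then show ?thesis by (simp only: AE_past[OF P, of "0 - 1"])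
qed

lemma AE_score_bound_ge_1: "AE e in past_law. 1 \<le> score_bound e"
proof (rule AE_past_law_of_typical)
  show "Measurable.pred seq_borel (\<lambda>e. 1 \<le> score_bound e)" by measurable
qed (rule score_bound_ge_1)

lemma AE_score_nonneg:
  assumes "l \<le> p + q"
  shows "AE e in past_law. 0 \<le> score l e"
proof (rule AE_past_law_of_typical)
  show "Measurable.pred seq_borel (\<lambda>e. 0 \<le> score l e)" by measurable
qed (rule score_nonneg[OF _ assms])

lemma AE_score_le:
  assumes "l \<le> p + q"
  shows "AE e in past_law. \<theta> l * score l e \<le> score_bound e"
proof (rule AE_past_law_of_typical)
  have "(\<lambda>e. \<theta> l * score l e) \<in> borel_measurable seq_borel"
    by (intro borel_measurable_times borel_measurable_const measurable_score)
  from borel_measurable_le[OF this measurable_score_bound]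
  show "Measurable.pred seq_borel (\<lambda>e. \<theta> l * score l e \<le> score_bound e)"
    by (simp add: pred_def)
qed (rule score_le[OF _ assms])

lemma integrable_score_bound4: "integrable past_law (\<lambda>e. score_bound e ^ 4)"
proof (rule integrableI_bounded)
  have "(\<integral>\<^sup>+e. ennreal (norm (score_bound e ^ 4)) \<partial>past_law) = (\<integral>\<^sup>+e. ennreal (score_bound e ^ 4) \<partial>past_law)"
    by simp
  then show "(\<integral>\<^sup>+e. ennreal (norm (score_bound e ^ 4)) \<partial>past_law) < \<infinity>" using score_bound_moment by simp
qed measurable

lemma integrable_score_bound2: "integrable past_law (\<lambda>e. (score_bound e)\<^sup>2)"
proof (rule Bochner_Integration.integrable_bound[OF integrable_score_bound4])
  show "AE e in past_law. norm ((score_bound e)\<^sup>2) \<le> norm (score_bound e ^ 4)"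
    by (rule eventually_mono[OF AE_score_bound_ge_1]) (auto intro: power_increasing)
qed measurable

lemma integrable_score: "l \<le> p + q \<Longrightarrow> integrable past_law (score l)"
proof (rule Bochner_Integration.integrable_bound[of _ "\<lambda>e. 1 / \<theta> l * score_bound e ^ 4"])
  assume l: "l \<le> p + q"
  show "integrable past_law (\<lambda>e. 1 / \<theta> l * score_bound e ^ 4)"
    by (intro integrable_mult_right integrable_score_bound4)
  show "AE e in past_law. norm (score l e) \<le> norm (1 / \<theta> l * score_bound e ^ 4)"
    using AE_score_bound_ge_1 AE_score_nonneg[OF l] AE_score_le[OF l]
  proof eventually_elim
    case (elim e)
    have "score l e \<le> 1 / \<theta> l * score_bound e" using elim pos[OF l] by (simp add: field_simps)
    also have "\<dots> \<le> 1 / \<theta> l * score_bound e ^ 4"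
      using elim pos[OF l] power_increasing[of 1 4 "score_bound e"] by (intro mult_left_mono) auto
    finally show ?case using elim pos[OF l] by simp
  qed
qed measurable

definition noise_score :: "nat \<Rightarrow> nat \<Rightarrow> (nat \<Rightarrow> real) \<Rightarrow> real" where
  "noise_score k l e = e 0 ^ k * score l (tail_from 1 e)"

definition noise_bound :: "nat \<Rightarrow> (nat \<Rightarrow> real) \<Rightarrow> real" where
  "noise_bound k e = \<bar>e 0\<bar> ^ k * (score_bound (tail_from 1 e))\<^sup>2"

lemma noise_score_past: "noise_score k l (past \<epsilon> t \<omega>) = \<epsilon> t \<omega> ^ k * score l (past \<epsilon> (t - 1) \<omega>)"
  by (simp add: noise_score_def tail_from_past) (simp add: past_def)

lemma noise_bound_past: "noise_bound k (past \<epsilon> t \<omega>) = \<bar>\<epsilon> t \<omega>\<bar> ^ k * (score_bound (past \<epsilon> (t - 1) \<omega>))\<^sup>2"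
  by (simp add: noise_bound_def tail_from_past) (simp add: past_def)

lemma integrable_noise_power:
  assumes int: "integrable M (\<lambda>\<omega>. \<bar>\<epsilon> 0 \<omega>\<bar> ^ k)"
  shows "integrable past_law (\<lambda>e. e 0 ^ k)" "integrable past_law (\<lambda>e. \<bar>e 0\<bar> ^ k)"
proof -
  note [measurable] = measurable_coord[of 0]
  have "(\<integral>\<^sup>+e. ennreal (\<bar>e 0\<bar> ^ k) \<partial>past_law) = (\<integral>\<^sup>+\<omega>. ennreal (\<bar>\<epsilon> 0 \<omega>\<bar> ^ k) \<partial>M)"
    using nn_integral_past[of "\<lambda>e. ennreal (\<bar>e 0\<bar> ^ k)" 0] by (simp add: past_def)
  also have "\<dots> < \<infinity>" using nn_integral_eq_integral[OF int] by simp
  finally show "integrable past_law (\<lambda>e. e 0 ^ k)" "integrable past_law (\<lambda>e. \<bar>e 0\<bar> ^ k)"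
    by (auto intro!: integrableI_bounded simp: power_abs)
qed

lemma integrable_noise_score:
  assumes "integrable M (\<lambda>\<omega>. \<bar>\<epsilon> 0 \<omega>\<bar> ^ k)" "l \<le> p + q"
  shows "integrable past_law (noise_score k l)"
  unfolding noise_score_def[abs_def]
  by (rule integrable_head_tail[OF integrable_noise_power(1) integrable_score])
     (use assms in \<open>auto simp: depends_on_first_def\<close>)

lemma integrable_noise_bound:
  assumes "integrable M (\<lambda>\<omega>. \<bar>\<epsilon> 0 \<omega>\<bar> ^ k)"
  shows "integrable past_law (noise_bound k)"
  unfolding noise_bound_def[abs_def]
  by (rule integrable_head_tail[OF integrable_noise_power(2) integrable_score_bound2])
     (use assms in \<open>auto simp: depends_on_first_def\<close>)

lemma noise_bound_nonneg: "0 \<le> noise_bound k e"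
  by (simp add: noise_bound_def)

text \<open>The deterministic core. The increments \<open>x t\<close> are \<open>- k / 2\<close> times a combination of the \<open>z l t\<close> with
  coefficients \<open>h l\<close> that do not depend on \<open>t\<close>, up to errors \<open>A t\<close>. If the partial sums of each \<open>z l\<close> are
  linear up to \<open>D\<close>, the bridge cancels the linear parts and retains at most \<open>2 D + \<bar>\<mu> l\<bar>\<close>, the last
  summand being due to rounding \<open>n * u\<close> down to an integer.\<close>

lemma bridge_bound:
  fixes a :: "nat \<Rightarrow> real"
  assumes n: "0 < n" and u: "0 \<le> u" "u \<le> 1" and h: "\<And>l. l \<le> p + q \<Longrightarrow> \<bar>h l\<bar> \<le> H" "0 \<le> H"
    and a: "\<And>j. a j = (\<Sum>t=1..j. x t)"
    and x: "\<And>t. t \<in> {1..n} \<Longrightarrow> \<bar>x t + real k / 2 * (\<Sum>l\<le>p + q. h l * z l t)\<bar> \<le> A t"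
    and z: "\<And>l j. l \<le> p + q \<Longrightarrow> j \<le> n \<Longrightarrow> \<bar>(\<Sum>t=1..j. z l t) - real j * \<mu> l\<bar> \<le> D"
  shows "\<bar>a (nat \<lfloor>real n * u\<rfloor>) - u * a n\<bar> \<le> 2 * (\<Sum>t=1..n. A t) + real k / 2 * H * (\<Sum>l\<le>p + q. 2 * D + \<bar>\<mu> l\<bar>)"
proof -
  define j where "j = nat \<lfloor>real n * u\<rfloor>"
  have jl: "real j \<le> real n * u" using u unfolding j_def by (simp add: of_nat_nat)
  have "real j = real_of_int \<lfloor>real n * u\<rfloor>" using u unfolding j_def by (simp add: of_nat_nat)
  then have ju: "real n * u < real (Suc j)" 
      using floor_correct[of "real n * u"] unfolding of_nat_Suc by linarith
  have "real n * u \<le> real n" using u n by (simp add: mult_left_le)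
  then have jn: "j \<le> n" using jl by linarith
  define y where "y t = x t + real k / 2 * (\<Sum>l\<le>p + q. h l * z l t)" for t
  define Z where "Z l = (\<Sum>t=1..j. z l t) - u * (\<Sum>t=1..n. z l t)" for l
  have A_nn: "0 \<le> A t" if "t \<in> {1..n}" for t using x[OF that] by linarith
  have part: "(\<Sum>t=1..m. x t) = (\<Sum>t=1..m. y t) - real k / 2 * (\<Sum>l\<le>p + q. h l * (\<Sum>t=1..m. z l t))" for m
  proof -
    have "(\<Sum>t=1..m. y t) = (\<Sum>t=1..m. x t) + real k / 2 * (\<Sum>t=1..m. \<Sum>l\<le>p + q. h l * z l t)"
      by (simp add: y_def sum.distrib sum_distrib_left)
    also have "(\<Sum>t=1..m. \<Sum>l\<le>p + q. h l * z l t) = (\<Sum>l\<le>p + q. h l * (\<Sum>t=1..m. z l t))"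
      by (subst sum.swap) (simp add: sum_distrib_left)
    finally show ?thesis by simp
  qed
  have y_le: "\<bar>\<Sum>t=1..m. y t\<bar> \<le> (\<Sum>t=1..n. A t)" if "m \<le> n" for m
  proof -
    have "\<bar>\<Sum>t=1..m. y t\<bar> \<le> (\<Sum>t=1..m. A t)"
      using x that unfolding y_def by (intro order_trans[OF sum_abs] sum_mono) auto
    also have "\<dots> \<le> (\<Sum>t=1..n. A t)" using that A_nn by (intro sum_mono2) auto
    finally show ?thesis .
  qed
  have uy: "\<bar>u * (\<Sum>t=1..n. y t)\<bar> \<le> (\<Sum>t=1..n. A t)"
  proof -
    have "\<bar>u * (\<Sum>t=1..n. y t)\<bar> \<le> 1 * \<bar>\<Sum>t=1..n. y t\<bar>"
      unfolding abs_mult using u by (intro mult_right_mono) auto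
    then show ?thesis using y_le[of n] by simp
  qed
  have Z_le: "\<bar>Z l\<bar> \<le> 2 * D + \<bar>\<mu> l\<bar>" if l: "l \<le> p + q" for l
  proof -
    have 1: "\<bar>(\<Sum>t=1..j. z l t) - real j * \<mu> l\<bar> \<le> D" by (rule z[OF l jn])
    have "\<bar>u * ((\<Sum>t=1..n. z l t) - real n * \<mu> l)\<bar> \<le> 1 * D"
      unfolding abs_mult using u z[OF l order_refl] by (intro mult_mono) auto
    then have 2: "\<bar>u * (\<Sum>t=1..n. z l t) - real n * u * \<mu> l\<bar> \<le> D" by (simp add: algebra_simps)
    have "\<bar>(real j - real n * u) * \<mu> l\<bar> \<le> 1 * \<bar>\<mu> l\<bar>"
      unfolding abs_mult using jl ju by (intro mult_right_mono) auto
    then have 3: "\<bar>real j * \<mu> l - real n * u * \<mu> l\<bar> \<le> \<bar>\<mu> l\<bar>" by (simp add: algebra_simps)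
    show ?thesis using 1 2 3 unfolding Z_def by linarith
  qed
  have "\<bar>\<Sum>l\<le>p + q. h l * Z l\<bar> \<le> (\<Sum>l\<le>p + q. H * (2 * D + \<bar>\<mu> l\<bar>))"
    by (intro order_trans[OF sum_abs] sum_mono) (use h Z_le in \<open>auto simp: abs_mult intro!: mult_mono\<close>)
  then have hZ: "\<bar>\<Sum>l\<le>p + q. h l * Z l\<bar> \<le> H * (\<Sum>l\<le>p + q. 2 * D + \<bar>\<mu> l\<bar>)" by (simp only: sum_distrib_left)
  have hZ_eq: "(\<Sum>l\<le>p + q. h l * Z l) = (\<Sum>l\<le>p + q. h l * (\<Sum>t=1..j. z l t)) - u * (\<Sum>l\<le>p + q. h l * (\<Sum>t=1..n. z l t))"
    by (simp add: Z_def right_diff_distrib sum_subtractf sum_distrib_left mult_ac)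
  have "a j - u * a n = (\<Sum>t=1..j. y t) - u * (\<Sum>t=1..n. y t) - real k / 2 * (\<Sum>l\<le>p + q. h l * Z l)"
    unfolding a part hZ_eq by (simp add: algebra_simps)
  moreover have "\<bar>real k / 2 * (\<Sum>l\<le>p + q. h l * Z l)\<bar> \<le> real k / 2 * (H * (\<Sum>l\<le>p + q. 2 * D + \<bar>\<mu> l\<bar>))"
    unfolding abs_mult using hZ by (intro mult_mono) auto
  ultimately show ?thesis using y_le[OF jn] uy unfolding j_def[symmetric] mult.assoc by linarith
qed

lemma parameter_lower_bound: "\<exists>m>0. \<forall>l\<le>p + q. m \<le> \<theta> l"
  using pos by (intro exI[of _ "Min (\<theta> ` {..p + q})"]) (auto simp: Min_gr_iff)

text \<open>The estimation error is at most \<open>\<eta> = O(n\<^bsup>-1/2\<^esup>)\<close> relative to each coordinate, outside an event of small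
  probability. Divided by \<open>sqrt n\<close>, the bound of \<open>bridge_bound\<close> has three parts. The linear part is \<open>h l * sqrt n\<close>, which is
  bounded, times a deviation from linearity of order \<open>o(n) / n\<close>. The second-order part is a constant times
  \<open>n\<^bsup>-3/2\<^esup>\<close> times a sum of \<open>n\<close> terms with bounded expectations. The remainders have a finite sum. The expansion
  requires \<open>\<eta> * score_bound \<le> 1 / 4\<close> at all times up to \<open>n\<close>; by the fourth moment of the score bound this
  fails with probability \<open>O(1 / n)\<close>.\<close>

lemma bridge_difference_tendsto:
  fixes th :: "nat \<Rightarrow> 'a \<Rightarrow> nat \<Rightarrow> real" and Q :: "nat \<Rightarrow> 'a \<Rightarrow> real"
  assumes int: "integrable M (\<lambda>\<omega>. \<bar>\<epsilon> 0 \<omega>\<bar> ^ k)"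
    and op: "big_OP_1 M (\<lambda>n \<omega>. sqrt (real n) * maxnorm (p + q) (\<lambda>i. th n \<omega> i - \<theta> i))"
    and [measurable]: "\<And>n. Q n \<in> borel_measurable M"
    and Q: "\<And>n \<omega> B. 0 < n \<Longrightarrow> (\<And>u. 0 \<le> u \<Longrightarrow> u \<le> 1 \<Longrightarrow>
      1 / sqrt (real n) * \<bar>(\<Sum>t=1..nat \<lfloor>real n * u\<rfloor>. residual p q (th n \<omega>) (\<lambda>s. X s \<omega>) t ^ k - \<epsilon> (int t) \<omega> ^ k) -
        u * (\<Sum>t=1..n. residual p q (th n \<omega>) (\<lambda>s. X s \<omega>) t ^ k - \<epsilon> (int t) \<omega> ^ k)\<bar> \<le> B) \<Longrightarrow> \<bar>Q n \<omega>\<bar> \<le> B"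
    and \<delta>: "0 < \<delta>"
  shows "(\<lambda>n. prob {\<omega>\<in>space M. \<delta> < \<bar>Q n \<omega>\<bar>}) \<longlonglongrightarrow> 0"
proof (rule LIMSEQ_I)
  fix \<kappa> :: real assume \<kappa>: "0 < \<kappa>"
  define H where "H n \<omega> = sqrt (real n) * maxnorm (p + q) (\<lambda>i. th n \<omega> i - \<theta> i)" for n \<omega>
  have [measurable]: "H n \<in> borel_measurable M" for n using op by (simp add: big_OP_1_def H_def[abs_def])
  obtain L0 where "eventually (\<lambda>n. prob {\<omega>\<in>space M. L0 < \<bar>H n \<omega>\<bar>} \<le> \<kappa> / 4) sequentially"
    using op \<kappa> unfolding big_OP_1_def H_def by (meson zero_less_divide_iff zero_less_numeral)
  note L0 = this
  define L where "L = max 1 L0"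
  have L: "1 \<le> L" by (simp add: L_def)
  have ev1: "eventually (\<lambda>n. prob {\<omega>\<in>space M. L < \<bar>H n \<omega>\<bar>} \<le> \<kappa> / 4) sequentially"
    using L0
  proof eventually_elim
    case (elim n)
    have "prob {\<omega>\<in>space M. L < \<bar>H n \<omega>\<bar>} \<le> prob {\<omega>\<in>space M. L0 < \<bar>H n \<omega>\<bar>}"
      by (intro finite_measure_mono) (auto simp: L_def)
    with elim show ?case by linarith
  qed
  obtain m where m: "0 < m" "\<And>l. l \<le> p + q \<Longrightarrow> m \<le> \<theta> l" using parameter_lower_bound by blast
  define \<eta> where "\<eta> n = L / (m * sqrt (real n))" for n
  have \<eta>_nn: "0 \<le> \<eta> n" for n using L m by (simp add: \<eta>_def)
  have \<eta>_sq: "(\<eta> n)\<^sup>2 = (L / m)\<^sup>2 / real n" for n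
    by (simp add: \<eta>_def power_divide power_mult_distrib)
  have sqrt_inf: "filterlim (\<lambda>n. sqrt (real n)) at_top sequentially"
    by (rule filterlim_compose[OF sqrt_at_top filterlim_real_sequentially])
  have inv_sqrt: "(\<lambda>n. 1 / sqrt (real n)) \<longlonglongrightarrow> 0"
    using tendsto_inverse_0_at_top[OF sqrt_inf] by (simp add: inverse_eq_divide)
  have \<eta>_lim: "\<eta> \<longlonglongrightarrow> 0"
    using tendsto_mult_right_zero[OF inv_sqrt, of "L / m"] by (simp add: \<eta>_def[abs_def])
  obtain K where K: "0 \<le> K" and ex: "\<forall>\<omega> t \<eta> u. typical \<omega> \<longrightarrow> 0 \<le> \<eta> \<longrightarrow> \<eta> \<le> \<eta>0 \<longrightarrow> \<eta> * C \<le> 1 / 2 \<longrightarrow>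
    (\<forall>l\<le>p + q. \<bar>u l - \<theta> l\<bar> \<le> \<eta> * \<theta> l) \<longrightarrow> \<eta> * score_bound (past \<epsilon> (int t - 1) \<omega>) \<le> 1 / 4 \<longrightarrow>
    \<bar>linearization_error k u t \<omega>\<bar>
    \<le> K * \<eta>\<^sup>2 * (\<bar>\<epsilon> (int t) \<omega>\<bar> ^ k * (score_bound (past \<epsilon> (int t - 1) \<omega>))\<^sup>2) + remainder K k t \<omega>"
    using residual_power_expansion[of k] by blast
  define \<mu> where "\<mu> l = (\<integral>e. noise_score k l e \<partial>past_law)" for l
  define E2 where "E2 = (\<integral>e. noise_bound k e \<partial>past_law)"
  define E4 where "E4 = (\<integral>e. score_bound e ^ 4 \<partial>past_law)"
  define S2 where "S2 n \<omega> = (\<Sum>t=1..n. noise_bound k (past \<epsilon> (int t) \<omega>))" for n \<omega>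
  define Rem where "Rem \<omega> = (\<Sum>t. remainder K k t \<omega>)" for \<omega>
  have nb_meas [measurable]: "noise_bound k \<in> borel_measurable seq_borel"
    and ns_meas [measurable]: "noise_score k l \<in> borel_measurable seq_borel" for l
  proof -
    note [measurable] = measurable_coord[of 0]
    show "noise_bound k \<in> borel_measurable seq_borel" "noise_score k l \<in> borel_measurable seq_borel"
      unfolding noise_bound_def noise_score_def by measurable
  qed
  have [measurable]: "S2 n \<in> borel_measurable M" for n unfolding S2_def by measurable
  have [measurable]: "Rem \<in> borel_measurable M" unfolding Rem_def by measurable
  define \<delta>' where "\<delta>' = \<delta> / (4 * (real k * L * real (p + q + 1) + 1))"
  have kL: "0 \<le> real k * L * real (p + q + 1)" using L by simp
  have \<delta>': "0 < \<delta>'" using \<delta> kL by (simp add: \<delta>'_def add_nonneg_pos)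
  have \<delta>'_le: "real k * L * real (p + q + 1) * \<delta>' \<le> \<delta> / 4"
  proof -
    have "real k * L * real (p + q + 1) * \<delta>' \<le> (real k * L * real (p + q + 1) + 1) * \<delta>'"
      using \<delta>' by (intro mult_right_mono) auto
    also have "\<dots> = \<delta> / 4" using kL by (simp add: \<delta>'_def field_simps)
    finally show ?thesis .
  qed
  \<comment> \<open>In this order: the estimator is not \<open>sqrt n\<close>-close, the score bound is too large at some time, the law of large numbers fails, the second-order part is too large, the remainders are too large.\<close>
  let ?B1 = "\<lambda>n. {\<omega>\<in>space M. L < \<bar>H n \<omega>\<bar>}"
  let ?B2 = "\<lambda>n. \<Union>t\<in>{1..n}. {\<omega>\<in>space M. (1 / (4 * \<eta> n)) ^ 4 < score_bound (past \<epsilon> (int t - 1) \<omega>) ^ 4}"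
  let ?B3 = "\<lambda>n. \<Union>l\<in>{..p + q}. {\<omega>\<in>space M. \<exists>j\<le>n.
    \<delta>' * real n < \<bar>(\<Sum>t=1..j. noise_score k l (past \<epsilon> (int t) \<omega>)) - real j * \<mu> l\<bar>}"
  let ?B4 = "\<lambda>n. {\<omega>\<in>space M. \<delta> / 4 < 2 * K * (\<eta> n)\<^sup>2 / sqrt (real n) * S2 n \<omega>}"
  let ?B5 = "\<lambda>n. {\<omega>\<in>space M. \<delta> / 8 * sqrt (real n) < Rem \<omega>}"
  have lim2: "(\<lambda>n. prob (?B2 n)) \<longlonglongrightarrow> 0"
  proof (rule tendsto_sandwich[where f = "\<lambda>_. 0"])
    show "(\<lambda>n. (4 * L / m) ^ 4 * E4 * (1 / real n)) \<longlonglongrightarrow> 0"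
      by (intro tendsto_mult_right_zero lim_1_over_n)
    show "eventually (\<lambda>n. prob (?B2 n) \<le> (4 * L / m) ^ 4 * E4 * (1 / real n)) sequentially"
      using eventually_gt_at_top[of 0]
    proof eventually_elim
      case (elim n)
      have \<eta>p: "0 < \<eta> n" using L m elim by (simp add: \<eta>_def)
      have eta4: "(4 * \<eta> n) ^ 4 = (4 * L / m) ^ 4 / (real n)\<^sup>2"
      proof -
        have "(4 * \<eta> n) ^ 4 = 4 ^ 4 * ((\<eta> n)\<^sup>2)\<^sup>2" by (simp add: power_mult_distrib power_mult[symmetric])
        then show ?thesis unfolding \<eta>_sq by (simp add: power_divide power_mult_distrib power_mult[symmetric])
      qed
      have "prob (?B2 n) \<le> (\<Sum>t\<in>{1..n}. prob {\<omega>\<in>space M. (1 / (4 * \<eta> n)) ^ 4 < score_bound (past \<epsilon> (int t - 1) \<omega>) ^ 4})"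
        by (intro finite_measure_subadditive_finite) auto
      also have "\<dots> \<le> (\<Sum>t\<in>{1..n}. E4 / (1 / (4 * \<eta> n)) ^ 4)"
      proof (intro sum_mono)
        fix t
        have "prob {\<omega>\<in>space M. (1 / (4 * \<eta> n)) ^ 4 < score_bound (past \<epsilon> (int t - 1) \<omega>) ^ 4} \<le>
            expectation (\<lambda>\<omega>. score_bound (past \<epsilon> (int t - 1) \<omega>) ^ 4) / (1 / (4 * \<eta> n)) ^ 4"
          using \<eta>p by (intro prob_gt_le_expectation integrable_past[OF integrable_score_bound4]) auto
        also have "expectation (\<lambda>\<omega>. score_bound (past \<epsilon> (int t - 1) \<omega>) ^ 4) = E4"
          unfolding E4_def by (rule integral_past[where F = "\<lambda>e. score_bound e ^ 4"]) measurable
        finally show "prob {\<omega>\<in>space M. (1 / (4 * \<eta> n)) ^ 4 < score_bound (past \<epsilon> (int t - 1) \<omega>) ^ 4} \<le> E4 / (1 / (4 * \<eta> n)) ^ 4" .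
      qed
      also have "\<dots> = real n * (E4 * (4 * \<eta> n) ^ 4)" by (simp add: power_divide)
      also have "\<dots> = (4 * L / m) ^ 4 * E4 * (1 / real n)"
        unfolding eta4 using elim by (simp add: power2_eq_square)
      finally show ?case .
    qed
  qed (auto intro!: always_eventually)
  have lim3: "(\<lambda>n. prob (?B3 n)) \<longlonglongrightarrow> 0"
  proof (rule tendsto_sandwich[where f = "\<lambda>_. 0"])
    show "(\<lambda>n. \<Sum>l\<in>{..p + q}. prob {\<omega>\<in>space M. \<exists>j\<le>n.
      \<delta>' * real n < \<bar>(\<Sum>t=1..j. noise_score k l (past \<epsilon> (int t) \<omega>)) - real j * \<mu> l\<bar>}) \<longlonglongrightarrow> 0"
      unfolding \<mu>_def by (intro tendsto_null_sum weak_law_uniform integrable_noise_score int \<delta>') auto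
    show "eventually (\<lambda>n. prob (?B3 n) \<le> (\<Sum>l\<in>{..p + q}. prob {\<omega>\<in>space M. \<exists>j\<le>n.
      \<delta>' * real n < \<bar>(\<Sum>t=1..j. noise_score k l (past \<epsilon> (int t) \<omega>)) - real j * \<mu> l\<bar>})) sequentially"
      by (intro always_eventually allI finite_measure_subadditive_finite) auto
  qed (auto intro!: always_eventually)
  have lim4: "(\<lambda>n. prob (?B4 n)) \<longlonglongrightarrow> 0"
  proof (rule tendsto_sandwich[where f = "\<lambda>_. 0"])
    show "(\<lambda>n. 8 * K * (L / m)\<^sup>2 * E2 / \<delta> * (1 / sqrt (real n))) \<longlonglongrightarrow> 0"
      by (intro tendsto_mult_right_zero inv_sqrt)
    show "eventually (\<lambda>n. prob (?B4 n) \<le> 8 * K * (L / m)\<^sup>2 * E2 / \<delta> * (1 / sqrt (real n))) sequentially"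
      using eventually_gt_at_top[of 0]
    proof eventually_elim
      case (elim n)
      let ?w = "2 * K * (\<eta> n)\<^sup>2 / sqrt (real n)"
      have w: "0 \<le> ?w" using K by simp
      have i: "integrable M (\<lambda>\<omega>. noise_bound k (past \<epsilon> (int t) \<omega>))" for t
        by (rule integrable_past[OF integrable_noise_bound[OF int]])
      have iS: "integrable M (S2 n)" unfolding S2_def[abs_def] by (intro Bochner_Integration.integrable_sum i)
      have ES: "expectation (S2 n) = real n * E2"
      proof -
        have "expectation (S2 n) = (\<Sum>t=1..n. expectation (\<lambda>\<omega>. noise_bound k (past \<epsilon> (int t) \<omega>)))"
          unfolding S2_def[abs_def] by (intro Bochner_Integration.integral_sum i)
        also have "\<dots> = (\<Sum>t=1..n. E2)"
          unfolding E2_def by (intro sum.cong refl integral_past) measurable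
        finally show ?thesis by simp
      qed
      have "prob (?B4 n) \<le> expectation (\<lambda>\<omega>. ?w * S2 n \<omega>) / (\<delta> / 4)"
      proof (rule prob_gt_le_expectation)
        show "integrable M (\<lambda>\<omega>. ?w * S2 n \<omega>)" by (intro integrable_mult_right iS)
        show "0 \<le> ?w * S2 n \<omega>" for \<omega>
          unfolding S2_def by (intro mult_nonneg_nonneg w sum_nonneg noise_bound_nonneg)
      qed (use \<delta> in simp)
      also have "expectation (\<lambda>\<omega>. ?w * S2 n \<omega>) = ?w * (real n * E2)" by (simp add: ES)
      also have "?w * (real n * E2) / (\<delta> / 4) = 8 * K * (L / m)\<^sup>2 * E2 / \<delta> * (1 / sqrt (real n))"
        unfolding \<eta>_sq using elim \<delta> by (simp add: field_simps)
      finally show ?case .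
    qed
  qed (auto intro!: always_eventually)
  have ev5: "eventually (\<lambda>n. prob (?B5 n) < \<kappa> / 8) sequentially"
  proof -
    obtain S where S: "0 \<le> S" "prob {\<omega>\<in>space M. S < Rem \<omega>} < \<kappa> / 8" using tight[of Rem "\<kappa> / 8"] \<kappa> by auto
    have "eventually (\<lambda>n. 8 * S / \<delta> \<le> sqrt (real n)) sequentially"
      using sqrt_inf by (simp add: filterlim_at_top)
    then show ?thesis
    proof eventually_elim
      case (elim n)
      then have "S \<le> \<delta> / 8 * sqrt (real n)" using \<delta> by (simp add: field_simps)
      then have "prob (?B5 n) \<le> prob {\<omega>\<in>space M. S < Rem \<omega>}" by (intro finite_measure_mono) auto
      with S show ?case by linarith
    qed
  qed
  have ev_m: "eventually (\<lambda>n. real k * L / 2 * (\<Sum>l\<le>p + q. \<bar>\<mu> l\<bar>) * (1 / real n) < \<delta> / 4) sequentially"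
    using order_tendstoD(2)[OF tendsto_mult_right_zero[OF lim_1_over_n[where 'a = real]], of "\<delta> / 4" "real k * L / 2 * (\<Sum>l\<le>p + q. \<bar>\<mu> l\<bar>)"] \<delta>
    by simp
  have ev_eta: "eventually (\<lambda>n. \<eta> n < min \<eta>0 (1 / (2 * C))) sequentially"
    using \<eta>0 C by (intro order_tendstoD(2)[OF \<eta>_lim]) auto
  have ev_sub: "eventually (\<lambda>n. AE \<omega> in M. \<delta> < \<bar>Q n \<omega>\<bar> \<longrightarrow> \<omega> \<in> ?B1 n \<union> (?B2 n \<union> (?B3 n \<union> (?B4 n \<union> ?B5 n)))) sequentially"
    using ev_m ev_eta eventually_gt_at_top[of 0]
  proof eventually_elim
    case (elim n)
    have n: "0 < n" and en: "\<eta> n \<le> \<eta>0" "\<eta> n * C \<le> 1 / 2" using elim C by (auto simp: field_simps)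
    have sn: "0 < sqrt (real n)" using n by simp
    have \<eta>p: "0 < \<eta> n" using L m n by (simp add: \<eta>_def)
    from AE_typical remainder_summable[OF int, of K] AE_space show ?case
    proof eventually_elim
      case (elim \<omega>)
      note typical = elim(1)
      show ?case
      proof (rule impI, rule ccontr)
        assume big: "\<delta> < \<bar>Q n \<omega>\<bar>" and notin: "\<omega> \<notin> ?B1 n \<union> (?B2 n \<union> (?B3 n \<union> (?B4 n \<union> ?B5 n)))"
        have n1: "\<bar>H n \<omega>\<bar> \<le> L" using notin elim(3) by (simp add: not_less)
        have n2: "score_bound (past \<epsilon> (int t - 1) \<omega>) ^ 4 \<le> (1 / (4 * \<eta> n)) ^ 4" if "t \<in> {1..n}" for t
          using notin elim(3) that by (auto simp: not_less)
        have n3: "\<bar>(\<Sum>t=1..j. noise_score k l (past \<epsilon> (int t) \<omega>)) - real j * \<mu> l\<bar> \<le> \<delta>' * real n"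
          if "l \<le> p + q" "j \<le> n" for l j
          using notin elim(3) that by (auto simp: not_less)
        have n4: "2 * K * (\<eta> n)\<^sup>2 / sqrt (real n) * S2 n \<omega> \<le> \<delta> / 4" using notin elim(3) by (simp add: not_less)
        have n5: "Rem \<omega> \<le> \<delta> / 8 * sqrt (real n)" using notin elim(3) by (simp add: not_less)
        define h where "h l = th n \<omega> l - \<theta> l" for l
        have h_le: "\<bar>h l\<bar> \<le> L / sqrt (real n)" if "l \<le> p + q" for l
        proof -
          have "\<bar>h l\<bar> \<le> maxnorm (p + q) (\<lambda>i. th n \<omega> i - \<theta> i)"
            unfolding maxnorm_def h_def using that by (intro Max_ge) auto
          then have "sqrt (real n) * \<bar>h l\<bar> \<le> H n \<omega>" unfolding H_def using sn by (intro mult_left_mono) auto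
          also have "\<dots> \<le> L" using n1 by linarith
          finally show ?thesis using sn by (simp add: field_simps)
        qed
        have u: "\<forall>l\<le>p + q. \<bar>th n \<omega> l - \<theta> l\<bar> \<le> \<eta> n * \<theta> l"
        proof (intro allI impI)
          fix l assume l: "l \<le> p + q"
          have "\<bar>h l\<bar> \<le> L / sqrt (real n)" by (rule h_le[OF l])
          also have "\<dots> = \<eta> n * m" using m by (simp add: \<eta>_def)
          also have "\<dots> \<le> \<eta> n * \<theta> l" by (intro mult_left_mono m(2)[OF l] \<eta>_nn)
          finally show "\<bar>th n \<omega> l - \<theta> l\<bar> \<le> \<eta> n * \<theta> l" by (simp add: h_def)
        qed
        have small: "\<eta> n * score_bound (past \<epsilon> (int t - 1) \<omega>) \<le> 1 / 4" if t: "t \<in> {1..n}" for t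
        proof -
          have "score_bound (past \<epsilon> (int t - 1) \<omega>) \<le> 1 / (4 * \<eta> n)"
            by (rule power_le_imp_le_base[of _ 3]) (use n2[OF t] \<eta>p in \<open>simp_all add: numeral_eq_Suc\<close>)
          then show ?thesis using \<eta>p by (simp add: field_simps)
        qed
        define A where "A t = K * (\<eta> n)\<^sup>2 * noise_bound k (past \<epsilon> (int t) \<omega>) + remainder K k t \<omega>" for t
        have sumA: "(\<Sum>t=1..n. A t) \<le> K * (\<eta> n)\<^sup>2 * S2 n \<omega> + Rem \<omega>"
        proof -
          have "(\<Sum>t=1..n. remainder K k t \<omega>) \<le> Rem \<omega>"
            unfolding Rem_def by (intro sum_le_suminf elim(2)) (auto intro: remainder_nonneg[OF typical K])
          then show ?thesis by (simp add: A_def sum.distrib S2_def sum_distrib_left)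
        qed
        have "\<bar>Q n \<omega>\<bar> \<le> \<delta>"
        proof (rule Q[OF n])
          fix v :: real assume v: "0 \<le> v" "v \<le> 1"
          let ?x = "\<lambda>t. residual p q (th n \<omega>) (\<lambda>s. X s \<omega>) t ^ k - \<epsilon> (int t) \<omega> ^ k"
          have "\<bar>(\<lambda>j. \<Sum>t=1..j. ?x t) (nat \<lfloor>real n * v\<rfloor>) - v * (\<lambda>j. \<Sum>t=1..j. ?x t) n\<bar> \<le>
              2 * (\<Sum>t=1..n. A t) + real k / 2 * (L / sqrt (real n)) * (\<Sum>l\<le>p + q. 2 * (\<delta>' * real n) + \<bar>\<mu> l\<bar>)"
          proof (rule bridge_bound[OF n v h_le, where x = ?x])
            show "0 \<le> L / sqrt (real n)" using L by simp
            show "\<bar>?x t + real k / 2 * (\<Sum>l\<le>p + q. h l * noise_score k l (past \<epsilon> (int t) \<omega>))\<bar> \<le> A t" if t: "t \<in> {1..n}" for t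
              unfolding noise_score_past h_def A_def noise_bound_past linearization_error_def[symmetric]
              using ex typical \<eta>_nn en u small[OF t] by blast
            show "\<bar>(\<Sum>t=1..j. noise_score k l (past \<epsilon> (int t) \<omega>)) - real j * \<mu> l\<bar> \<le> \<delta>' * real n"
              if "l \<le> p + q" "j \<le> n" for l j using n3[OF that] .
          qed simp_all
          also have "\<dots> \<le> 2 * (K * (\<eta> n)\<^sup>2 * S2 n \<omega> + Rem \<omega>) +
              real k / 2 * (L / sqrt (real n)) * (\<Sum>l\<le>p + q. 2 * (\<delta>' * real n) + \<bar>\<mu> l\<bar>)"
            using sumA by simp
          finally have "1 / sqrt (real n) * \<bar>(\<lambda>j. \<Sum>t=1..j. ?x t) (nat \<lfloor>real n * v\<rfloor>) - v * (\<lambda>j. \<Sum>t=1..j. ?x t) n\<bar> \<le>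
              1 / sqrt (real n) * (2 * (K * (\<eta> n)\<^sup>2 * S2 n \<omega> + Rem \<omega>) +
              real k / 2 * (L / sqrt (real n)) * (\<Sum>l\<le>p + q. 2 * (\<delta>' * real n) + \<bar>\<mu> l\<bar>))"
            using sn by (intro mult_left_mono) auto
          also have "\<dots> = 2 * K * (\<eta> n)\<^sup>2 / sqrt (real n) * S2 n \<omega> + 2 * Rem \<omega> / sqrt (real n) +
              (real k * L * real (p + q + 1) * \<delta>' + real k * L / 2 * (\<Sum>l\<le>p + q. \<bar>\<mu> l\<bar>) * (1 / real n))"
          proof -
            have e1: "(\<Sum>l\<le>p + q. 2 * (\<delta>' * real n) + \<bar>\<mu> l\<bar>) = real (p + q + 1) * (2 * \<delta>' * real n) + (\<Sum>l\<le>p + q. \<bar>\<mu> l\<bar>)"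
              by (simp add: sum.distrib)
            have e2: "1 / sqrt (real n) * (real k / 2 * (L / sqrt (real n)) * W) = real k * L / 2 * W * (1 / real n)" for W
              using n by simp
            have "1 / sqrt (real n) * (2 * (K * (\<eta> n)\<^sup>2 * S2 n \<omega> + Rem \<omega>) + real k / 2 * (L / sqrt (real n)) * W) =
                2 * K * (\<eta> n)\<^sup>2 / sqrt (real n) * S2 n \<omega> + 2 * Rem \<omega> / sqrt (real n) + real k * L / 2 * W * (1 / real n)" for W
              unfolding distrib_left e2 by simp
            moreover have "real k * L / 2 * (real (p + q + 1) * (2 * \<delta>' * real n) + V) * (1 / real n) =
                real k * L * real (p + q + 1) * \<delta>' + real k * L / 2 * V * (1 / real n)" for V
              using n by (simp add: field_simps)
            ultimately show ?thesis unfolding e1 by simp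
          qed
          also have "\<dots> \<le> \<delta> / 4 + \<delta> / 4 + (\<delta> / 4 + \<delta> / 4)"
          proof (intro add_mono n4 \<delta>'_le)
            show "2 * Rem \<omega> / sqrt (real n) \<le> \<delta> / 4" using n5 sn by (simp add: field_simps)
            show "real k * L / 2 * (\<Sum>l\<le>p + q. \<bar>\<mu> l\<bar>) * (1 / real n) \<le> \<delta> / 4" using \<open>real k * L / 2 * (\<Sum>l\<le>p + q. \<bar>\<mu> l\<bar>) * (1 / real n) < \<delta> / 4\<close> by linarith
          qed
          finally show "1 / sqrt (real n) * \<bar>(\<Sum>t=1..nat \<lfloor>real n * v\<rfloor>. ?x t) - v * (\<Sum>t=1..n. ?x t)\<bar> \<le> \<delta>" by simp
        qed
        then show False using big by simp
      qed
    qed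
  qed
  have B_sets: "?B1 n \<in> sets M" "?B2 n \<in> sets M" "?B3 n \<in> sets M" "?B4 n \<in> sets M" "?B5 n \<in> sets M" for n
    by measurable
  have k8: "0 < \<kappa> / 8" using \<kappa> by simp
  have "eventually (\<lambda>n. prob {\<omega>\<in>space M. \<delta> < \<bar>Q n \<omega>\<bar>} < \<kappa>) sequentially"
    using ev_sub ev1 order_tendstoD(2)[OF lim2 k8] order_tendstoD(2)[OF lim3 k8] order_tendstoD(2)[OF lim4 k8] ev5
  proof eventually_elim
    case (elim n)
    have "prob {\<omega>\<in>space M. \<delta> < \<bar>Q n \<omega>\<bar>} \<le> prob (?B1 n \<union> (?B2 n \<union> (?B3 n \<union> (?B4 n \<union> ?B5 n))))"
      using elim(1) by (intro finite_measure_mono_AE sets.Un B_sets) (auto elim: eventually_mono)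
    also have "\<dots> \<le> prob (?B1 n) + (prob (?B2 n) + (prob (?B3 n) + (prob (?B4 n) + prob (?B5 n))))"
      by (intro order_trans[OF measure_Un_le] add_left_mono sets.Un B_sets order_refl)
    also have "\<dots> < \<kappa>" using elim(2-6) \<kappa> by linarith
    finally show ?case .
  qed
  then show "\<exists>n0. \<forall>n\<ge>n0. norm (prob {\<omega>\<in>space M. \<delta> < \<bar>Q n \<omega>\<bar>} - 0) < \<kappa>"
    by (simp add: eventually_sequentially)
qed

end

theorem theorem1p2:
  fixes M :: "'a measure"
    and p q k :: nat
    and \<theta> :: "nat \<Rightarrow> real"
    and \<epsilon> X \<sigma> :: "int \<Rightarrow> 'a \<Rightarrow> real"
    and ul uu \<rho>0 \<zeta> :: real
    and theta_hat :: "nat \<Rightarrow> 'a \<Rightarrow> nat \<Rightarrow> real"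
  assumes "prob_space M"
    and "p \<ge> 1" and "q \<ge> 1"
    and "\<theta> 0 > 0" and "\<forall>i\<in>{1..p}. \<theta> i \<ge> 0" and "\<forall>j\<in>{1..q}. \<theta> (p + j) \<ge> 0"
    and "iid_family M \<epsilon>"
    and "integrable M (\<epsilon> 0)" and "prob_space.expectation M (\<epsilon> 0) = 0"
    and "integrable M (\<lambda>\<omega>. (\<epsilon> 0 \<omega>)\<^sup>2)" and "prob_space.variance M (\<epsilon> 0) = 1"
    and "bougerol_picard M p q \<theta> \<epsilon>"
    and "garch_stationary_solution M p q \<theta> \<epsilon> X \<sigma>"
    and "0 < ul" and "ul < uu" and "0 < \<rho>0" and "\<rho>0 < 1" and "real q * ul < \<rho>0"
    and "estimator_seq M (p + q) X theta_hat"
    and "k \<ge> 1"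
    and "\<theta> \<in> product_topology (\<lambda>_. euclideanreal) {..p+q} interior_of Theta p q ul uu \<rho>0"
    and "big_OP_1 M (\<lambda>n \<omega>. sqrt (real n) * maxnorm (p + q) (\<lambda>i. theta_hat n \<omega> i - \<theta> i))"
    and "\<zeta> > 0"
    and "((\<lambda>x. x powr (- \<zeta>) * measure M {\<omega>\<in>space M. \<bar>\<epsilon> 0 \<omega>\<bar> \<le> x}) \<longlongrightarrow> 0) (at_right 0)"
    and "integrable M (\<lambda>\<omega>. \<bar>\<epsilon> 0 \<omega>\<bar> ^ k)"
  shows "little_oP_1 M (\<lambda>n \<omega>.
    let S_hat = partial_sum k n (residual p q (theta_hat n \<omega>) (\<lambda>s. X s \<omega>));
        S = partial_sum k n (\<lambda>t. \<epsilon> (int t) \<omega>)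
    in SUP u\<in>{0..1::real}.
         1 / sqrt (real n) * \<bar>(S_hat u - u * S_hat 1) - (S u - u * S 1)\<bar>)"
proof -
  have "\<theta> \<in> Theta p q ul uu \<rho>0" by (rule subsetD[OF interior_of_subset assms(21)])
  then have beta: "(\<Sum>j=1..q. \<theta> (p + j)) \<le> \<rho>0" and ul: "\<And>l. l \<le> p + q \<Longrightarrow> ul \<le> \<theta> l"
    by (auto simp: Theta_def)
  interpret iid_noise M \<epsilon>
    using assms(1,7) by (simp add: iid_noise_def iid_noise_axioms_def)
  interpret garch_parameter p q \<theta> \<rho>0
  proof
    show "0 < \<theta> l" if "l \<le> p + q" for l using ul[OF that] \<open>0 < ul\<close> by linarith
  qed (fact assms(3) beta assms(16) assms(17))+
  interpret garch_process M \<epsilon> p q \<theta> \<rho>0 X \<sigma>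
    by standard (fact assms)+
  obtain s R where s: "0 < s" "s \<le> 1" and R: "\<And>t. (\<integral>\<^sup>+\<omega>. ennreal (((\<sigma> t \<omega>)\<^sup>2) powr s) \<partial>M) \<le> ennreal R"
    "\<And>t. (\<integral>\<^sup>+\<omega>. ennreal (((X t \<omega>)\<^sup>2) powr s) \<partial>M) \<le> ennreal R"
    using fractional_moment by blast
  obtain Cr r where r: "0 < Cr" "0 < r" "r < 1" "\<And>i. c i \<le> Cr * r ^ i" using c_decay by blast
  \<comment> \<open>Growth by the factor \<open>b\<close> per step must not destroy the geometric decay of the weights.\<close>
  obtain b :: real where b: "1 < b" "b ^ q * \<rho>0 < 1" "b * r powr (s / 4) < 1"
  proof -
    have "((\<lambda>b. b ^ q * \<rho>0) \<longlongrightarrow> 1 ^ q * \<rho>0) (at_right 1)"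
      "((\<lambda>b. b * r powr (s / 4)) \<longlongrightarrow> 1 * r powr (s / 4)) (at_right 1)"
      by (intro tendsto_intros)+
    moreover have "r powr (s / 4) < 1" using r s powr_less_mono2[of "s / 4" r 1] by simp
    ultimately have "eventually (\<lambda>b. b ^ q * \<rho>0 < 1) (at_right 1)" "eventually (\<lambda>b. b * r powr (s / 4) < 1) (at_right 1)"
      using rho by (auto intro!: order_tendstoD(2))
    then have "eventually (\<lambda>b. 1 < b \<and> b ^ q * \<rho>0 < 1 \<and> b * r powr (s / 4) < 1) (at_right (1::real))"
      using eventually_at_right_less[of "1::real"] by eventually_elim simp
    from eventually_happens[OF this] show thesis using that by auto
  qed
  obtain C \<eta>0 where C: "1 \<le> C" "0 < \<eta>0" "\<eta>0 \<le> 1"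
    "\<forall>\<eta> u i. 0 \<le> \<eta> \<longrightarrow> \<eta> \<le> \<eta>0 \<longrightarrow> (\<forall>l\<le>p + q. \<bar>u l - \<theta> l\<bar> \<le> \<eta> * \<theta> l) \<longrightarrow>
      \<bar>garch_c p q u i - c i\<bar> \<le> \<eta> * (C * b ^ i * c i) \<and>
      \<bar>garch_c p q u i - c i - (\<Sum>l\<le>p + q. (u l - \<theta> l) * dc l i)\<bar> \<le> \<eta>\<^sup>2 * (C * b ^ i * c i)"
    "\<forall>l\<le>p + q. \<forall>i. \<theta> l * dc l i \<le> C * b ^ i * c i"
    using c_expansion[OF b(1)] by blast
  interpret garch_estimates M \<epsilon> p q \<theta> \<rho>0 X \<sigma> s R Cr r b C \<eta>0
  proof
    show "\<bar>garch_c p q u i - c i\<bar> \<le> \<eta> * (C * b ^ i * c i) \<and>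
        \<bar>garch_c p q u i - c i - (\<Sum>l\<le>p + q. (u l - \<theta> l) * dc l i)\<bar> \<le> \<eta>\<^sup>2 * (C * b ^ i * c i)"
      if "0 \<le> \<eta>" "\<eta> \<le> \<eta>0" "\<forall>l\<le>p + q. \<bar>u l - \<theta> l\<bar> \<le> \<eta> * \<theta> l" for \<eta> u i
      using C(4) that by blast
    show "\<theta> l * dc l i \<le> C * b ^ i * c i" if "l \<le> p + q" for l i using C(5) that by blast
  qed (fact s R r b C)+
  define e where "e n \<omega> t = residual p q (theta_hat n \<omega>) (\<lambda>s. X s \<omega>) t ^ k - \<epsilon> (int t) \<omega> ^ k" for n \<omega> t
  define a where "a n \<omega> j = (\<Sum>t=1..j. e n \<omega> t)" for n \<omega> j
  define Q where "Q n \<omega> = (SUP u\<in>{0..1::real}. 1 / sqrt (real n) * \<bar>a n \<omega> (nat \<lfloor>real n * u\<rfloor>) - u * a n \<omega> n\<bar>)" for n \<omega>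
  have Q_eq: "(\<lambda>n \<omega>. let S_hat = partial_sum k n (residual p q (theta_hat n \<omega>) (\<lambda>s. X s \<omega>));
        S = partial_sum k n (\<lambda>t. \<epsilon> (int t) \<omega>)
    in SUP u\<in>{0..1::real}. 1 / sqrt (real n) * \<bar>(S_hat u - u * S_hat 1) - (S u - u * S 1)\<bar>) = Q"
  proof (intro ext)
    fix n \<omega>
    have "(partial_sum k n (residual p q (theta_hat n \<omega>) (\<lambda>s. X s \<omega>)) u
          - u * partial_sum k n (residual p q (theta_hat n \<omega>) (\<lambda>s. X s \<omega>)) 1)
        - (partial_sum k n (\<lambda>t. \<epsilon> (int t) \<omega>) u - u * partial_sum k n (\<lambda>t. \<epsilon> (int t) \<omega>) 1)
        = a n \<omega> (nat \<lfloor>real n * u\<rfloor>) - u * a n \<omega> n" for u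
      by (simp add: partial_sum_def a_def e_def sum_subtractf algebra_simps)
    then show "(let S_hat = partial_sum k n (residual p q (theta_hat n \<omega>) (\<lambda>s. X s \<omega>));
        S = partial_sum k n (\<lambda>t. \<epsilon> (int t) \<omega>)
      in SUP u\<in>{0..1::real}. 1 / sqrt (real n) * \<bar>(S_hat u - u * S_hat 1) - (S u - u * S 1)\<bar>) = Q n \<omega>"
      unfolding Let_def Q_def by presburger
  qed
  have a_meas: "(\<lambda>\<omega>. a n \<omega> j) \<in> borel_measurable M" for n j
  proof -
    have [measurable]: "(\<lambda>\<omega>. residual p q (theta_hat n \<omega>) (\<lambda>s. X s \<omega>) t) \<in> borel_measurable M" for t
      by (intro measurable_residual estimator_component_measurable[OF assms(19)] measurable_X)
    show ?thesis unfolding a_def e_def by measurable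
  qed
  have Q_meas: "Q n \<in> borel_measurable M" for n
  proof (cases "n = 0")
    case True
    then show ?thesis by (simp add: Q_def[abs_def])
  next
    case False
    note [measurable] = a_meas
    have "Q n = (\<lambda>\<omega>. Max ((\<lambda>j. max (1 / sqrt (real n) * \<bar>a n \<omega> j - real j / real n * a n \<omega> n\<bar>)
        (1 / sqrt (real n) * \<bar>a n \<omega> j - real (Suc j) / real n * a n \<omega> n\<bar>)) ` {..<n}))"
      unfolding Q_def[abs_def] using False by (intro ext sup_bridge_eq_Max(2)) auto
    then show ?thesis by simp
  qed
  have Q_le: "\<bar>Q n \<omega>\<bar> \<le> B"
    if n: "0 < n" and B: "\<And>u. 0 \<le> u \<Longrightarrow> u \<le> 1 \<Longrightarrow> 1 / sqrt (real n) * \<bar>a n \<omega> (nat \<lfloor>real n * u\<rfloor>) - u * a n \<omega> n\<bar> \<le> B" for n \<omega> B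
  proof -
    have bdd: "bdd_above ((\<lambda>u. 1 / sqrt (real n) * \<bar>a n \<omega> (nat \<lfloor>real n * u\<rfloor>) - u * a n \<omega> n\<bar>) ` {0..1})"
      by (rule sup_bridge_eq_Max(1)[OF n]) simp
    have "0 \<le> 1 / sqrt (real n) * \<bar>a n \<omega> (nat \<lfloor>real n * 0\<rfloor>) - 0 * a n \<omega> n\<bar>" by simp
    also have "\<dots> \<le> Q n \<omega>" unfolding Q_def by (rule cSUP_upper[OF _ bdd]) simp
    finally have "0 \<le> Q n \<omega>" .
    moreover have "Q n \<omega> \<le> B" unfolding Q_def by (rule cSUP_least) (use B in auto)
    ultimately show ?thesis by simp
  qed
  have "(\<lambda>n. prob {\<omega>\<in>space M. \<delta> < \<bar>Q n \<omega>\<bar>}) \<longlonglongrightarrow> 0" if "0 < \<delta>" for \<delta>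
    by (rule bridge_difference_tendsto[OF assms(25,22) Q_meas _ that]) (rule Q_le, assumption, simp add: a_def e_def)
  then show ?thesis unfolding Q_eq little_oP_1_def using Q_meas by simp
qed

end
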